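(* Let $w\in S_\mathbb{Z}$, $n\ge1$, and $A\subseteq\mathrm{Inv}(w)$. When nonempty, the sets $\mathrm{RF}^+_n(w,A)$ and $\mathrm{RF}^+_n(w)$, with weight function $\mathrm{wt}$ and crystal operators $e_i,f_i$ ($i\in[n-1]$) as defined below, are normal $\mathfrak{gl}_n$-crystals, and the map $\mathsf{unprime}:\mathrm{RF}^+_n(w,A)\to\mathrm{RF}_n(w)$ is a $\mathfrak{gl}_n$-crystal isomorphism.
   Context: $S_\mathbb{Z}$ is the group of finitary permutations of $\mathbb{Z}$ generated by $s_i=(i\ i+1)$; $\mathcal{R}(w)$ is the set of reduced words of $w$; $\mathrm{Inv}(w)=\{(a,b)\in\mathbb{Z}^2:a<b,\ w(a)>w(b)\}$. Primed letters: $\mathbb{Z}'=\{m-\tfrac12\}$, $m'=m-\tfrac12$, order $\cdots<1'<1<2'<2<\cdots$, $\lceil\cdot\rceil$ removes primes (letterwise on words). For a primed word $i=i_1\cdots i_\ell$ with $\lceil i\rceil\in\mathcal{R}(w)$ put $a_j=s_{\lceil i_\ell\rceil}\cdots s_{\lceil i_{j+1}\rceil}(\lceil i_j\rceil)$, $b_j=s_{\lceil i_\ell\rceil}\cdots s_{\lceil i_{j+1}\rceil}(\lceil i_j\rceil+1)$, and $\mathrm{Marked}(i)=\{(a_j,b_j):i_j\in\mathbb{Z}'\}$. $\mathrm{RF}^+_n(w)$ is the set of $n$-tuples $a=(a^1,\dots,a^n)$ of strictly decreasing primed words whose concatenation $i$ has $\lceil i\rceil\in\mathcal{R}(w)$;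 $\mathrm{RF}^+_n(w,A)$ is the subset with $\mathrm{Marked}(a^1\cdots a^n)=A$; $\mathrm{RF}_n(w)=\mathrm{RF}^+_n(w,\emptyset)$ (no primes); $\mathsf{unprime}(a)=(\lceil a^1\rceil,\dots,\lceil a^n\rceil)$; $\mathrm{wt}(a)=(\ell(a^1),\dots,\ell(a^n))$. Pairing of strictly decreasing primed words $(u,v)$: letters $c$ of $v$, taken right to left, are paired with the largest unpaired $b\in u$ with $\lceil b\rceil<\lceil c\rceil$. Swapping the primes on two letters reverses both primes if exactly one is primed, and does nothing otherwise. For $i\in[n-1]$: $e_ia=\mathbf{0}$ if all letters of $a^{i+1}$ are paired in the pairing of $(a^i,a^{i+1})$; else let $x$ be the largest unpaired letter of $a^{i+1}$, $q\ge0$ minimal with $\lceil x\rceil+q\notin\lceil a^i\rceil$; remove $x$ from $a^{i+1}$, insert $x+q$ into $a^i$ in decreasing position, and swap the primes on each pair $(b,c)$ with $\lceil x\rceil+q\ge\lceil c\rceil>\lceil x\rceil$. $f_ia=\mathbf{0}$ if all letters of $a^i$ are paired; else let $y$ be the smallest unpaired letter of $a^i$, $q\ge0$ minimal with $\lceil y\rceil-q\notin\lceil a^{i+1}\rceil$; remove $y$ from $a^i$, insert $y-q$ into $a^{i+1}$, and swap the primes on each pair $(b,c)$ with $\lceil y\rceil>\lceil b\rceil\ge\lceil y\rceil-q$. The statistics are $\varepsilon_i(a)=\max\{k:e_i^ka\ne\mathbf{0}\}$, $\varphi_i(a)=\max\{k:f_i^ka\ne\mathbf{0}\}$. Normal $\mathfrak{gl}_n$-crystals: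 the standard crystal is $\{1,\dots,n\}$ with $\mathrm{wt}(j)=\mathbf{e}_j$, $f_i(i)=i+1$ and $f_i(j)=\mathbf{0}$ otherwise. On $b_1\otimes\cdots\otimes b_m$ (weight the sum of weights) $e_i,f_i$ act by the signature rule: write ")" for each factor equal to $i$ and "(" for each factor equal to $i+1$, cancel adjacent "()" pairs repeatedly to get $)^p(^q$; $e_i$ changes the factor of the leftmost unmatched "(" to $i$ ($\mathbf{0}$ if $q=0$), and $f_i$ changes the factor of the rightmost unmatched ")" to $i+1$ ($\mathbf{0}$ if $p=0$). A normal $\mathfrak{gl}_n$-crystal is a set with weight map and operators $e_i,f_i$ ($i\in[n-1]$) admitting a weight-preserving bijection commuting with all $e_i,f_i$ onto a finite disjoint union of connected components of such tensor powers. A $\mathfrak{gl}_n$-crystal isomorphism is a weight-preserving bijection commuting with all $e_i,f_i$. *)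

theory Defs
  imports Complex_Main "HOL-Combinatorics.Permutations"
begin

text \<open>
  The group of finitary permutations of the integers consists of the functions
  \<open>w :: int \<Rightarrow> int\<close> with \<open>permutation w\<close>; the library lemma \<open>permutation\<close> says that this means
  \<open>bij w \<and> finite {x. w x \<noteq> x}\<close>.
\<close>

definition word_perm :: "int list \<Rightarrow> int \<Rightarrow> int" where
  "word_perm is = foldr (\<lambda>i g. transpose i (i + 1) \<circ> g) is id"

definition reduced_words :: "(int \<Rightarrow> int) \<Rightarrow> int list set" where
  "reduced_words w = {is. word_perm is = w \<and> (\<forall>js. word_perm js = w \<longrightarrow> length is \<le> length js)}"

definition Inv :: "(int \<Rightarrow> int) \<Rightarrow> (int \<times> int) set" where
  "Inv w = {(a, b). a < b \<and> w a > w b}"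

text \<open>
  A letter is a rational number in \<open>\<int> \<union> \<int>'\<close> where \<open>m' = m - 1/2\<close>, so the order on letters is the
  usual one and removing a prime is \<^const>\<open>ceiling\<close>.
\<close>

definition primed_ints :: "rat set" where
  "primed_ints = {of_int m - 1 / 2 | m. True}"

definition primed_word :: "rat list \<Rightarrow> bool" where
  "primed_word u \<longleftrightarrow> set u \<subseteq> \<int> \<union> primed_ints"

definition strictly_decreasing :: "rat list \<Rightarrow> bool" where
  "strictly_decreasing u \<longleftrightarrow> sorted_wrt (>) u"

definition toggle_prime :: "rat \<Rightarrow> rat" where
  "toggle_prime x = (if x \<in> primed_ints then x + 1 / 2 else x - 1 / 2)"

text \<open>
  Positions are counted from 0.  In \<open>marked\<close>, \<open>g\<close> is the product of the transpositions of all
  letters to the right of position \<open>j\<close>, with the last letter leftmost.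
\<close>

definition marked :: "rat list \<Rightarrow> (int \<times> int) set" where
  "marked is =
     {(g \<lceil>is ! j\<rceil>, g (\<lceil>is ! j\<rceil> + 1)) | j g.
        j < length is \<and> is ! j \<in> primed_ints \<and> g = word_perm (rev (drop (Suc j) (map ceiling is)))}"

definition RF_plus :: "nat \<Rightarrow> (int \<Rightarrow> int) \<Rightarrow> rat list list set" where
  "RF_plus n w =
     {a. length a = n \<and> (\<forall>u \<in> set a. primed_word u \<and> strictly_decreasing u) \<and>
         map ceiling (concat a) \<in> reduced_words w}"

definition RF_plus_marked :: "nat \<Rightarrow> (int \<Rightarrow> int) \<Rightarrow> (int \<times> int) set \<Rightarrow> rat list list set" where
  "RF_plus_marked n w A = {a \<in> RF_plus n w. marked (concat a) = A}"

definition RF :: "nat \<Rightarrow> (int \<Rightarrow> int) \<Rightarrow> rat list list set" where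
  "RF n w = RF_plus_marked n w {}"

definition unprime :: "rat list list \<Rightarrow> rat list list" where
  "unprime a = map (map (\<lambda>x. of_int \<lceil>x\<rceil>)) a"

text \<open>
  The first argument is the set of still unpaired letters of \<open>u\<close>, the second the list of
  letters of \<open>v\<close> still to be treated, in the order in which they are treated.
\<close>

fun pairing_from :: "rat set \<Rightarrow> rat list \<Rightarrow> (rat \<times> rat) set" where
  "pairing_from U [] = {}"
| "pairing_from U (c # cs) =
     (let B = {b \<in> U. \<lceil>b\<rceil> < \<lceil>c\<rceil>}
      in if B = {} then pairing_from U cs
         else insert (Max B, c) (pairing_from (U - {Max B}) cs))"

definition pairing :: "rat list \<Rightarrow> rat list \<Rightarrow> (rat \<times> rat) set" where
  "pairing u v = pairing_from (set u) (rev v)"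

definition insert_decreasing :: "rat \<Rightarrow> rat list \<Rightarrow> rat list" where
  "insert_decreasing y u = takeWhile (\<lambda>z. z > y) u @ y # dropWhile (\<lambda>z. z > y) u"

text \<open>
  \<open>swap_left Q u\<close> and \<open>swap_right Q v\<close> are the two words after swapping the primes on all pairs
  \<open>(b, c) \<in> Q\<close>; every letter occurs in at most one pair of a pairing, so the swaps are independent.
\<close>

definition swap_left :: "(rat \<times> rat) set \<Rightarrow> rat list \<Rightarrow> rat list" where
  "swap_left Q u =
     map (\<lambda>b. if \<exists>c. (b, c) \<in> Q \<and> (b \<in> primed_ints) \<noteq> (c \<in> primed_ints)
              then toggle_prime b else b) u"

definition swap_right :: "(rat \<times> rat) set \<Rightarrow> rat list \<Rightarrow> rat list" where
  "swap_right Q v =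
     map (\<lambda>c. if \<exists>b. (b, c) \<in> Q \<and> (b \<in> primed_ints) \<noteq> (c \<in> primed_ints)
              then toggle_prime c else c) v"

definition e_pair :: "rat list \<Rightarrow> rat list \<Rightarrow> (rat list \<times> rat list) option" where
  "e_pair u v =
     (let P = pairing u v; N = {c \<in> set v. c \<notin> snd ` P}
      in if N = {} then None
         else let x = Max N;
                  q = (LEAST q::nat. \<lceil>x\<rceil> + int q \<notin> ceiling ` set u);
                  Q = {(b, c) \<in> P. \<lceil>x\<rceil> + int q \<ge> \<lceil>c\<rceil> \<and> \<lceil>c\<rceil> > \<lceil>x\<rceil>}
              in Some (insert_decreasing (x + of_nat q) (swap_left Q u),
                       swap_right Q (remove1 x v)))"

definition f_pair :: "rat list \<Rightarrow> rat list \<Rightarrow> (rat list \<times> rat list) option" where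
  "f_pair u v =
     (let P = pairing u v; N = {b \<in> set u. b \<notin> fst ` P}
      in if N = {} then None
         else let y = Min N;
                  q = (LEAST q::nat. \<lceil>y\<rceil> - int q \<notin> ceiling ` set v);
                  Q = {(b, c) \<in> P. \<lceil>y\<rceil> > \<lceil>b\<rceil> \<and> \<lceil>b\<rceil> \<ge> \<lceil>y\<rceil> - int q}
              in Some (swap_left Q (remove1 y u),
                       insert_decreasing (y - of_nat q) (swap_right Q v)))"

text \<open>The factor \<open>a\<^sup>i\<close>, \<open>1 \<le> i \<le> n\<close>, is \<open>a ! (i - 1)\<close>; the value \<open>\<^bold>0\<close> is \<^const>\<open>None\<close>.\<close>

definition on_factors ::
  "(rat list \<Rightarrow> rat list \<Rightarrow> (rat list \<times> rat list) option) \<Rightarrow> nat \<Rightarrow> rat list list \<Rightarrow> rat list list option"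
  where
  "on_factors op i a =
     map_option (\<lambda>(u, v). a[i - 1 := u, i := v]) (op (a ! (i - 1)) (a ! i))"

definition factor_wt :: "rat list list \<Rightarrow> nat \<Rightarrow> int" where
  "factor_wt a i = (if 1 \<le> i \<and> i \<le> length a then int (length (a ! (i - 1))) else 0)"

text \<open>
  A weight in \<open>\<int>\<^sup>n\<close> is a function on the indices \<open>1, \<dots>, n\<close>. The operators are relevant only for
  the indices \<open>1 \<le> i < n\<close>.
\<close>

record 'a crystal =
  elems :: "'a set"
  wt :: "'a \<Rightarrow> nat \<Rightarrow> int"
  e_op :: "nat \<Rightarrow> 'a \<Rightarrow> 'a option"
  f_op :: "nat \<Rightarrow> 'a \<Rightarrow> 'a option"

definition ops_closed :: "nat \<Rightarrow> 'a crystal \<Rightarrow> bool" where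
  "ops_closed n X \<longleftrightarrow>
     (\<forall>i \<in> {1..<n}. \<forall>b \<in> elems X.
        set_option (e_op X i b) \<subseteq> elems X \<and> set_option (f_op X i b) \<subseteq> elems X)"

definition crystal_iso :: "nat \<Rightarrow> 'a crystal \<Rightarrow> 'b crystal \<Rightarrow> ('a \<Rightarrow> 'b) \<Rightarrow> bool" where
  "crystal_iso n X Y h \<longleftrightarrow>
     ops_closed n X \<and> ops_closed n Y \<and> bij_betw h (elems X) (elems Y) \<and>
     (\<forall>b \<in> elems X. \<forall>j \<in> {1..n}. wt Y (h b) j = wt X b j) \<and>
     (\<forall>b \<in> elems X. \<forall>i \<in> {1..<n}.
        e_op Y i (h b) = map_option h (e_op X i b) \<and> f_op Y i (h b) = map_option h (f_op X i b))"

text \<open>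
  Elements \<open>b\<^sub>1 \<otimes> \<dots> \<otimes> b\<^sub>m\<close> of a tensor power of the standard crystal are lists.  The signature
  consists of the positions with entry \<open>i\<close>, i.e. closing brackets, or \<open>i + 1\<close>, i.e. opening
  brackets; \<open>cancel_cons\<close> prepends a bracket to a fully cancelled signature, cancelling an
  opening bracket against an immediately following closing one.
\<close>

definition signature :: "nat \<Rightarrow> nat list \<Rightarrow> (nat \<times> nat) list" where
  "signature i b = filter (\<lambda>(k, x). x = i \<or> x = Suc i) (enumerate 0 b)"

fun cancel_cons :: "nat \<Rightarrow> nat \<times> nat \<Rightarrow> (nat \<times> nat) list \<Rightarrow> (nat \<times> nat) list" where
  "cancel_cons i p [] = [p]"
| "cancel_cons i p (r # rs) = (if snd p = Suc i \<and> snd r = i then rs else p # r # rs)"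

definition cancelled_signature :: "nat \<Rightarrow> nat list \<Rightarrow> (nat \<times> nat) list" where
  "cancelled_signature i b = foldr (cancel_cons i) (signature i b) []"

definition unmatched_positions :: "nat \<Rightarrow> nat list \<Rightarrow> nat \<Rightarrow> nat list" where
  "unmatched_positions i b x = map fst (filter (\<lambda>p. snd p = x) (cancelled_signature i b))"

definition tensor_e :: "nat \<Rightarrow> nat list \<Rightarrow> nat list option" where
  "tensor_e i b =
     (let ks = unmatched_positions i b (Suc i) in if ks = [] then None else Some (b[hd ks := i]))"

definition tensor_f :: "nat \<Rightarrow> nat list \<Rightarrow> nat list option" where
  "tensor_f i b =
     (let ks = unmatched_positions i b i in if ks = [] then None else Some (b[last ks := Suc i]))"

definition tensor_power :: "nat \<Rightarrow> nat \<Rightarrow> nat list crystal" where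
  "tensor_power n m =
     \<lparr>elems = {b. length b = m \<and> set b \<subseteq> {1..n}},
      wt = (\<lambda>b j. \<Sum>x\<leftarrow>b. if x = j then 1 else 0),
      e_op = tensor_e,
      f_op = tensor_f\<rparr>"

definition crystal_edges :: "nat \<Rightarrow> 'a crystal \<Rightarrow> ('a \<times> 'a) set" where
  "crystal_edges n X =
     {(b, c). b \<in> elems X \<and> c \<in> elems X \<and>
        (\<exists>i \<in> {1..<n}. e_op X i b = Some c \<or> f_op X i b = Some c)}"

definition crystal_component :: "nat \<Rightarrow> 'a crystal \<Rightarrow> 'a crystal \<Rightarrow> bool" where
  "crystal_component n X C \<longleftrightarrow>
     (\<exists>b \<in> elems X.
        C = X\<lparr>elems := {c. (b, c) \<in> (crystal_edges n X \<union> (crystal_edges n X)\<inverse>)\<^sup>*}\<rparr>)"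

definition disjoint_union :: "'a crystal list \<Rightarrow> (nat \<times> 'a) crystal" where
  "disjoint_union Cs =
     \<lparr>elems = {(k, c). k < length Cs \<and> c \<in> elems (Cs ! k)},
      wt = (\<lambda>(k, c). wt (Cs ! k) c),
      e_op = (\<lambda>i (k, c). map_option (Pair k) (e_op (Cs ! k) i c)),
      f_op = (\<lambda>i (k, c). map_option (Pair k) (f_op (Cs ! k) i c))\<rparr>"

definition normal_crystal :: "nat \<Rightarrow> 'a crystal \<Rightarrow> bool" where
  "normal_crystal n X \<longleftrightarrow>
     (\<exists>Cs h. (\<forall>C \<in> set Cs. \<exists>m. crystal_component n (tensor_power n m) C) \<and>
             crystal_iso n X (disjoint_union Cs) h)"

definition factorization_crystal :: "rat list list set \<Rightarrow> rat list list crystal" where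
  "factorization_crystal S =
     \<lparr>elems = S, wt = factor_wt, e_op = on_factors e_pair, f_op = on_factors f_pair\<rparr>"

end

theory Submission imports Defs "HOL-Library.Multiset" begin

text \<open>
  In a reduced word the letters are labelled bijectively by the inversions of the permutation, so a
  primed word is determined by the underlying word and its set of marked inversions. On a pair of
  factors the operators act by commutations and braid moves along a common run; these moves carry the
  labels along, and the prime swaps are exactly what keeps the marked inversions fixed. Hence
  \<^const>\<open>unprime\<close> commutes with the operators and is bijective on each set of fixed marks.

  For normality, insert the factors successively, by Edelman--Greene insertion, into a row of widely
  spaced letters above all letters of the word, and replace every factor by the letters it bumps.
  Insertion respects Coxeter--Knuth equivalence, the operators stay in the Coxeter--Knuth class, and a
  product of two decreasing words is determined by its class and the lengths of the factors; therefore
  insertion commutes with the operators and the final row is constant on components. After finitely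
  many passes all letters are distinct and far apart, and then the operators follow the signature rule
  on the word of factor indices, read in decreasing order of the letters. That word together with the
  final rows and the marked inversions determines the factorization.
\<close>

subsection \<open>Reduced words\<close>

text \<open>The letters bumped by the factors form a factorization with the same factor lengths, so
  a single row, used repeatedly, does the work of a whole tableau. The delicate point is that a pass
  commutes with the operators. The pairings before and after a pass are not compared. An operator is
  recognized by its result, the only pair of decreasing words in the Coxeter--Knuth class with the
  required lengths. Both facts behind this, that raising stays in the class and that class and
  lengths determine the pair, are proved by induction on the number of letters: a frame of two large
  letters traps one or two letters of the pair and leaves a smaller pair, on which raising is still
  visible as raising. The pairing itself enters through a lattice path whose first minimum is the
  letter moved by \<open>e_i\<close>. Reversing a word and negating its letters exchanges the two
  factors and the two operators. Lowering is therefore raising seen through this symmetry, and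
  reverse insertion is again insertion.\<close>

abbreviation adj_transp :: "int \<Rightarrow> int \<Rightarrow> int" where
  "adj_transp i \<equiv> transpose i (i + 1)"

definition reduced :: "int list \<Rightarrow> bool" where
  "reduced c \<longleftrightarrow> c \<in> reduced_words (word_perm c)"

lemma word_perm_Nil [simp]: "word_perm [] = id"
  by (simp add: word_perm_def)

lemma word_perm_Cons: "word_perm (i # c) = adj_transp i \<circ> word_perm c"
  by (simp add: word_perm_def)

lemma word_perm_append: "word_perm (c @ d) = word_perm c \<circ> word_perm d"
  by (induction c) (simp_all add: word_perm_Cons comp_assoc)

lemma word_perm_snoc: "word_perm (c @ [i]) = word_perm c \<circ> adj_transp i"
  by (simp add: word_perm_append word_perm_Cons)

lemma word_perm_rev_comp: "word_perm (rev c) \<circ> word_perm c = id"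
proof (induction c)
  case (Cons i c)
  have "word_perm (rev (i # c)) \<circ> word_perm (i # c) =
        word_perm (rev c) \<circ> (adj_transp i \<circ> adj_transp i) \<circ> word_perm c"
    by (simp add: word_perm_append word_perm_Cons comp_assoc del: transpose_comp_involutory)
  then show ?case using Cons by simp
qed simp

lemma permutation_word_perm: "permutation (word_perm c)"
  by (induction c) (simp_all only: word_perm_Cons word_perm_Nil permutation_id permutation_compose permutation_swap_id)

lemma bij_word_perm: "bij (word_perm c)"
  by (rule permutation_bijective[OF permutation_word_perm])

lemma inj_word_perm: "inj (word_perm c)"
  using bij_word_perm by (rule bij_is_inj)

lemma word_perm_rev_eq: "word_perm c = word_perm d \<Longrightarrow> word_perm (rev c) = word_perm (rev d)"
proof -
  assume a: "word_perm c = word_perm d"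
  have "word_perm (rev c) k = word_perm (rev d) k" for k
  proof -
    have "word_perm (rev c) (word_perm d (word_perm (rev d) k)) = word_perm (rev d) k"
      using fun_cong[OF word_perm_rev_comp[of c], of "word_perm (rev d) k"] a by simp
    then show ?thesis using fun_cong[OF word_perm_rev_comp[of "rev d"], of k] by simp
  qed
  then show ?thesis by blast
qed

lemma reduced_iff: "reduced c \<longleftrightarrow> (\<forall>d. word_perm d = word_perm c \<longrightarrow> length c \<le> length d)"
  by (auto simp: reduced_def reduced_words_def)

lemma reduced_words_iff: "c \<in> reduced_words w \<longleftrightarrow> word_perm c = w \<and> reduced c"
  by (auto simp: reduced_def reduced_words_def)

lemma reduced_appendD:
  assumes "reduced (c @ d)"
  shows "reduced c" and "reduced d"
proof -
  have "length c \<le> length c'" if "word_perm c' = word_perm c" for c'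
    using assms[unfolded reduced_iff, rule_format, of "c' @ d"] that by (simp add: word_perm_append)
  then show "reduced c" by (simp add: reduced_iff)
  have "length d \<le> length d'" if "word_perm d' = word_perm d" for d'
    using assms[unfolded reduced_iff, rule_format, of "c @ d'"] that by (simp add: word_perm_append)
  then show "reduced d" by (simp add: reduced_iff)
qed

lemma reduced_cong:
  "word_perm c = word_perm d \<Longrightarrow> length c = length d \<Longrightarrow> reduced c \<longleftrightarrow> reduced d"
  by (simp add: reduced_iff)

lemma reduced_middleD: "reduced (p @ c @ s) \<Longrightarrow> reduced c"
  using reduced_appendD by blast

lemma word_perm_commute:
  "\<bar>i - j\<bar> \<ge> 2 \<Longrightarrow> adj_transp i \<circ> adj_transp j = adj_transp j \<circ> adj_transp i"
  by (rule ext) (auto simp: transpose_def)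

lemma word_perm_braid:
  "adj_transp i \<circ> (adj_transp (i + 1) \<circ> adj_transp i) =
   adj_transp (i + 1) \<circ> (adj_transp i \<circ> adj_transp (i + 1))"
  by (rule ext) (auto simp: transpose_def)

lemma word_perm_commute_word:
  assumes "\<forall>j \<in> set c. \<bar>i - j\<bar> \<ge> 2"
  shows "adj_transp i \<circ> word_perm c = word_perm c \<circ> adj_transp i"
proof (rule ext)
  fix k
  show "(adj_transp i \<circ> word_perm c) k = (word_perm c \<circ> adj_transp i) k"
    using assms
  proof (induction c)
    case (Cons j c)
    have "(adj_transp i \<circ> adj_transp j) l = (adj_transp j \<circ> adj_transp i) l" for l
      using Cons.prems by (subst word_perm_commute) simp_all
    then show ?case using Cons by (simp add: word_perm_Cons)
  qed simp
qed

text \<open>The first \<open>i\<close> commutes through \<open>c\<close> and cancels against the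
  last one. Reducedness is exploited below mostly in this form.\<close>

lemma not_reduced_repeat:
  assumes "\<forall>j \<in> set c. \<bar>i - j\<bar> \<ge> 2"
  shows "\<not> reduced (i # c @ [i])"
proof
  assume "reduced (i # c @ [i])"
  moreover have "word_perm (i # c @ [i]) = (adj_transp i \<circ> word_perm c) \<circ> adj_transp i"
    by (simp only: word_perm_append word_perm_Cons word_perm_Nil comp_id comp_assoc)
  then have "word_perm (i # c @ [i]) = word_perm c"
    by (simp only: word_perm_commute_word[OF assms] comp_assoc transpose_comp_involutory comp_id)
  ultimately show False using reduced_iff[of "i # c @ [i]"] by fastforce
qed

lemma reduced_rev: "reduced (rev c) \<longleftrightarrow> reduced c"
proof -
  have "reduced (rev c)" if "reduced c" for c
    unfolding reduced_iff
  proof (intro allI impI)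
    fix d assume "word_perm d = word_perm (rev c)"
    from word_perm_rev_eq[OF this] have "word_perm (rev d) = word_perm c" by simp
    with that[unfolded reduced_iff, rule_format, of "rev d"] show "length (rev c) \<le> length d" by simp
  qed
  from this[of c] this[of "rev c"] show ?thesis by auto
qed

text \<open>Negating letters turns the swap of \<open>i\<close> and \<open>i + 1\<close> into the
  swap of \<open>- i\<close> and \<open>1 - i\<close>. The conjugating map is therefore
  \<open>k -> 1 - k\<close> and not \<open>k -> - k\<close>.\<close>

definition reflect :: "int \<Rightarrow> int" where "reflect k = 1 - k"

lemma word_perm_uminus: "word_perm (map uminus c) = reflect \<circ> word_perm c \<circ> reflect"
proof (induction c)
  case Nil
  show ?case by (auto simp: reflect_def)
next
  case (Cons i c)
  have "adj_transp (- i) (reflect k) = reflect (adj_transp i k)" for k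
    by (auto simp: transpose_def reflect_def)
  moreover have "reflect (reflect k) = k" for k by (simp add: reflect_def)
  ultimately show ?case using Cons by (simp add: word_perm_Cons fun_eq_iff)
qed

lemma reduced_uminus: "reduced (map uminus c) \<longleftrightarrow> reduced c"
proof -
  have "reduced (map uminus c)" if "reduced c" for c
    unfolding reduced_iff
  proof (intro allI impI)
    fix d assume a: "word_perm d = word_perm (map uminus c)"
    have "word_perm (map uminus d) = word_perm c"
      unfolding word_perm_uminus a by (auto simp: reflect_def)
    with that[unfolded reduced_iff, rule_format, of "map uminus d"] show "length (map uminus c) \<le> length d" by simp
  qed
  from this[of c] this[of "map uminus c"] show ?thesis by (auto simp: comp_def)
qed

subsection \<open>Inversions\<close>

lemma Inv_id [simp]: "Inv id = {}" "Inv (\<lambda>a. a) = {}"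
  by (auto simp: Inv_def)

abbreviation pair_transp :: "int \<Rightarrow> int \<times> int \<Rightarrow> int \<times> int" where
  "pair_transp i \<equiv> map_prod (adj_transp i) (adj_transp i)"

lemma pair_transp_involutory [simp]: "pair_transp i (pair_transp i x) = x"
  by (cases x) simp

text \<open>Multiplying by \<open>adj_transp i\<close> on the right relabels positions; apart from
  the relabelling, only the pair \<open>(i, i + 1)\<close> changes its status.\<close>

lemma Inv_comp_transp:
  assumes "inj p" and "p i < p (i + 1)"
  shows "Inv (p \<circ> adj_transp i) = insert (i, i + 1) (pair_transp i ` Inv p)"
    and "(i, i + 1) \<notin> pair_transp i ` Inv p"
proof -
  have *: "(a, b) \<in> Inv (p \<circ> adj_transp i) \<longleftrightarrow> pair_transp i (a, b) \<in> Inv p" if "(a, b) \<noteq> (i, i + 1)" for a b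
    using that assms(2) by (auto simp: Inv_def transpose_def)
  have **: "x \<in> pair_transp i ` Inv p \<longleftrightarrow> pair_transp i x \<in> Inv p" for x
    by (metis (no_types, lifting) image_iff pair_transp_involutory)
  show "(i, i + 1) \<notin> pair_transp i ` Inv p" unfolding ** by (simp add: Inv_def)
  show "Inv (p \<circ> adj_transp i) = insert (i, i + 1) (pair_transp i ` Inv p)"
  proof (rule set_eqI)
    fix x show "x \<in> Inv (p \<circ> adj_transp i) \<longleftrightarrow> x \<in> insert (i, i + 1) (pair_transp i ` Inv p)"
    proof (cases "x = (i, i + 1)")
      case True
      then show ?thesis using assms(2) by (simp add: Inv_def)
    next
      case False
      obtain a b where x: "x = (a, b)" by (cases x)
      then have "(a, b) \<noteq> (i, i + 1)" using False by simp
      from *[OF this] show ?thesis using ** False unfolding x by blast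
    qed
  qed
qed

lemma Inv_comp_transp':
  assumes "inj p" and "p i > p (i + 1)"
  shows "Inv p = insert (i, i + 1) (pair_transp i ` Inv (p \<circ> adj_transp i))"
    and "(i, i + 1) \<notin> pair_transp i ` Inv (p \<circ> adj_transp i)"
proof -
  have "inj (p \<circ> adj_transp i)" using assms(1) by (simp add: inj_compose)
  moreover have "(p \<circ> adj_transp i) \<circ> adj_transp i = p" by (simp add: comp_assoc)
  ultimately show "Inv p = insert (i, i + 1) (pair_transp i ` Inv (p \<circ> adj_transp i))"
    and "(i, i + 1) \<notin> pair_transp i ` Inv (p \<circ> adj_transp i)"
    using Inv_comp_transp[of "p \<circ> adj_transp i" i] assms(2) by simp_all
qed

lemma inj_pair_transp: "inj_on (pair_transp i) S"
  by (rule inj_on_inverseI[of _ "pair_transp i"]) simp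

lemma finite_Inv_comp_transp:
  assumes "inj p"
  shows "finite (Inv (p \<circ> adj_transp i)) \<longleftrightarrow> finite (Inv p)"
proof -
  have "p i \<noteq> p (i + 1)" using assms by (metis add_cancel_right_right injD zero_neq_one)
  then consider "p i < p (i + 1)" | "p i > p (i + 1)" by linarith
  then show ?thesis
    by cases (use assms Inv_comp_transp Inv_comp_transp' in \<open>simp_all add: finite_image_iff inj_pair_transp\<close>)
qed

lemma card_Inv_comp_transp:
  assumes "inj p" and "finite (Inv p)"
  shows "p i < p (i + 1) \<Longrightarrow> card (Inv (p \<circ> adj_transp i)) = Suc (card (Inv p))"
    and "p i > p (i + 1) \<Longrightarrow> card (Inv p) = Suc (card (Inv (p \<circ> adj_transp i)))"
proof -
  assume "p i < p (i + 1)"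
  with Inv_comp_transp[OF assms(1) this] assms show "card (Inv (p \<circ> adj_transp i)) = Suc (card (Inv p))"
    by (simp add: card_image inj_pair_transp)
next
  assume "p i > p (i + 1)"
  moreover have "finite (Inv (p \<circ> adj_transp i))" using assms finite_Inv_comp_transp by blast
  ultimately show "card (Inv p) = Suc (card (Inv (p \<circ> adj_transp i)))"
    using Inv_comp_transp'[OF assms(1), of i] by (simp add: card_image inj_pair_transp)
qed

lemma finite_Inv_word_perm: "finite (Inv (word_perm c))"
proof (induction c rule: rev_induct)
  case Nil
  show ?case by simp
next
  case (snoc i c)
  then show ?case by (simp only: word_perm_snoc finite_Inv_comp_transp inj_word_perm)
qed

lemma card_Inv_le_length: "card (Inv (word_perm c)) \<le> length c"
proof (induction c rule: rev_induct)
  case Nil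
  show ?case by simp
next
  case (snoc i c)
  have "word_perm c i \<noteq> word_perm c (i + 1)" by (metis add_cancel_right_right injD inj_word_perm zero_neq_one)
  then consider "word_perm c i < word_perm c (i + 1)" | "word_perm c i > word_perm c (i + 1)" by linarith
  then show ?case
    unfolding word_perm_snoc
    by cases (use snoc card_Inv_comp_transp[OF inj_word_perm finite_Inv_word_perm, of c i] in \<open>simp_all add: o_def\<close>)
qed

lemma increasing_permutation_id:
  fixes p :: "int \<Rightarrow> int"
  assumes "permutation p" and inc: "\<And>i. p i < p (i + 1)"
  shows "p = id"
proof -
  have step: "p (k + int n) \<ge> p k + int n" for k n
  proof (induction n)
    case (Suc n)
    then show ?case using inc[of "k + int n"] by (simp add: algebra_simps)
  qed simp
  have fin: "finite {x. p x \<noteq> x}" using assms(1) by (rule permutation_finite_support)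
  show ?thesis
  proof (rule ext)
    fix k
    obtain B where B: "\<And>x. p x \<noteq> x \<Longrightarrow> \<bar>x\<bar> \<le> B"
    proof (rule that)
      show "\<bar>x\<bar> \<le> Max (abs ` {x. p x \<noteq> x})" if "p x \<noteq> x" for x
        using that fin by (intro Max_ge) auto
    qed
    \<comment> \<open>Both \<open>k + n\<close> and \<open>k - n\<close> lie outside the support.
      Since \<open>p\<close> grows by at least one per step, the fixed values there bound
      \<open>p k\<close> from above and from below.\<close>
    define n where "n = nat (\<bar>B\<bar> + \<bar>k\<bar> + 1)"
    have "p (k + int n) = k + int n" "p (k - int n) = k - int n"
      using B[of "k + int n"] B[of "k - int n"] unfolding n_def by force+
    then show "p k = id k" using step[of k n] step[of "k - int n" n] by simp
  qed
qed

text \<open>Descents are removed one at a time. Each removal costs one inversion, and a permutation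
  without descents is the identity.\<close>

lemma ex_word_length_card_Inv: "\<exists>d. word_perm d = word_perm c \<and> length d = card (Inv (word_perm c))"
proof (induction "card (Inv (word_perm c))" arbitrary: c rule: less_induct)
  case less
  show ?case
  proof (cases "\<forall>i. word_perm c i < word_perm c (i + 1)")
    case True
    then have "word_perm c = id" using increasing_permutation_id permutation_word_perm by blast
    then show ?thesis by (intro exI[of _ "[]"]) simp
  next
    case False
    then obtain i where "\<not> word_perm c i < word_perm c (i + 1)" by blast
    moreover have "word_perm c i \<noteq> word_perm c (i + 1)" by (metis add_cancel_right_right injD inj_word_perm zero_neq_one)
    ultimately have "word_perm c i > word_perm c (i + 1)" by linarith
    then have k: "card (Inv (word_perm c)) = Suc (card (Inv (word_perm (c @ [i]))))"
      using card_Inv_comp_transp[OF inj_word_perm finite_Inv_word_perm] by (simp add: word_perm_snoc)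
    then obtain d where "word_perm d = word_perm (c @ [i])" "length d = card (Inv (word_perm (c @ [i])))"
      using less[of "c @ [i]"] by auto
    then show ?thesis using k
      by (intro exI[of _ "d @ [i]"]) (simp add: word_perm_snoc comp_assoc)
  qed
qed

lemma reduced_iff_card_Inv: "reduced c \<longleftrightarrow> length c = card (Inv (word_perm c))"
  by (metis card_Inv_le_length ex_word_length_card_Inv le_antisym reduced_iff)

lemma reduced_snoc_iff:
  "reduced (c @ [i]) \<longleftrightarrow> reduced c \<and> word_perm c i < word_perm c (i + 1)"
proof -
  have ne: "word_perm c i \<noteq> word_perm c (i + 1)" by (metis add_cancel_right_right injD inj_word_perm zero_neq_one)
  have "card (Inv (word_perm c)) \<le> length c" by (rule card_Inv_le_length)
  then show ?thesis
    using ne card_Inv_comp_transp[OF inj_word_perm finite_Inv_word_perm, of c i]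
    by (cases "word_perm c i < word_perm c (i + 1)") (auto simp: reduced_iff_card_Inv word_perm_snoc)
qed

text \<open>Induction on the number of inversions: the last letter of a reduced word is a descent,
  descents are inversions, and there are finitely many of those.\<close>

lemma finite_reduced_words: "finite {c. word_perm c = p \<and> reduced c}"
proof (induction "card (Inv p)" arbitrary: p rule: less_induct)
  case less
  show ?case
  proof (cases "{c. word_perm c = p \<and> reduced c} = {}")
    case True
    then show ?thesis by (simp only: finite.emptyI)
  next
    case False
    then have fin: "finite (Inv p)" and inj: "inj p" using finite_Inv_word_perm inj_word_perm by auto
    define D where "D = {i. (i, i + 1) \<in> Inv p}"
    have "finite D" unfolding D_def using finite_imageI[OF fin, of fst] by (rule finite_subset[rotated]) force
    have "{c. word_perm c = p \<and> reduced c} \<subseteq>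
      insert [] (\<Union>i \<in> D. (\<lambda>c. c @ [i]) ` {c. word_perm c = p \<circ> adj_transp i \<and> reduced c})"
    proof
      fix c assume "c \<in> {c. word_perm c = p \<and> reduced c}"
      then have c: "word_perm c = p" "reduced c" by auto
      show "c \<in> insert [] (\<Union>i \<in> D. (\<lambda>c. c @ [i]) ` {c. word_perm c = p \<circ> adj_transp i \<and> reduced c})"
      proof (cases c rule: rev_cases)
        case (snoc d i)
        then have lt: "word_perm d i < word_perm d (i + 1)" and d: "reduced d" using c reduced_snoc_iff by auto
        have p: "p = word_perm d \<circ> adj_transp i" using c snoc word_perm_snoc by simp
        have "i \<in> D" using lt unfolding D_def p Inv_def by simp
        moreover have "word_perm d = p \<circ> adj_transp i" unfolding p by (simp add: comp_assoc)
        ultimately show ?thesis using d unfolding snoc by blast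
      qed simp
    qed
    moreover have "finite {c. word_perm c = p \<circ> adj_transp i \<and> reduced c}" if "i \<in> D" for i
      using that card_Inv_comp_transp(2)[OF inj fin, of i] by (intro less) (auto simp: D_def Inv_def)
    ultimately show ?thesis using \<open>finite D\<close> by (elim finite_subset) simp
  qed
qed

text \<open>The entry at position \<open>j\<close> is the pair \<open>(a_j, b_j)\<close> of the
  definition of marked inversions, recorded for every letter, primed or not.\<close>

fun inv_labels :: "int list \<Rightarrow> (int \<times> int) list" where
  "inv_labels [] = []"
| "inv_labels (i # c) = (word_perm (rev c) i, word_perm (rev c) (i + 1)) # inv_labels c"

lemma length_inv_labels [simp]: "length (inv_labels c) = length c"
  by (induction c) simp_all

lemma inv_labels_append:
  "inv_labels (c @ d) = map (map_prod (word_perm (rev d)) (word_perm (rev d))) (inv_labels c) @ inv_labels d"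
  by (induction c) (simp_all add: word_perm_append)

lemma inv_labels_nth:
  "j < length c \<Longrightarrow> inv_labels c ! j =
     (word_perm (rev (drop (Suc j) c)) (c ! j), word_perm (rev (drop (Suc j) c)) (c ! j + 1))"
proof (induction c arbitrary: j)
  case (Cons i c)
  then show ?case by (cases j) simp_all
qed simp

text \<open>Appending a last letter \<open>i\<close> conjugates all earlier labels by
  \<open>adj_transp i\<close> and adds \<open>(i, i + 1)\<close>. The inversion set obeys the same
  recursion by \<open>Inv_comp_transp\<close>.\<close>

lemma inv_labels_reduced:
  assumes "reduced c"
  shows "distinct (inv_labels c)" and "set (inv_labels c) = Inv (word_perm c)"
proof -
  have "distinct (inv_labels c) \<and> set (inv_labels c) = Inv (word_perm c)"
    using assms
  proof (induction c rule: rev_induct)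
    case Nil
    show ?case by simp
  next
    case (snoc i c)
    then have "reduced c" and lt: "word_perm c i < word_perm c (i + 1)" using reduced_snoc_iff by auto
    then have IH: "distinct (inv_labels c)" "set (inv_labels c) = Inv (word_perm c)" using snoc by auto
    have e: "inv_labels (c @ [i]) = map (pair_transp i) (inv_labels c) @ [(i, i + 1)]"
      by (simp add: inv_labels_append word_perm_Cons)
    show ?case
      unfolding e word_perm_snoc Inv_comp_transp(1)[OF inj_word_perm lt]
      using IH Inv_comp_transp(2)[OF inj_word_perm lt] by (simp add: distinct_map inj_pair_transp)
  qed
  then show "distinct (inv_labels c)" and "set (inv_labels c) = Inv (word_perm c)" by auto
qed

subsection \<open>Coxeter--Knuth equivalence\<close>

text \<open>The Knuth relations, with the braid relation in place of those for repeated letters. The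
  letter \<open>b\<close> strictly between \<open>a\<close> and \<open>c\<close> forces
  \<open>c - a\<close> to be at least 2, so the first two rules are commutations and preserve the
  permutation.\<close>

inductive ck_base :: "int list \<Rightarrow> int list \<Rightarrow> bool" where
  ck_acb: "a < b \<Longrightarrow> b < c \<Longrightarrow> ck_base [a, c, b] [c, a, b]"
| ck_bac: "a < b \<Longrightarrow> b < c \<Longrightarrow> ck_base [b, a, c] [b, c, a]"
| ck_braid: "ck_base [a, a + 1, a] [a + 1, a, a + 1]"

inductive ck :: "int list \<Rightarrow> int list \<Rightarrow> bool" (infix "\<approx>" 50) where
  ck_refl [simp]: "c \<approx> c"
| ck_sym: "c \<approx> d \<Longrightarrow> d \<approx> c"
| ck_trans [trans]: "c \<approx> d \<Longrightarrow> d \<approx> e \<Longrightarrow> c \<approx> e"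
| ck_infix: "ck_base x y \<Longrightarrow> p @ x @ s \<approx> p @ y @ s"

lemma ck_baseI: "ck_base x y \<Longrightarrow> x \<approx> y"
  using ck_infix[of x y "[]" "[]"] by simp

lemma ck_append:
  assumes "c \<approx> d" shows "p @ c @ s \<approx> p @ d @ s"
  using assms
proof (induction arbitrary: p s rule: ck.induct)
  case (ck_infix x y p' s')
  then show ?case using ck.ck_infix[of x y "p @ p'" "s' @ s"] by simp
next
  case (ck_sym c d)
  show ?case by (rule ck.ck_sym) (rule ck_sym.IH)
next
  case (ck_trans c d e)
  show ?case by (rule ck.ck_trans) (rule ck_trans.IH)+
qed simp

lemmas ck_append_left = ck_append[where s = "[]", simplified]
lemmas ck_append_right = ck_append[where p = "[]", simplified]

lemma ck_Cons: "c \<approx> d \<Longrightarrow> x # c \<approx> x # d"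
  using ck_append_left[of c d "[x]"] by simp

lemma ck_base_word_perm: "ck_base x y \<Longrightarrow> word_perm x = word_perm y"
proof (induction rule: ck_base.induct)
  case (ck_acb a b c)
  then show ?case using fun_cong[OF word_perm_commute[of a c]] by (auto simp: word_perm_Cons)
next
  case (ck_bac a b c)
  then show ?case using fun_cong[OF word_perm_commute[of a c]] by (auto simp: word_perm_Cons)
next
  case (ck_braid a)
  then show ?case using fun_cong[OF word_perm_braid[of a]] by (auto simp: word_perm_Cons)
qed

lemma ck_word_perm: "c \<approx> d \<Longrightarrow> word_perm c = word_perm d"
  by (induction rule: ck.induct) (simp_all add: word_perm_append ck_base_word_perm)

lemma ck_length: "c \<approx> d \<Longrightarrow> length c = length d"
  by (induction rule: ck.induct) (auto elim: ck_base.cases)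

lemma ck_set: "c \<approx> d \<Longrightarrow> set c = set d"
proof (induction rule: ck.induct)
  case (ck_infix x y p s)
  then have "set x = set y" by (induction rule: ck_base.induct) auto
  then show ?case by simp
qed simp_all

lemma ck_reduced: "c \<approx> d \<Longrightarrow> reduced c \<longleftrightarrow> reduced d"
  by (rule reduced_cong) (simp_all add: ck_word_perm ck_length)

text \<open>A braid relation with letters on both sides of the cut would involve
  \<open>M + 1\<close>. A Knuth relation loses its largest letters first, and what is left of its
  two sides coincides. This lemma erases auxiliary large letters once they have done their
  work.\<close>

lemma ck_filter:
  assumes "c \<approx> d" and "M + 1 \<notin> set c"
  shows "filter (\<lambda>x. x \<le> M) c \<approx> filter (\<lambda>x. x \<le> M) d"
  using assms
proof (induction rule: ck.induct)
  case (ck_sym c d)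
  then show ?case using ck_set ck.ck_sym by blast
next
  case (ck_trans c d e)
  then show ?case using ck_set ck.ck_trans by blast
next
  case (ck_infix x y p s)
  from \<open>ck_base x y\<close> have "filter (\<lambda>x. x \<le> M) x \<approx> filter (\<lambda>x. x \<le> M) y"
    using ck_infix.prems
  proof (cases rule: ck_base.cases)
    case (ck_acb a b c)
    then show ?thesis using ck_baseI[OF ck_base.ck_acb[of a b c]] by auto
  next
    case (ck_bac a b c)
    then show ?thesis using ck_baseI[OF ck_base.ck_bac[of a b c]] by auto
  next
    case (ck_braid a)
    then have "a \<noteq> M" using ck_infix.prems by auto
    then show ?thesis unfolding ck_braid using ck_baseI[OF ck_base.ck_braid[of a]] by auto
  qed
  then show ?case by (simp add: ck_append)
qed simp

text \<open>Reversal alone would turn decreasing words into increasing ones; the signs restore the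
  order. This map exchanges the two Knuth relations and the two factors of a product, which makes
  one operator the mirror image of the other.\<close>

definition star :: "int list \<Rightarrow> int list" where
  "star c = map uminus (rev c)"

lemma star_append: "star (c @ d) = star d @ star c"
  by (simp add: star_def)

lemma star_star [simp]: "star (star c) = c"
  by (simp add: star_def rev_map comp_def)

lemma length_star [simp]: "length (star c) = length c"
  by (simp add: star_def)

lemma star_Nil [simp]: "star [] = []"
  by (simp add: star_def)

lemma star_Cons: "star (x # c) = star c @ [- x]"
  by (simp add: star_def)

lemma reduced_star: "reduced (star c) \<longleftrightarrow> reduced c"
  by (simp only: star_def reduced_uminus reduced_rev)

lemma sorted_star: "sorted_wrt (>) (star c) \<longleftrightarrow> sorted_wrt (>) c"
  by (simp add: star_def sorted_wrt_map sorted_wrt_rev)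

lemma ck_star:
  assumes "c \<approx> d" shows "star c \<approx> star d"
  using assms
proof (induction rule: ck.induct)
  case (ck_infix x y p s)
  from \<open>ck_base x y\<close> have "star x \<approx> star y"
  proof (cases rule: ck_base.cases)
    case (ck_acb a b c)
    then show ?thesis using ck_baseI[OF ck_base.ck_bac[of "-c" "-b" "-a"]]
      by (simp add: star_def ck.ck_sym)
  next
    case (ck_bac a b c)
    then show ?thesis using ck_baseI[OF ck_base.ck_acb[of "-c" "-b" "-a"]]
      by (simp add: star_def ck.ck_sym)
  next
    case (ck_braid a)
    then show ?thesis using ck_baseI[OF ck_base.ck_braid[of "-a - 1"]]
      by (simp add: star_def ck.ck_sym)
  qed
  then show ?case by (simp add: star_append ck_append)
next
  case (ck_sym c d)
  show ?case by (rule ck.ck_sym) (rule ck_sym.IH)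
next
  case (ck_trans c d e)
  show ?case by (rule ck.ck_trans) (rule ck_trans.IH)+
qed simp

subsection \<open>Row insertion\<close>

abbreviation row :: "int set \<Rightarrow> int list" where
  "row \<equiv> sorted_list_of_set"

lemma row_set: "sorted_wrt (<) xs \<Longrightarrow> row (set xs) = xs"
  by (simp add: sorted_list_of_set.idem_if_sorted_distinct strict_sorted_iff)

lemma row_split:
  assumes "finite R" "y \<in> R"
  shows "row R = row {r \<in> R. r < y} @ y # row {r \<in> R. y < r}"
proof -
  have "sorted_wrt (<) (row {r \<in> R. r < y} @ y # row {r \<in> R. y < r})"
    using assms(1) by (auto simp: sorted_wrt_append)
  moreover have "set (row {r \<in> R. r < y} @ y # row {r \<in> R. y < r}) = R"
    using assms by auto
  ultimately show ?thesis using row_set by metis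
qed

text \<open>
  Edelman--Greene insertion. If \<open>x \<in> R\<close> and the word stays reduced, then \<open>x + 1 \<in> R\<close> is bumped and the
  row does not change. The bumped letter is junk unless \<open>R\<close> has an element above \<open>x\<close>; the condition
  \<open>can_pass R c\<close> says that every insertion bumps, so that the row keeps its length.
\<close>

definition bump :: "int set \<Rightarrow> int \<Rightarrow> int" where
  "bump R x = Min {r \<in> R. x < r}"

definition row_insert :: "int set \<Rightarrow> int \<Rightarrow> int set" where
  "row_insert R x = (if x \<in> R then R else insert x (R - {bump R x}))"

fun outs :: "int set \<Rightarrow> int list \<Rightarrow> int list" where
  "outs R [] = []"
| "outs R (x # c) = bump R x # outs (row_insert R x) c"

fun final :: "int set \<Rightarrow> int list \<Rightarrow> int set" where
  "final R [] = R"
| "final R (x # c) = final (row_insert R x) c"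

fun can_pass :: "int set \<Rightarrow> int list \<Rightarrow> bool" where
  "can_pass R [] \<longleftrightarrow> finite R"
| "can_pass R (x # c) \<longleftrightarrow> finite R \<and> (\<exists>r\<in>R. x < r) \<and> can_pass (row_insert R x) c"

lemma outs_append: "outs R (c @ d) = outs R c @ outs (final R c) d"
  by (induction c arbitrary: R) simp_all

lemma final_append: "final R (c @ d) = final (final R c) d"
  by (induction c arbitrary: R) simp_all

lemma finite_row_insert [simp]: "finite R \<Longrightarrow> finite (row_insert R x)"
  by (simp add: row_insert_def)

lemma can_pass_append: "can_pass R (c @ d) \<longleftrightarrow> can_pass R c \<and> can_pass (final R c) d"
  by (induction c arbitrary: R) (auto elim: can_pass.elims)

lemma length_outs [simp]: "length (outs R c) = length c"
  by (induction c arbitrary: R) simp_all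

lemma can_pass_finite: "can_pass R c \<Longrightarrow> finite R"
  by (cases c) simp_all

lemma can_pass_final: "can_pass R c \<Longrightarrow> finite (final R c)"
  by (induction c arbitrary: R) simp_all

lemma bump_eqI:
  assumes "finite R" "y \<in> R" "x < y" "\<And>z. z \<in> R \<Longrightarrow> x < z \<Longrightarrow> y \<le> z"
  shows "bump R x = y"
  unfolding bump_def using assms by (intro Min_eqI) auto

lemma bump:
  assumes "finite R" "\<exists>r\<in>R. x < r"
  shows "bump R x \<in> R" and "x < bump R x" and "z \<in> R \<Longrightarrow> x < z \<Longrightarrow> bump R x \<le> z"
proof -
  have "Min {r \<in> R. x < r} \<in> {r \<in> R. x < r}" using assms by (intro Min_in) auto
  then show "bump R x \<in> R" and "x < bump R x" by (auto simp: bump_def)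
  show "z \<in> R \<Longrightarrow> x < z \<Longrightarrow> bump R x \<le> z" unfolding bump_def using assms by (intro Min_le) auto
qed

lemma row_insert_mem: "x \<in> row_insert R x"
  by (simp add: row_insert_def)

text \<open>If \<open>x + 1\<close> were missing, all row letters above \<open>x\<close> would be at
  least \<open>x + 2\<close>, and the \<open>x\<close> of the row would cancel against the inserted
  one.\<close>

lemma reduced_row_mem:
  assumes "reduced (row R @ x # s)" "finite R" "x \<in> R"
  shows "x + 1 \<in> R"
proof (rule ccontr)
  assume n: "x + 1 \<notin> R"
  have "row R @ x # s = row {r \<in> R. r < x} @ (x # row {r \<in> R. x < r} @ [x]) @ s"
    using row_split[OF assms(2,3)] by simp
  from assms(1)[unfolded this] have "reduced (x # row {r \<in> R. x < r} @ [x])" by (rule reduced_middleD)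
  moreover have "\<forall>j\<in>set (row {r \<in> R. x < r}). 2 \<le> \<bar>x - j\<bar>"
  proof
    fix j assume "j \<in> set (row {r \<in> R. x < r})"
    then have "j \<in> R" "x < j" using assms(2) by auto
    then show "2 \<le> \<bar>x - j\<bar>" using n by (cases "j = x + 1") auto
  qed
  ultimately show False using not_reduced_repeat by blast
qed

lemma bump_mem:
  assumes "finite R" "x + 1 \<in> R" shows "bump R x = x + 1"
  using assms by (intro bump_eqI) auto

text \<open>The large letter \<open>y\<close> passes one letter of \<open>A\<close> at a time; the
  witness strictly between the two is the letter that \<open>y\<close> has passed just
  before.\<close>

lemma ck_move_left:
  assumes "sorted_wrt (<) (A @ [x])" "x < y"
  shows "A @ [y, x] \<approx> y # A @ [x]"
  using assms
proof (induction A arbitrary: x rule: rev_induct)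
  case (snoc a A)
  then have "a < x" "sorted_wrt (<) (A @ [a])" "a < y" by (auto simp: sorted_wrt_append)
  then have "A @ [a, y, x] \<approx> A @ [y, a, x]"
    using snoc.prems by (intro ck_append_left ck_baseI ck_acb) auto
  also have "A @ [y, a, x] \<approx> (y # A @ [a]) @ [x]"
    using ck_append_right[OF snoc.IH[OF \<open>sorted_wrt (<) (A @ [a])\<close> \<open>a < y\<close>], of "[x]"] by simp
  finally show ?case by simp
qed simp

text \<open>Here the small letter \<open>x\<close> moves left, and the witness is the row letter in
  front of the two letters exchanged.\<close>

lemma ck_move_right:
  assumes "sorted_wrt (<) (y # B)" "x < y"
  shows "y # B @ [x] \<approx> y # x # B"
  using assms
proof (induction B arbitrary: y)
  case (Cons b B)
  have "y # b # B @ [x] \<approx> y # b # x # B"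
    using Cons by (intro ck_Cons Cons.IH) auto
  also have "y # b # x # B = [y, b, x] @ B" by simp
  also have "\<dots> \<approx> [y, x, b] @ B"
    using Cons.prems by (intro ck_append_right ck_sym[OF ck_baseI] ck_bac) auto
  finally show ?case by simp
qed simp

text \<open>The inserted \<open>x\<close> moves left until it stands next to the letter
  \<open>y\<close> that it bumps, and \<open>y\<close> then travels on to the front. If
  \<open>x\<close> is already in the row, then \<open>y = x + 1\<close> and the three letters
  \<open>x, x + 1, x\<close> meet; a braid move releases \<open>x + 1\<close> and leaves the row as
  it was.\<close>

lemma ck_row_insert:
  assumes "finite R" "\<exists>r\<in>R. x < r" "reduced (row R @ [x])"
  shows "row R @ [x] \<approx> bump R x # row (row_insert R x)"
proof -
  define y where "y = bump R x"
  have y: "y \<in> R" "x < y" "\<And>z. z \<in> R \<Longrightarrow> x < z \<Longrightarrow> y \<le> z"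
    using bump[OF assms(1,2)] unfolding y_def by auto
  define B where "B = row {r \<in> R. y < r}"
  have B: "sorted_wrt (<) (y # B)" using assms(1) by (auto simp: B_def)
  show ?thesis
  proof (cases "x \<in> R")
    case True
    then have "x + 1 \<in> R" using reduced_row_mem assms by blast
    then have yx: "y = x + 1" unfolding y_def using bump_mem assms(1) by blast
    define A where "A = row {r \<in> R. r < x}"
    have A: "sorted_wrt (<) (A @ [x])" using assms(1) by (auto simp: A_def sorted_wrt_append)
    have "set (A @ [x]) = {r \<in> R. r < y}" using True yx assms(1) by (auto simp: A_def)
    with row_set[OF A] have "row {r \<in> R. r < y} = A @ [x]" by (simp only:)
    then have R: "row R = A @ [x, y] @ B" using row_split[OF assms(1) y(1)] by (simp add: B_def)
    have "row R @ [x] = (A @ [x]) @ (y # B @ [x])" using R by simp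
    also have "\<dots> \<approx> (A @ [x]) @ (y # x # B)" by (intro ck_append_left ck_move_right B y)
    also have "\<dots> = A @ [x, x + 1, x] @ B" using yx by simp
    also have "\<dots> \<approx> A @ [x + 1, x, x + 1] @ B" by (intro ck_infix ck_braid)
    also have "\<dots> = (A @ [y, x]) @ (y # B)" using yx by simp
    also have "\<dots> \<approx> (y # A @ [x]) @ (y # B)" by (intro ck_append_right ck_move_left A y)
    also have "\<dots> = y # row (row_insert R x)" using True R by (simp add: row_insert_def)
    finally show ?thesis by (simp add: y_def)
  next
    case False
    define A where "A = row {r \<in> R. r < y}"
    have Ax: "r < x" if "r \<in> R" "r < y" for r using that y(3)[of r] False by (cases r x rule: linorder_cases) auto
    have A: "sorted_wrt (<) (A @ [x])" using assms(1) Ax by (auto simp: A_def sorted_wrt_append)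
    have R: "row R = A @ y # B" using row_split[OF assms(1) y(1)] by (simp add: A_def B_def)
    have e: "row_insert R x = insert x (R - {y})" using False by (simp add: row_insert_def y_def)
    have "{r \<in> row_insert R x. r < x} = {r \<in> R. r < y}" "{r \<in> row_insert R x. x < r} = {r \<in> R. y < r}"
      unfolding e using Ax y by force+
    then have R': "row (row_insert R x) = A @ x # B"
      using row_split[of "row_insert R x" x] assms(1) by (simp add: A_def B_def row_insert_mem)
    have "row R @ [x] = A @ (y # B @ [x])" using R by simp
    also have "\<dots> \<approx> A @ (y # x # B)" by (intro ck_append_left ck_move_right B y)
    also have "\<dots> = (A @ [y, x]) @ B" by simp
    also have "\<dots> \<approx> (y # A @ [x]) @ B" by (intro ck_append_right ck_move_left A y)
    finally show ?thesis using R' by (simp add: y_def)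
  qed
qed

lemma ck_outs:
  assumes "can_pass R c" "reduced (row R @ c)"
  shows "row R @ c \<approx> outs R c @ row (final R c)"
  using assms
proof (induction c arbitrary: R)
  case (Cons x c)
  have "reduced ((row R @ [x]) @ c)" using Cons.prems by simp
  then have "reduced (row R @ [x])" by (rule reduced_appendD)
  then have 1: "row R @ [x] \<approx> bump R x # row (row_insert R x)"
    using Cons.prems by (intro ck_row_insert) auto
  have 2: "row R @ x # c \<approx> (bump R x # row (row_insert R x)) @ c"
    using ck_append_right[OF 1, of c] by simp
  then have "reduced ([bump R x] @ (row (row_insert R x) @ c))" using Cons.prems(2) ck_reduced[OF 2] by simp
  then have "reduced (row (row_insert R x) @ c)" by (rule reduced_appendD)
  with Cons have "row (row_insert R x) @ c \<approx> outs (row_insert R x) c @ row (final (row_insert R x) c)"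
    by simp
  from ck_trans[OF 2, simplified, OF ck_Cons[OF this]] show ?case by simp
qed simp

lemma reduced_final:
  assumes "can_pass R c" "reduced (row R @ c @ s)"
  shows "reduced (outs R c @ row (final R c) @ s)" and "reduced (row (final R c) @ s)"
proof -
  have "reduced ((row R @ c) @ s)" using assms(2) by simp
  then have "reduced (row R @ c)" by (rule reduced_appendD)
  from ck_append_right[OF ck_outs[OF assms(1) this], of s]
  have "reduced ((row R @ c) @ s) \<longleftrightarrow> reduced ((outs R c @ row (final R c)) @ s)" by (rule ck_reduced)
  then show *: "reduced (outs R c @ row (final R c) @ s)" using assms(2) by simp
  show "reduced (row (final R c) @ s)" using * by (rule reduced_appendD)
qed

lemma reduced_outs:
  assumes "can_pass R c" "reduced (row R @ c)" shows "reduced (outs R c)"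
  using reduced_final(1)[of R c "[]"] assms by (auto dest: reduced_appendD)

text \<open>The row bumping lemma: the inserted \<open>x\<close> is now in the row, so a smaller
  letter that follows bumps at most \<open>x\<close>. Hence decreasing words bump decreasing
  words.\<close>

lemma outs_le:
  assumes "x \<in> R" "sorted_wrt (>) (x # c)" "can_pass R c" "z \<in> set (outs R c)"
  shows "z \<le> x"
  using assms
proof (induction c arbitrary: R x)
  case (Cons y c)
  then consider "z = bump R y" | "z \<in> set (outs (row_insert R y) c)" by auto
  then show ?case
  proof cases
    case 1
    then show ?thesis using Cons.prems bump(3)[of R y x] by auto
  next
    case 2
    then have "z \<le> y" using Cons.prems by (intro Cons.IH[OF row_insert_mem]) auto
    then show ?thesis using Cons.prems by auto
  qed
qed simp

lemma sorted_outs: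
  assumes "sorted_wrt (>) c" "can_pass R c"
  shows "sorted_wrt (>) (outs R c)"
  using assms
proof (induction c arbitrary: R)
  case (Cons x c)
  have "z < bump R x" if "z \<in> set (outs (row_insert R x) c)" for z
    using outs_le[OF row_insert_mem Cons.prems(1)] that Cons.prems(2) bump(2)[of R x] by fastforce
  then show ?case using Cons by simp
qed simp

text \<open>The output relation need not be of the same kind as the input relation. Which one
  appears depends on the letter \<open>\<alpha>\<close> bumped by \<open>a\<close> compared with
  \<open>c\<close>. Reducedness enters for letters already in the row, which must have their
  successor there.\<close>

lemma outs_acb:
  assumes "a < b" "b < c" "reduced (row R @ [a, c, b])" "finite R"
  shows "can_pass R [a, c, b] \<longleftrightarrow> can_pass R [c, a, b]"
    and "can_pass R [a, c, b] \<Longrightarrow> final R [a, c, b] = final R [c, a, b] \<and> outs R [a, c, b] \<approx> outs R [c, a, b]"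
proof -
  have cab: "reduced (row R @ [c, a, b])"
    using ck_reduced[OF ck_append_left[OF ck_baseI[OF ck_acb[OF assms(1,2)]]]] assms(3) by blast
  have ra: "a \<in> R \<Longrightarrow> a + 1 \<in> R" and rc: "c \<in> R \<Longrightarrow> c + 1 \<in> R"
    using reduced_row_mem[OF assms(3,4)] reduced_row_mem[OF cab assms(4)] by auto
  have "(can_pass R [a, c, b] \<longleftrightarrow> can_pass R [c, a, b]) \<and>
     (can_pass R [a, c, b] \<longrightarrow> final R [a, c, b] = final R [c, a, b] \<and> outs R [a, c, b] \<approx> outs R [c, a, b])"
  proof (cases "\<exists>r\<in>R. c < r")
    case False
    then have "\<not> can_pass R [c, a, b]" "\<not> can_pass R [a, c, b]"
      using assms(1,2) by (auto simp: row_insert_def split: if_splits)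
    then show ?thesis by blast
  next
    case True
    then have Ea: "\<exists>r\<in>R. a < r" using assms(1,2) by (meson less_trans)
    define \<alpha> where "\<alpha> = bump R a"
    define \<gamma> where "\<gamma> = bump R c"
    have \<alpha>: "\<alpha> \<in> R" "a < \<alpha>" "\<And>z. z \<in> R \<Longrightarrow> a < z \<Longrightarrow> \<alpha> \<le> z"
      using bump[OF assms(4) Ea] by (auto simp: \<alpha>_def)
    have \<gamma>: "\<gamma> \<in> R" "c < \<gamma>" "\<And>z. z \<in> R \<Longrightarrow> c < z \<Longrightarrow> \<gamma> \<le> z"
      using bump[OF assms(4) True] by (auto simp: \<gamma>_def)
    have aR: "a \<in> R \<Longrightarrow> \<alpha> = a + 1" using ra \<alpha> by force
    have Ra: "row_insert R a = (if a \<in> R then R else insert a (R - {\<alpha>}))"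
      and Rc: "row_insert R c = (if c \<in> R then R else insert c (R - {\<gamma>}))"
      by (simp_all add: row_insert_def \<alpha>_def \<gamma>_def)
    consider "\<alpha> < c" | "\<alpha> = c" | "\<alpha> > c" by linarith
    then show ?thesis
    proof cases
      \<comment> \<open>\<open>a\<close> and \<open>c\<close> act at different places of the row and
        bump the same letters in either order. Then \<open>b\<close> bumps some
        \<open>\<beta>\<close> with \<open>\<alpha> < \<beta> \<le> c < \<gamma>\<close>, so the
        outputs are related by the same rule.\<close>
      case 1
      define R2 where "R2 = (if c \<in> R then row_insert R a else insert c (row_insert R a - {\<gamma>}))"
      have g: "bump (row_insert R a) c = \<gamma>"
        using assms(1,2,4) \<gamma> 1 by (intro bump_eqI) (auto simp: Ra split: if_splits)
      have h: "bump (row_insert R c) a = \<alpha>"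
        using assms(1,2,4) \<alpha> \<gamma> 1 by (intro bump_eqI) (auto simp: Rc split: if_splits)
      have e1: "row_insert (row_insert R a) c = R2"
        using assms(1,2) 1 unfolding row_insert_def[of "row_insert R a"] g by (auto simp: R2_def Ra)
      have e2: "row_insert (row_insert R c) a = R2"
        using assms(1,2) 1 \<gamma>(2) unfolding row_insert_def[of "row_insert R c"] h by (auto simp: R2_def Ra Rc)
      have cR2: "c \<in> R2" using 1 by (auto simp: R2_def Ra)
      have fR2: "finite R2" using assms(4) by (auto simp: R2_def)
      have Eb: "\<exists>r\<in>R2. b < r" using cR2 assms(2) by blast
      define \<beta> where "\<beta> = bump R2 b"
      have \<beta>: "\<beta> \<in> R2" "b < \<beta>" "\<beta> \<le> c" using bump[OF fR2 Eb] cR2 assms(2) by (auto simp: \<beta>_def)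
      have "\<alpha> < \<beta>"
      proof (cases "\<alpha> \<le> b")
        case False
        then have "a \<notin> R" using aR assms(1) by force
        then have "\<alpha> \<notin> R2" using 1 \<alpha>(2) by (auto simp: R2_def Ra)
        moreover have "\<beta> \<in> R \<or> \<beta> = a \<or> \<beta> = c" using \<beta>(1) by (auto simp: R2_def Ra split: if_splits)
        moreover have "a < \<beta>" using \<beta> assms(1) by simp
        ultimately have "\<alpha> \<le> \<beta>" "\<alpha> \<noteq> \<beta>" using \<beta>(1) \<alpha>(3)[of \<beta>] 1 by auto
        then show ?thesis by simp
      qed (use \<beta> in simp)
      then have "[\<alpha>, \<gamma>, \<beta>] \<approx> [\<gamma>, \<alpha>, \<beta>]" using \<beta> \<gamma> by (intro ck_baseI ck_acb) auto
      moreover have "\<exists>r\<in>row_insert R a. c < r" using 1 \<gamma> by (auto simp: Ra)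
      moreover have "\<exists>r\<in>row_insert R c. a < r" using row_insert_mem[of c R] assms(1,2) by (meson less_trans)
      ultimately show ?thesis using e1 e2 g h Eb Ea True fR2 assms(4) by (auto simp: \<alpha>_def \<gamma>_def \<beta>_def)
    next
      \<comment> \<open>Now \<open>c\<close> is in the row, hence also \<open>c + 1\<close>. The
        outputs are \<open>c, c + 1, c\<close> and \<open>c + 1, c, c + 1\<close>: a Knuth relation
        becomes a braid relation.\<close>
      case 2
      have cR: "c \<in> R" using 2 \<alpha> by simp
      then have \<gamma>c: "\<gamma> = c + 1" using rc \<gamma> by force
      have aN: "a \<notin> R" using aR 2 assms(1,2) by force
      have Rc': "row_insert R c = R" using cR by (simp add: row_insert_def)
      have Ra': "row_insert R a = insert a (R - {c})" using aN 2 Ra by simp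
      have nz: "z \<notin> R" if "a \<le> z" "z < c" for z using that \<alpha>(3)[of z] 2 aN by (cases "z = a") auto
      have nz2: "c \<le> z" if "z \<in> R" "b < z" for z using nz[of z] that assms(1) by (meson less_imp_le less_trans not_le)
      have b1: "bump (insert a (R - {c})) c = c + 1"
        using assms(1,2,4) \<gamma>(1) \<gamma>c by (intro bump_eqI) auto
      have i1: "row_insert (insert a (R - {c})) c = insert c (insert a (R - {c}) - {c + 1})"
        using assms(1,2) b1 by (simp add: row_insert_def)
      have b2: "bump (insert c (insert a (R - {c}) - {c + 1})) b = c"
        using assms(1,2,4) nz2 by (intro bump_eqI) auto
      have b3: "bump (insert a (R - {c})) b = c + 1"
        using assms(1,2,4) nz2 \<gamma>(1) \<gamma>c by (intro bump_eqI) (force simp: order.order_iff_strict)+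
      have bN: "b \<notin> R" using nz[of b] assms(1,2) by simp
      have i2: "row_insert (insert c (insert a (R - {c}) - {c + 1})) b = insert b (insert c (insert a (R - {c}) - {c + 1}) - {c})"
        using assms(1,2) b2 bN by (auto simp: row_insert_def)
      have i3: "row_insert (insert a (R - {c})) b = insert b (insert a (R - {c}) - {c + 1})"
        using assms(1,2) b3 bN by (auto simp: row_insert_def)
      have o1: "outs R [a, c, b] = [c, c + 1, c]" using Ra' b1 i1 b2 2 by (simp add: \<alpha>_def)
      have o2: "outs R [c, a, b] = [c + 1, c, c + 1]" using Rc' Ra' b3 2 \<gamma>c by (simp add: \<alpha>_def \<gamma>_def)
      have f: "final R [a, c, b] = final R [c, a, b]" using Ra' Rc' i1 i2 i3 cR assms(1,2) by auto
      have ex: "\<exists>x\<in>R - {c}. c < x" using \<gamma>(1) \<gamma>c by (intro bexI[of _ "c + 1"]) auto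
      have c1: "can_pass R [a, c, b]" using ex Ra' i1 Ea \<gamma>(1) \<gamma>c assms(1,2,4) by (auto simp: row_insert_def[of _ b])
      have "\<exists>r\<in>insert a (R - {c}). b < r" using \<gamma>(1) \<gamma>c assms(1,2) by (intro bexI[of _ "c + 1"]) auto
      then have c2: "can_pass R [c, a, b]" using Ra' Rc' Ea True assms(1,2,4) by auto
      show ?thesis using o1 o2 f c1 c2 ck_baseI[OF ck_braid[of c]] by simp
    next
      \<comment> \<open>The row has no letter between \<open>a\<close> and \<open>c\<close>, so both
        compete for the same letter \<open>\<gamma>\<close>. With \<open>\<delta>\<close> the next
        row letter, the outputs are \<open>\<gamma>, \<delta>, c\<close> and
        \<open>\<gamma>, c, \<delta>\<close>, which is the other Knuth relation.\<close>
      case 3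
      have nz: "z \<notin> R" if "a \<le> z" "z \<le> c" for z
      proof
        assume z: "z \<in> R"
        show False
        proof (cases "z = a")
          case True
          then show False using aR z 3 assms(1,2) by simp
        next
          case False
          then show False using \<alpha>(3)[OF z] that 3 by simp
        qed
      qed
      have nz2: "c < z" if "z \<in> R" "a < z" for z using nz[of z] that by (meson less_imp_le not_le)
      have \<alpha>\<gamma>: "\<alpha> = \<gamma>" using \<alpha> \<gamma> 3 assms(1,2) by (simp add: order_antisym)
      have N: "a \<notin> R" "b \<notin> R" "c \<notin> R" using nz assms(1,2) by auto
      have Ra': "row_insert R a = insert a (R - {\<gamma>})" and Rc': "row_insert R c = insert c (R - {\<gamma>})"
        using Ra Rc N \<alpha>\<gamma> by simp_all
      have b1: "bump (insert c (R - {\<gamma>})) a = c"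
        using assms(1,2,4) nz2 by (intro bump_eqI) (auto simp: less_imp_le)
      have i1: "row_insert (insert c (R - {\<gamma>})) a = insert a (R - {\<gamma>})"
        using assms(1,2) b1 N by (auto simp: row_insert_def)
      show ?thesis
      proof (cases "\<exists>r\<in>R. \<gamma> < r")
        case False
        then have R\<gamma>: "r \<le> \<gamma>" if "r \<in> R" for r using that by force
        have "\<not> (\<exists>r\<in>insert a (R - {\<gamma>}). c < r)" using R\<gamma> \<gamma>(3) assms(1,2) by (auto dest: order.antisym)
        moreover have "\<not> (\<exists>r\<in>insert a (R - {\<gamma>}). b < r)"
        proof
          assume "\<exists>r\<in>insert a (R - {\<gamma>}). b < r"
          then obtain r where "r \<in> R" "r \<noteq> \<gamma>" "b < r" using assms(1) by force
          then show False using R\<gamma>[of r] \<gamma>(3)[of r] nz2[of r] assms(1) by auto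
        qed
        ultimately show ?thesis using Ra' Rc' i1 by simp
      next
        case E: True
        define \<delta> where "\<delta> = bump R \<gamma>"
        have \<delta>: "\<delta> \<in> R" "\<gamma> < \<delta>" "\<And>z. z \<in> R \<Longrightarrow> \<gamma> < z \<Longrightarrow> \<delta> \<le> z"
          using bump[OF assms(4) E] by (auto simp: \<delta>_def)
        have d: "\<delta> \<le> z" if "z \<in> R" "z \<noteq> \<gamma>" "a < z" for z
          using that \<gamma>(3)[of z] \<delta>(3)[of z] nz2[of z] by auto
        have b2: "bump (insert a (R - {\<gamma>})) c = \<delta>"
          using assms(1,2,4) \<delta> d \<gamma>(2) by (intro bump_eqI) auto
        have i2: "row_insert (insert a (R - {\<gamma>})) c = insert c (insert a (R - {\<gamma>}) - {\<delta>})"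
          using assms(1,2) N b2 by (auto simp: row_insert_def)
        have b3: "bump (insert c (insert a (R - {\<gamma>}) - {\<delta>})) b = c"
          using assms(1,2,4) nz2 by (intro bump_eqI) (auto intro: less_imp_le less_trans)
        have i3: "row_insert (insert c (insert a (R - {\<gamma>}) - {\<delta>})) b = insert b (insert a (R - {\<gamma>}) - {\<delta>})"
          using assms(1,2) N b3 \<gamma> \<delta> by (auto simp: row_insert_def)
        have b4: "bump (insert a (R - {\<gamma>})) b = \<delta>"
          using assms(1,2,4) \<delta> d \<gamma>(2) by (intro bump_eqI) auto
        have i4: "row_insert (insert a (R - {\<gamma>})) b = insert b (insert a (R - {\<gamma>}) - {\<delta>})"
          using assms(1,2) N b4 by (auto simp: row_insert_def)
        have "outs R [a, c, b] = [\<gamma>, \<delta>, c]" "outs R [c, a, b] = [\<gamma>, c, \<delta>]"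
          using Ra' Rc' i1 b1 b2 i2 b3 b4 \<alpha>\<gamma> by (simp_all add: \<alpha>_def[symmetric] \<gamma>_def[symmetric])
        moreover have "final R [a, c, b] = final R [c, a, b]" using Ra' Rc' i1 i2 i3 i4 by simp
        moreover have "\<exists>x\<in>R - {\<gamma>}. c < x" "\<exists>x\<in>R - {\<gamma>}. b < x"
          using \<delta>(1,2) \<gamma>(2) assms(2) by (auto intro!: bexI[of _ \<delta>])
        then have "can_pass R [a, c, b]"
          using Ra' i2 i3 Ea \<delta> \<gamma> assms(1,2,4) by auto
        moreover from \<open>\<exists>x\<in>R - {\<gamma>}. b < x\<close> have "can_pass R [c, a, b]"
          using Rc' i1 i4 True \<delta> \<gamma> assms(1,2,4) by auto
        moreover have "[\<gamma>, \<delta>, c] \<approx> [\<gamma>, c, \<delta>]"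
          using \<gamma> \<delta> by (intro ck_sym[OF ck_baseI] ck_bac) auto
        ultimately show ?thesis by simp
      qed
    qed
  qed
  then show "can_pass R [a, c, b] \<longleftrightarrow> can_pass R [c, a, b]"
    and "can_pass R [a, c, b] \<Longrightarrow> final R [a, c, b] = final R [c, a, b] \<and> outs R [a, c, b] \<approx> outs R [c, a, b]"
    by blast+
qed

text \<open>Here the kind of relation is preserved: \<open>b\<close> stays in the row, so
  \<open>a\<close> bumps at most \<open>b\<close>, whereas \<open>c\<close> bumps a letter larger
  than the one bumped by \<open>b\<close>. The insertions of \<open>a\<close> and \<open>c\<close>
  therefore do not interfere.\<close>

lemma outs_bac:
  assumes "a < b" "b < c" "reduced (row R @ [b, a, c])" "finite R"
  shows "can_pass R [b, a, c] \<longleftrightarrow> can_pass R [b, c, a]"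
    and "can_pass R [b, a, c] \<Longrightarrow> final R [b, a, c] = final R [b, c, a] \<and> outs R [b, a, c] \<approx> outs R [b, c, a]"
proof -
  have rb: "b \<in> R \<Longrightarrow> b + 1 \<in> R"
    using reduced_row_mem[OF assms(3,4)] by auto
  have "(can_pass R [b, a, c] \<longleftrightarrow> can_pass R [b, c, a]) \<and>
     (can_pass R [b, a, c] \<longrightarrow> final R [b, a, c] = final R [b, c, a] \<and> outs R [b, a, c] \<approx> outs R [b, c, a])"
  proof (cases "(\<exists>r\<in>R. b < r) \<and> (\<exists>r\<in>row_insert R b. c < r)")
    case False
    then have "\<not> can_pass R [b, a, c]" "\<not> can_pass R [b, c, a]"
      using assms(1,2) by (auto simp: row_insert_def[of _ a] split: if_splits)
    then show ?thesis by blast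
  next
    case True
    then have Eb: "\<exists>r\<in>R. b < r" and Ec: "\<exists>r\<in>row_insert R b. c < r" by auto
    define R1 where "R1 = row_insert R b"
    have fR1: "finite R1" using assms(4) by (simp add: R1_def)
    have bR1: "b \<in> R1" by (simp add: R1_def row_insert_mem)
    have Ea: "\<exists>r\<in>R1. a < r" using bR1 assms(1) by blast
    define \<alpha> where "\<alpha> = bump R1 a"
    define \<beta> where "\<beta> = bump R b"
    define \<gamma> where "\<gamma> = bump R1 c"
    have \<alpha>: "\<alpha> \<in> R1" "a < \<alpha>" "\<And>z. z \<in> R1 \<Longrightarrow> a < z \<Longrightarrow> \<alpha> \<le> z"
      using bump[OF fR1 Ea] by (auto simp: \<alpha>_def)
    have \<beta>: "\<beta> \<in> R" "b < \<beta>" "\<And>z. z \<in> R \<Longrightarrow> b < z \<Longrightarrow> \<beta> \<le> z"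
      using bump[OF assms(4) Eb] by (auto simp: \<beta>_def)
    have \<gamma>: "\<gamma> \<in> R1" "c < \<gamma>" "\<And>z. z \<in> R1 \<Longrightarrow> c < z \<Longrightarrow> \<gamma> \<le> z"
      using bump[OF fR1 Ec[folded R1_def]] by (auto simp: \<gamma>_def)
    have "\<alpha> \<le> b" using \<alpha>(3)[OF bR1] assms(1) by simp
    have "\<beta> < \<gamma>"
    proof (cases "b \<in> R")
      case True
      then have "\<beta> = b + 1" using rb \<beta> by force
      then show ?thesis using \<gamma>(2) assms(2) by simp
    next
      case False
      then have "R1 = insert b (R - {\<beta>})" by (simp add: R1_def row_insert_def \<beta>_def)
      then show ?thesis using \<gamma> \<beta>(3)[of \<gamma>] assms(2) by force
    qed
    have Ra: "row_insert R1 a = (if a \<in> R1 then R1 else insert a (R1 - {\<alpha>}))"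
      and Rc: "row_insert R1 c = (if c \<in> R1 then R1 else insert c (R1 - {\<gamma>}))"
      by (simp_all add: row_insert_def \<alpha>_def \<gamma>_def)
    have g: "bump (row_insert R1 a) c = \<gamma>"
      using assms(1,2,4) fR1 \<gamma> \<open>\<alpha> \<le> b\<close> by (intro bump_eqI) (auto simp: Ra split: if_splits)
    have h: "bump (row_insert R1 c) a = \<alpha>"
      using assms(1,2,4) fR1 \<alpha> \<gamma> \<open>\<alpha> \<le> b\<close> by (intro bump_eqI) (auto simp: Rc split: if_splits)
    have e: "row_insert (row_insert R1 a) c = row_insert (row_insert R1 c) a"
      unfolding row_insert_def[of "row_insert R1 a"] row_insert_def[of "row_insert R1 c"] g h
      using assms(1,2) \<open>\<alpha> \<le> b\<close> \<gamma>(2) \<alpha>(2) by (auto simp: Ra Rc)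
    have "[\<beta>, \<alpha>, \<gamma>] \<approx> [\<beta>, \<gamma>, \<alpha>]"
      using \<open>\<alpha> \<le> b\<close> \<beta>(2) \<open>\<beta> < \<gamma>\<close> by (intro ck_baseI ck_bac) auto
    moreover have "\<exists>r\<in>row_insert R1 a. c < r" using \<gamma> \<open>\<alpha> \<le> b\<close> assms(1,2) by (auto simp: Ra)
    moreover have "\<exists>r\<in>row_insert R1 c. a < r" using row_insert_mem[of c R1] assms(1,2) by (meson less_trans)
    ultimately show ?thesis using e g h Eb Ea Ec fR1 assms(4)
      by (auto simp: \<alpha>_def \<gamma>_def \<beta>_def R1_def)
  qed
  then show "can_pass R [b, a, c] \<longleftrightarrow> can_pass R [b, c, a]"
    and "can_pass R [b, a, c] \<Longrightarrow> final R [b, a, c] = final R [b, c, a] \<and> outs R [b, a, c] \<approx> outs R [b, c, a]"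
    by blast+
qed

text \<open>If \<open>a + 1\<close> is in the row, the result is the braid relation one step higher.
  Otherwise neither \<open>a\<close> nor \<open>a + 1\<close> is in the row, they compete for the
  same letter, and a Knuth relation appears.\<close>

lemma outs_braid:
  assumes "reduced (row R @ [a, a + 1, a])" "finite R"
  shows "can_pass R [a, a + 1, a] \<longleftrightarrow> can_pass R [a + 1, a, a + 1]"
    and "can_pass R [a, a + 1, a] \<Longrightarrow> final R [a, a + 1, a] = final R [a + 1, a, a + 1] \<and> outs R [a, a + 1, a] \<approx> outs R [a + 1, a, a + 1]"
proof -
  have red2: "reduced (row R @ [a + 1, a, a + 1])"
    using ck_reduced[OF ck_append_left[OF ck_baseI[OF ck_braid]]] assms(1) by blast
  have ra: "a \<in> R \<Longrightarrow> a + 1 \<in> R" and rc: "a + 1 \<in> R \<Longrightarrow> a + 1 + 1 \<in> R"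
    using reduced_row_mem[OF assms] reduced_row_mem[OF red2 assms(2)] by auto
  have "(can_pass R [a, a + 1, a] \<longleftrightarrow> can_pass R [a + 1, a, a + 1]) \<and>
     (can_pass R [a, a + 1, a] \<longrightarrow> final R [a, a + 1, a] = final R [a + 1, a, a + 1] \<and> outs R [a, a + 1, a] \<approx> outs R [a + 1, a, a + 1])"
  proof (cases "a + 1 \<in> R")
    case True
    then have r2: "a + 2 \<in> R" using rc by (simp add: add.assoc)
    have b1: "bump R a = a + 1" using True assms(2) by (rule bump_mem[rotated])
    have b2: "bump R (a + 1) = a + 2" using bump_mem[of R "a + 1"] r2 assms(2) by (simp add: add.assoc)
    have i2: "row_insert R (a + 1) = R" using True by (simp add: row_insert_def)
    have E: "\<exists>r\<in>R. a < r" "\<exists>r\<in>R. a + 1 < r" using True r2 by force+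
    have braid: "[a + 1, a + 2, a + 1] \<approx> [a + 2, a + 1, a + 2]"
      using ck_baseI[OF ck_braid[of "a + 1"]] by (simp add: add.assoc)
    show ?thesis
    proof (cases "a \<in> R")
      case aR: True
      then have i1: "row_insert R a = R" by (simp add: row_insert_def)
      show ?thesis using b1 b2 i1 i2 E braid assms(2) by auto
    next
      case aN: False
      define R1 where "R1 = insert a (R - {a + 1})"
      have i1: "row_insert R a = R1" using aN b1 by (simp add: row_insert_def R1_def)
      have b3: "bump R1 (a + 1) = a + 2"
        using assms(2) r2 by (intro bump_eqI) (auto simp: R1_def)
      have i3: "row_insert R1 (a + 1) = insert (a + 1) (R1 - {a + 2})"
        using b3 by (auto simp: row_insert_def R1_def)
      have b4: "bump (insert (a + 1) (R1 - {a + 2})) a = a + 1"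
        using assms(2) by (intro bump_mem) (auto simp: R1_def)
      have i4: "row_insert (insert (a + 1) (R1 - {a + 2})) a = insert (a + 1) (R1 - {a + 2})"
        by (simp add: row_insert_def R1_def)
      have E1: "\<exists>r\<in>R1. a + 1 < r" using r2 by (force simp: R1_def)
      have E2: "\<exists>r\<in>insert (a + 1) (R1 - {a + 2}). a < r" by force
      have fR1: "finite R1" using assms(2) by (simp add: R1_def)
      show ?thesis using b1 b2 b3 b4 i1 i2 i3 i4 E E1 E2 fR1 braid assms(2) by simp
    qed
  next
    case False
    then have aN: "a \<notin> R" using ra by blast
    have gt: "a < r \<longleftrightarrow> a + 1 < r" if "r \<in> R" for r using that False by (cases "r = a + 1") auto
    show ?thesis
    proof (cases "\<exists>r\<in>R. a < r")
      case F: False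
      then show ?thesis using gt by auto
    next
      case E: True
      then have E1: "\<exists>r\<in>R. a + 1 < r" using gt by blast
      define \<alpha> where "\<alpha> = bump R a"
      have \<alpha>: "\<alpha> \<in> R" "a < \<alpha>" "\<And>z. z \<in> R \<Longrightarrow> a < z \<Longrightarrow> \<alpha> \<le> z"
        using bump[OF assms(2) E] by (auto simp: \<alpha>_def)
      have b1: "bump R (a + 1) = \<alpha>" using \<alpha> gt assms(2) by (intro bump_eqI) auto
      have i1: "row_insert R a = insert a (R - {\<alpha>})" and i2: "row_insert R (a + 1) = insert (a + 1) (R - {\<alpha>})"
        using False aN b1 by (auto simp: row_insert_def \<alpha>_def)
      have b2: "bump (insert (a + 1) (R - {\<alpha>})) a = a + 1"
        using assms(2) by (intro bump_mem) auto
      have i3: "row_insert (insert (a + 1) (R - {\<alpha>})) a = insert a (R - {\<alpha>})"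
        using False aN b2 by (auto simp: row_insert_def)
      show ?thesis
      proof (cases "\<exists>r\<in>R. \<alpha> < r")
        case F: False
        then have "\<not> (\<exists>r\<in>insert a (R - {\<alpha>}). a + 1 < r)"
          using \<alpha> gt by force
        then show ?thesis using i1 i2 i3 by simp
      next
        case E2: True
        define \<delta> where "\<delta> = bump R \<alpha>"
        have \<delta>: "\<delta> \<in> R" "\<alpha> < \<delta>" "\<And>z. z \<in> R \<Longrightarrow> \<alpha> < z \<Longrightarrow> \<delta> \<le> z"
          using bump[OF assms(2) E2] by (auto simp: \<delta>_def)
        have d: "\<delta> \<le> z" if "z \<in> R" "z \<noteq> \<alpha>" "a < z" for z
          using that \<delta>(3)[of z] \<alpha>(3)[of z] by force
        have lt: "a + 1 < \<alpha>" using gt \<alpha> by blast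
        have b3: "bump (insert a (R - {\<alpha>})) (a + 1) = \<delta>"
          using assms(2) \<delta> d lt by (intro bump_eqI) auto
        have i4: "row_insert (insert a (R - {\<alpha>})) (a + 1) = insert (a + 1) (insert a (R - {\<alpha>}) - {\<delta>})"
          using b3 False by (auto simp: row_insert_def)
        have b4: "bump (insert (a + 1) (insert a (R - {\<alpha>}) - {\<delta>})) a = a + 1"
          using assms(2) by (intro bump_mem) auto
        have i5: "row_insert (insert (a + 1) (insert a (R - {\<alpha>}) - {\<delta>})) a = insert (a + 1) (insert a (R - {\<alpha>}) - {\<delta>})"
          using \<delta> \<alpha> by (auto simp: row_insert_def)
        have "outs R [a, a + 1, a] = [\<alpha>, \<delta>, a + 1]" "outs R [a + 1, a, a + 1] = [\<alpha>, a + 1, \<delta>]"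
          using b1 b2 b3 b4 i1 i2 i3 i4 by (simp_all add: \<alpha>_def[symmetric])
        moreover have "final R [a, a + 1, a] = final R [a + 1, a, a + 1]" using i1 i2 i3 i4 i5 by simp
        moreover have "\<exists>r\<in>insert a (R - {\<alpha>}). a + 1 < r" using \<delta>(1,2) lt by (intro bexI[of _ \<delta>]) auto
        then have "can_pass R [a, a + 1, a]" "can_pass R [a + 1, a, a + 1]"
          using i1 i2 i3 i4 i5 E E1 assms(2) by auto
        moreover have "[\<alpha>, \<delta>, a + 1] \<approx> [\<alpha>, a + 1, \<delta>]"
          using lt \<delta> by (intro ck_sym[OF ck_baseI] ck_bac) auto
        ultimately show ?thesis by simp
      qed
    qed
  qed
  then show "can_pass R [a, a + 1, a] \<longleftrightarrow> can_pass R [a + 1, a, a + 1]"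
    and "can_pass R [a, a + 1, a] \<Longrightarrow> final R [a, a + 1, a] = final R [a + 1, a, a + 1] \<and> outs R [a, a + 1, a] \<approx> outs R [a + 1, a, a + 1]"
    by blast+
qed

lemma outs_ck_base:
  assumes "ck_base x y" "reduced (row R @ x)" "finite R"
  shows "can_pass R x \<longleftrightarrow> can_pass R y" 
    and "can_pass R x \<Longrightarrow> final R x = final R y \<and> outs R x \<approx> outs R y"
proof -
  have "(can_pass R x \<longleftrightarrow> can_pass R y) \<and> (can_pass R x \<longrightarrow> final R x = final R y \<and> outs R x \<approx> outs R y)"
    using assms
  proof (cases rule: ck_base.cases)
    case (ck_acb a b c)
    then show ?thesis using outs_acb[of a b c R] assms(2,3) by blast
  next
    case (ck_bac a b c)
    then show ?thesis using outs_bac[of a b c R] assms(2,3) by blast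
  next
    case (ck_braid a)
    then show ?thesis using outs_braid[of R a] assms(2,3) by blast
  qed
  then show "can_pass R x \<longleftrightarrow> can_pass R y" 
    and "can_pass R x \<Longrightarrow> final R x = final R y \<and> outs R x \<approx> outs R y" by blast+
qed

text \<open>A local change affects the later insertions only through the row, and the row is the
  same after both sides of a basic relation.\<close>

lemma outs_ck_aux:
  assumes "c \<approx> d" "reduced (row R @ c)"
  shows "(can_pass R c \<longleftrightarrow> can_pass R d) \<and> (can_pass R c \<longrightarrow> final R c = final R d \<and> outs R c \<approx> outs R d)"
  using assms
proof (induction rule: ck.induct)
  case (ck_sym c d)
  have "reduced (row R @ c)" using ck_reduced[OF ck_append_left[OF ck_sym.hyps]] ck_sym.prems by blast
  from ck_sym.IH[OF this] show ?case using ck.ck_sym by metis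
next
  case (ck_trans c d e)
  have "reduced (row R @ d)" using ck_reduced[OF ck_append_left[OF ck_trans.hyps(1)]] ck_trans.prems by blast
  from ck_trans.IH(1)[OF ck_trans.prems] ck_trans.IH(2)[OF this] show ?case using ck.ck_trans by metis
next
  case (ck_infix x y p s)
  show ?case
  proof (cases "can_pass R p")
    case True
    have "reduced (row (final R p) @ x @ s)"
      by (rule reduced_final(2)[OF True]) (rule ck_infix.prems)
    then have "reduced (row (final R p) @ x)" using reduced_appendD(1)[of "row (final R p) @ x" s] by simp
    from outs_ck_base[OF ck_infix.hyps this can_pass_final[OF True]]
    have b: "can_pass (final R p) x \<longleftrightarrow> can_pass (final R p) y"
      "can_pass (final R p) x \<Longrightarrow> final (final R p) x = final (final R p) y \<and> outs (final R p) x \<approx> outs (final R p) y" by blast+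
    show ?thesis
    proof (cases "can_pass (final R p) x")
      case t: True
      from b(2)[OF this] show ?thesis using b(1) t
        by (simp add: can_pass_append outs_append final_append ck_append)
    next
      case False
      then show ?thesis using b(1) by (simp add: can_pass_append)
    qed
  qed (simp add: can_pass_append)
qed simp

lemma outs_ck:
  assumes "c \<approx> d" "reduced (row R @ c)" "can_pass R c"
  shows "can_pass R d" "final R d = final R c" "outs R c \<approx> outs R d"
  using outs_ck_aux[OF assms(1,2)] assms(3) by auto

subsection \<open>Reversing row insertion\<close>

text \<open>Undoing an insertion means inserting the bumped letter from above; after negation this
  is an ordinary row insertion. If \<open>x\<close> was already present, \<open>x + 1\<close> was
  bumped, and its negative bumps \<open>- x\<close> back, again without changing the row.\<close>

lemma row_insert_reverse:
  assumes "finite R" "\<exists>r\<in>R. x < r" "x \<in> R \<Longrightarrow> x + 1 \<in> R"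
  defines "R' \<equiv> uminus ` row_insert R x"
  shows "bump R' (- bump R x) = - x" and "row_insert R' (- bump R x) = uminus ` R"
    and "\<exists>r\<in>R'. - bump R x < r"
proof -
  define y where "y = bump R x"
  have y: "y \<in> R" "x < y" "\<And>z. z \<in> R \<Longrightarrow> x < z \<Longrightarrow> y \<le> z"
    using bump[OF assms(1,2)] unfolding y_def by auto
  have fin: "finite R'" using assms(1) by (simp add: R'_def)
  have x: "- x \<in> R'" by (simp add: R'_def row_insert_mem)
  then show "\<exists>r\<in>R'. - bump R x < r" using y(2) by (intro bexI[of _ "- x"]) (simp_all add: y_def)
  have "bump R' (- y) = - x"
  proof (rule bump_eqI[OF fin x])
    show "- y < - x" using y by simp
    fix z assume "z \<in> R'" "- y < z"
    then obtain r where r: "z = - r" "r \<in> row_insert R x" "r < y" by (auto simp: R'_def)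
    then have "r \<le> x" using y(3)[of r] by (cases "r \<le> x") (auto simp: row_insert_def split: if_splits)
    then show "- x \<le> z" using r by simp
  qed
  then show b: "bump R' (- bump R x) = - x" by (simp add: y_def)
  show "row_insert R' (- bump R x) = uminus ` R"
  proof (cases "x \<in> R")
    case True
    then have "R' = uminus ` R" by (simp add: R'_def row_insert_def)
    then show ?thesis using y(1) by (simp add: row_insert_def y_def)
  next
    case False
    then have "R' = insert (- x) (uminus ` R - {- y})" using y by (auto simp: R'_def row_insert_def y_def)
    moreover from this have "- y \<notin> R'" using y False by auto
    ultimately show ?thesis using b y False by (auto simp: row_insert_def y_def[symmetric])
  qed
qed

lemma outs_reverse:
  assumes "can_pass R c" "reduced (row R @ c)"
  shows "can_pass (uminus ` final R c) (star (outs R c)) \<and>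
    outs (uminus ` final R c) (star (outs R c)) = star c \<and>
    final (uminus ` final R c) (star (outs R c)) = uminus ` R"
  using assms
proof (induction c arbitrary: R)
  case (Cons x c)
  have ex: "finite R" "\<exists>r\<in>R. x < r" and cp: "can_pass (row_insert R x) c" using Cons.prems by auto
  have mem: "x \<in> R \<Longrightarrow> x + 1 \<in> R" using reduced_row_mem[OF Cons.prems(2) ex(1)] .
  have "reduced (row (row_insert R x) @ c)"
    using reduced_final(2)[of R "[x]" c] Cons.prems ex by simp
  from Cons.IH[OF cp this] row_insert_reverse[OF ex mem]
  show ?case using ex(1) by (simp add: star_Cons can_pass_append outs_append final_append)
qed simp

lemma outs_inj:
  assumes "can_pass R c" "reduced (row R @ c)" "can_pass R' d" "reduced (row R' @ d)"
    and "outs R c = outs R' d" "final R c = final R' d"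
  shows "c = d" and "R = R'"
proof -
  note 1 = outs_reverse[OF assms(1,2)] and 2 = outs_reverse[OF assms(3,4)]
  have "star c = star d" using 1 2 assms(5,6) by metis
  then show "c = d" by (metis star_star)
  have "uminus ` R = uminus ` R'" using 1 2 assms(5,6) by metis
  then show "R = R'" by (simp add: inj_image_eq_iff)
qed

lemma row_uminus: "finite R \<Longrightarrow> row (uminus ` R) = star (row R)"
proof -
  assume "finite R"
  then have "sorted_wrt (<) (star (row R))" "set (star (row R)) = uminus ` R"
    by (auto simp: star_def sorted_wrt_map sorted_wrt_rev)
  then show ?thesis using row_set by metis
qed

text \<open>Insertion is onto each class: reverse insertion is itself an insertion and so respects
  classes, and it carries every word equivalent to the output back to a word equivalent to the
  input. The formula for \<open>star d\<close> shows later that decreasing factors are lifted to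
  decreasing factors.\<close>

lemma outs_ck_lift:
  assumes "can_pass R c" "reduced (row R @ c)" "outs R c \<approx> d'"
  shows "\<exists>d. d \<approx> c \<and> can_pass R d \<and> outs R d = d' \<and> final R d = final R c \<and>
     star d = outs (uminus ` final R c) (star d') \<and> can_pass (uminus ` final R c) (star d')"
proof -
  define R1 where "R1 = uminus ` final R c"
  have fin: "finite R" "finite (final R c)" using assms(1) can_pass_finite can_pass_final by auto
  have rev: "can_pass R1 (star (outs R c))" "outs R1 (star (outs R c)) = star c"
    "final R1 (star (outs R c)) = uminus ` R"
    using outs_reverse[OF assms(1,2)] by (auto simp: R1_def)
  have eq: "row R1 @ star (outs R c) = star (outs R c @ row (final R c))"
    using row_uminus[OF fin(2)] by (simp add: star_append R1_def)
  have red: "reduced (row R1 @ star (outs R c))"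
    unfolding eq reduced_star using reduced_final(1)[of R c "[]"] assms(1,2) by simp
  note T = outs_ck[OF ck_star[OF assms(3)] red rev(1)]
  define d where "d = star (outs R1 (star d'))"
  have red': "reduced (row R1 @ star d')"
    using ck_reduced[OF ck_append_left[OF ck_star[OF assms(3)]]] red by blast
  have "uminus ` final R1 (star d') = R" using T(2) rev(3) by (simp add: image_image)
  moreover have "uminus ` R1 = final R c" by (simp add: R1_def image_image)
  ultimately have "can_pass R d \<and> outs R d = d' \<and> final R d = final R c"
    using outs_reverse[OF T(1) red'] by (simp add: d_def)
  moreover have "d \<approx> c" using ck_star[OF T(3)] rev(2) ck_sym by (simp add: d_def)
  moreover have "star d = outs R1 (star d')" by (simp add: d_def)
  ultimately show ?thesis using T(1) by (auto simp: R1_def)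
qed

subsection \<open>Raising and lowering pairs of finite sets\<close>

abbreviation dec :: "int set \<Rightarrow> int list" where
  "dec A \<equiv> rev (row A)"

lemma dec_set: "sorted_wrt (>) l \<Longrightarrow> dec (set l) = l"
  using row_set[of "rev l"] by (simp add: sorted_wrt_rev)

lemma sorted_dec: "sorted_wrt (>) (dec A)"
  by (simp add: sorted_wrt_rev)

lemma set_dec [simp]: "finite A \<Longrightarrow> set (dec A) = A"
  by simp

lemma dec_eqI: "sorted_wrt (>) l \<Longrightarrow> set l = A \<Longrightarrow> dec A = l"
  using dec_set by blast

lemma dec_split:
  assumes "finite A" "y \<in> A"
  shows "dec A = dec {r \<in> A. y < r} @ y # dec {r \<in> A. r < y}"
  using row_split[OF assms] by simp

lemma dec_uminus: "finite A \<Longrightarrow> dec (uminus ` A) = star (dec A)"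
  using row_uminus by (simp add: star_def rev_map)

text \<open>
  The largest unpaired letter of \<open>v\<close> is the first place where the lattice path \<open>height u v\<close> attains its
  minimum, and it exists if and only if this minimum is negative.
\<close>

definition height :: "int set \<Rightarrow> int set \<Rightarrow> int \<Rightarrow> int" where
  "height u v k = int (card {b \<in> u. b < k}) - int (card {c \<in> v. c \<le> k})"

definition first_min :: "int set \<Rightarrow> int set \<Rightarrow> int \<Rightarrow> bool" where
  "first_min u v x \<longleftrightarrow> (\<forall>k<x. height u v x < height u v k) \<and> (\<forall>k. height u v x \<le> height u v k)"

definition gap :: "int \<Rightarrow> int set \<Rightarrow> nat" where
  "gap x u = (LEAST q. x + int q \<notin> u)"

definition raise :: "int set \<Rightarrow> int set \<Rightarrow> (int set \<times> int set) option" where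
  "raise u v = (if \<exists>x. first_min u v x
     then let x = (THE x. first_min u v x) in Some (insert (x + int (gap x u)) u, v - {x}) else None)"

text \<open>Raising conjugated by the mirror symmetry. That this is the operator
  \<open>f_pair\<close> on unprimed letters is established in \<open>f_pair_None\<close> and
  \<open>f_pair_Some\<close>.\<close>

definition lower :: "int set \<Rightarrow> int set \<Rightarrow> (int set \<times> int set) option" where
  "lower u v = map_option (\<lambda>(V, U). (uminus ` U, uminus ` V)) (raise (uminus ` v) (uminus ` u))"

lemma first_min_unique: "first_min u v x \<Longrightarrow> first_min u v y \<Longrightarrow> x = y"
  unfolding first_min_def by (metis less_le_not_le linorder_neqE)

lemma raise_eqI: "first_min u v x \<Longrightarrow> raise u v = Some (insert (x + int (gap x u)) u, v - {x})"
  unfolding raise_def using first_min_unique by (metis (mono_tags, lifting) the_equality)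

lemma raise_SomeE:
  assumes "raise u v = Some (U, V)"
  obtains x where "first_min u v x" "U = insert (x + int (gap x u)) u" "V = v - {x}"
  using assms raise_eqI[of u v] unfolding raise_def by (metis (no_types, lifting) Pair_inject option.discI option.inject)

lemma gap_not_in: "finite u \<Longrightarrow> x + int (gap x u) \<notin> u"
proof -
  assume "finite u"
  then obtain B where B: "\<And>b. b \<in> u \<Longrightarrow> b \<le> B" by (metis Max_ge)
  have "x + int (nat (\<bar>B\<bar> + \<bar>x\<bar> + 1)) \<notin> u" using B[of "x + int (nat (\<bar>B\<bar> + \<bar>x\<bar> + 1))"] by auto
  then show ?thesis unfolding gap_def by (rule LeastI)
qed

lemma gap_less: "j < gap x u \<Longrightarrow> x + int j \<in> u"
  unfolding gap_def using not_less_Least by blast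

lemma gap_eqI: "x + int q \<notin> u \<Longrightarrow> (\<And>j. j < q \<Longrightarrow> x + int j \<in> u) \<Longrightarrow> gap x u = q"
  unfolding gap_def by (rule Least_equality) (auto simp: not_less[symmetric])

lemma gap_0: "x \<notin> u \<Longrightarrow> gap x u = 0"
  by (rule gap_eqI) auto

lemma height_insert_left:
  "finite u \<Longrightarrow> a \<notin> u \<Longrightarrow> height (insert a u) v k = height u v k + (if a < k then 1 else 0)"
proof -
  assume a: "finite u" "a \<notin> u"
  have "{b \<in> insert a u. b < k} = (if a < k then insert a {b \<in> u. b < k} else {b \<in> u. b < k})" by auto
  then show ?thesis using a by (simp add: height_def)
qed

lemma height_insert_right:
  "finite v \<Longrightarrow> a \<notin> v \<Longrightarrow> height u (insert a v) k = height u v k - (if a \<le> k then 1 else 0)"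
proof -
  assume a: "finite v" "a \<notin> v"
  have "{b \<in> insert a v. b \<le> k} = (if a \<le> k then insert a {b \<in> v. b \<le> k} else {b \<in> v. b \<le> k})" by auto
  then show ?thesis using a by (simp add: height_def)
qed

lemma height_remove_left:
  "finite u \<Longrightarrow> a \<in> u \<Longrightarrow> height (u - {a}) v k = height u v k - (if a < k then 1 else 0)"
  using height_insert_left[of "u - {a}" a v k] by (simp add: insert_absorb)

lemma height_remove_right:
  "finite v \<Longrightarrow> a \<in> v \<Longrightarrow> height u (v - {a}) k = height u v k + (if a \<le> k then 1 else 0)"
  using height_insert_right[of "v - {a}" a u k] by (simp add: insert_absorb)

text \<open>A letter of \<open>u\<close> lifts the path only after its own position, a letter of
  \<open>v\<close> lowers it at its position. This matches the strict inequality in a pair: equal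
  letters are not paired with each other.\<close>

lemma height_step:
  assumes "finite u" "finite v"
  shows "height u v (k + 1) = height u v k + (if k \<in> u then 1 else 0) - (if k + 1 \<in> v then 1 else 0)"
proof -
  have 1: "{b \<in> u. b < k + 1} = (if k \<in> u then insert k {b \<in> u. b < k} else {b \<in> u. b < k})"
    by (auto simp: less_le)
  have 2: "{c \<in> v. c \<le> k + 1} = (if k + 1 \<in> v then insert (k + 1) {c \<in> v. c \<le> k} else {c \<in> v. c \<le> k})"
    by (auto simp: order.order_iff_strict)
  show ?thesis using assms unfolding height_def 1 2 by auto
qed

lemma height_low:
  assumes "\<And>b. b \<in> u \<Longrightarrow> k \<le> b" "\<And>c. c \<in> v \<Longrightarrow> k < c"
  shows "height u v k = 0"
proof -
  have "{b \<in> u. b < k} = {}" "{c \<in> v. c \<le> k} = {}" using assms by force+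
  then show ?thesis by (simp only: height_def card.empty)
qed

lemma ex_height_0:
  assumes "finite u" "finite v" shows "\<exists>k. height u v k = 0 \<and> k < l"
proof -
  obtain B where B: "\<And>b. b \<in> insert l (u \<union> v) \<Longrightarrow> B \<le> b" using assms by (metis finite_UnI finite_insert Min_le)
  have "height u v (B - 1) = 0" using B by (intro height_low) force+
  moreover have "B - 1 < l" using B[of l] by simp
  ultimately show ?thesis by blast
qed

text \<open>The mirror symmetry reflects the path and shifts it by a constant, so the first minimum
  of the mirrored pair is the last minimum of the original one.\<close>

lemma height_uminus:
  assumes "finite u" "finite v"
  shows "height (uminus ` v) (uminus ` u) (- k) = height u v k + int (card v) - int (card u)"
proof -
  have "{b \<in> uminus ` v. b < - k} = uminus ` {c \<in> v. k < c}" "{b \<in> uminus ` u. b \<le> - k} = uminus ` {c \<in> u. k \<le> c}"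
    by auto
  then have "height (uminus ` v) (uminus ` u) (- k) = int (card {c \<in> v. k < c}) - int (card {c \<in> u. k \<le> c})"
    by (simp add: height_def card_image)
  moreover have "card v = card {c \<in> v. c \<le> k} + card {c \<in> v. k < c}"
    using assms by (subst card_Un_disjoint[symmetric]) (auto intro!: arg_cong[of _ _ card])
  moreover have "card u = card {c \<in> u. c < k} + card {c \<in> u. k \<le> c}"
    using assms by (subst card_Un_disjoint[symmetric]) (auto intro!: arg_cong[of _ _ card])
  ultimately show ?thesis by (simp add: height_def)
qed

text \<open>A negative value is essential: the path vanishes far to the left, so a minimum at level
  0 would have no first place. Below all letters of \<open>v\<close> the path is nonnegative, which
  confines the search to a finite interval.\<close>

lemma ex_first_min:
  assumes "finite u" "finite v" "height u v k < 0"
  shows "\<exists>x. first_min u v x"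
proof -
  define g where "g k = nat (height u v k + int (card v))" for k
  have ge: "height u v k \<ge> - int (card v)" for k
    using card_mono[OF assms(2), of "{c \<in> v. c \<le> k}"] by (simp add: height_def)
  have gh: "g i \<le> g j \<longleftrightarrow> height u v i \<le> height u v j" for i j using ge[of i] ge[of j] by (auto simp: g_def)
  obtain m where m: "\<And>j. g m \<le> g j"
    using ex_has_least_nat[of "\<lambda>_. True" k g] by auto
  have m': "height u v m \<le> height u v j" for j using m gh by blast
  have neg: "height u v m < 0" using m'[of k] assms(3) by simp
  obtain B where B: "\<And>b. b \<in> insert m v \<Longrightarrow> B \<le> b" using assms by (metis finite_insert Min_le)
  have pos: "height u v j \<ge> 0" if "j < B" for j
  proof -
    have "{c \<in> v. c \<le> j} = {}" using that B by force
    then have "card {c \<in> v. c \<le> j} = 0" by (simp only: card.empty)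
    then show ?thesis by (simp add: height_def)
  qed
  define S where "S = {j \<in> {B..m}. height u v j = height u v m}"
  have "B \<le> m" using B by simp
  then have S: "finite S" "m \<in> S" unfolding S_def by (auto intro: finite_subset[of _ "{B..m}"])
  then have x: "Min S \<in> S" by (intro Min_in) auto
  have "first_min u v (Min S)"
    unfolding first_min_def
  proof (intro conjI allI impI)
    fix j assume j: "j < Min S"
    then have "j \<notin> S" using Min_le[OF S(1), of j] by (meson not_le)
    moreover have "height u v (Min S) = height u v m" "Min S \<le> m" using x by (auto simp: S_def)
    ultimately show "height u v (Min S) < height u v j"
      using pos[of j] neg m'[of j] j by (cases "j < B") (auto simp: S_def)
  qed (use x m' in \<open>auto simp: S_def\<close>)
  then show ?thesis by blast
qed

lemma raise_NoneD: "finite u \<Longrightarrow> finite v \<Longrightarrow> raise u v = None \<Longrightarrow> height u v k \<ge> 0"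
  using ex_first_min[of u v k] raise_eqI[of u v] by force

lemma height_high:
  assumes "finite u" "finite v" shows "\<exists>k. height u v k = int (card u) - int (card v)"
proof -
  obtain k where "height (uminus ` v) (uminus ` u) k = 0" using ex_height_0[of "uminus ` v" "uminus ` u"] assms by auto
  then show ?thesis using height_uminus[OF assms, of "- k"] by (intro exI[of _ "- k"]) simp
qed

section \<open>Runs shared by the factors of a reduced product\<close>

definition run :: "int \<Rightarrow> nat \<Rightarrow> int list" where
  "run x n = rev [x..x + int n]"

lemma run_0 [simp]: "run x 0 = [x]"
  by (simp add: run_def)

lemma run_Suc: "run x (Suc n) = (x + int n + 1) # run x n"
proof -
  have "[x..x + int (Suc n)] = [x..x + int n] @ [x + int n + 1]"
    using upto_rec2[of x "x + int n + 1"] by (simp add: add.commute add.left_commute)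
  then show ?thesis by (simp add: run_def)
qed

lemma set_run [simp]: "set (run x n) = {x..x + int n}"
  by (simp add: run_def)

lemma sorted_run: "sorted_wrt (>) (run x n)"
  by (induction n) (auto simp: run_Suc)

lemma word_perm_commute_words:
  assumes "\<forall>i \<in> set c. \<forall>j \<in> set d. \<bar>i - j\<bar> \<ge> 2"
  shows "word_perm (c @ d) = word_perm (d @ c)"
proof -
  have "word_perm c (word_perm d k) = word_perm d (word_perm c k)" for k
    using assms
  proof (induction c arbitrary: k)
    case (Cons i c)
    have "adj_transp i (word_perm d l) = word_perm d (adj_transp i l)" for l
      using fun_cong[OF word_perm_commute_word[of d i], of l] Cons.prems by simp
    then show ?case using Cons by (simp add: word_perm_Cons)
  qed simp
  then show ?thesis by (auto simp: word_perm_append)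
qed

text \<open>The top letter \<open>y\<close> of the second run commutes through \<open>W\<close> and
  through all of the first run except its two top letters. The braid move on
  \<open>y, y - 1, y\<close> then exposes the same pattern with shorter runs, until a single
  repeated letter is left.\<close>

lemma not_reduced_run:
  assumes "\<forall>j \<in> set W. j \<le> x - 2 \<or> x + int n + 2 \<le> j"
  shows "\<not> reduced (run x n @ W @ run x n)"
  using assms
proof (induction n)
  case 0
  then have "\<forall>j \<in> set W. \<bar>x - j\<bar> \<ge> 2" by auto
  then show ?case using not_reduced_repeat[of W x] by simp
next
  case (Suc n)
  define y where "y = x + int n + 1"
  define r where "r = tl (run x n)"
  have r: "run x n = (y - 1) # r" unfolding r_def y_def by (cases n) (simp_all add: run_Suc)
  have rset: "j \<le> y - 2" if "j \<in> set r" for j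
  proof -
    have "distinct (run x n)" by (simp add: run_def)
    then have "j \<in> {x..y - 1} \<and> j \<noteq> y - 1" using that r set_run[of x n] by (auto simp: y_def)
    then show ?thesis by auto
  qed
  have comm: "word_perm ((r @ W) @ [y]) = word_perm ([y] @ (r @ W))"
    using Suc.prems rset by (intro word_perm_commute_words) (fastforce simp: y_def)
  have br: "word_perm [y, y - 1, y] = word_perm [y - 1, y, y - 1]"
    using ck_word_perm[OF ck_baseI[OF ck_braid[of "y - 1"]]] by simp
  have "word_perm (run x (Suc n) @ W @ run x (Suc n)) = word_perm ([y, y - 1] @ (((r @ W) @ [y]) @ run x n))"
    by (simp add: run_Suc y_def[symmetric] r)
  also have "\<dots> = word_perm ([y, y - 1] @ (([y] @ (r @ W)) @ run x n))"
    by (simp only: word_perm_append[of "[y, y - 1]"] word_perm_append[of _ "run x n"] comm)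
  also have "\<dots> = word_perm ([y, y - 1, y] @ (r @ W @ run x n))" by simp
  also have "\<dots> = word_perm ([y - 1, y, y - 1] @ (r @ W @ run x n))" by (simp only: word_perm_append[of _ "r @ W @ run x n"] br)
  also have "\<dots> = word_perm ([y - 1, y] @ (run x n @ W @ run x n))" by (simp add: r)
  finally have "reduced (run x (Suc n) @ W @ run x (Suc n)) \<longleftrightarrow> reduced ([y - 1, y] @ (run x n @ W @ run x n))"
    by (rule reduced_cong) (simp add: run_Suc)
  then show ?case using Suc.IH Suc.prems reduced_appendD(2) by force
qed

lemma dec_split_run:
  assumes "finite A" "{x..x + int n} \<subseteq> A"
  shows "dec A = dec {r \<in> A. x + int n < r} @ run x n @ dec {r \<in> A. r < x}"
proof (rule dec_eqI)
  show "set (dec {r \<in> A. x + int n < r} @ run x n @ dec {r \<in> A. r < x}) = A" using assms by auto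
  show "sorted_wrt (>) (dec {r \<in> A. x + int n < r} @ run x n @ dec {r \<in> A. r < x})"
    using assms(1) sorted_run sorted_dec by (auto simp: sorted_wrt_append)
qed

text \<open>The path drops at its first minimum \<open>x\<close>, which gives the position of
  \<open>x\<close>, and it cannot drop below the minimum just after \<open>x + q\<close>, which
  excludes \<open>x + q + 1\<close>. That \<open>v\<close> contains the whole run from
  \<open>x\<close> to \<open>x + q\<close> comes from reducedness: were \<open>v\<close> to leave
  the run earlier, both factors would contain the same isolated run. Along the run the path is
  flat.\<close>

lemma raise_structure:
  assumes fin: "finite u" "finite v" and red: "reduced (dec u @ dec v)" and x: "first_min u v x"
  defines "q \<equiv> int (gap x u)"
  shows "x - 1 \<notin> u" "{x..<x + q} \<subseteq> u" "x + q \<notin> u" "{x..x + q} \<subseteq> v" "x + q + 1 \<notin> v"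
    and "\<And>k. x \<le> k \<Longrightarrow> k \<le> x + q \<Longrightarrow> height u v k = height u v x"
proof -
  have "height u v x < height u v (x - 1)" using x by (simp add: first_min_def)
  then have xv: "x \<in> v" and xu: "x - 1 \<notin> u" using height_step[OF fin, of "x - 1"] by (auto split: if_splits)
  show "x - 1 \<notin> u" by (rule xu)
  show qu: "x + q \<notin> u" unfolding q_def by (rule gap_not_in[OF fin(1)])
  have run_u: "x + int j \<in> u" if "j < gap x u" for j using that by (rule gap_less)
  show sub: "{x..<x + q} \<subseteq> u"
  proof
    fix z assume "z \<in> {x..<x + q}"
    then show "z \<in> u" using run_u[of "nat (z - x)"] by (auto simp: q_def)
  qed
  have run_v: "{x..x + int j} \<subseteq> v" if "j \<le> gap x u" for j
    using that
  proof (induction j)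
    case 0
    then show ?case using xv by simp
  next
    case (Suc j)
    then have IH: "{x..x + int j} \<subseteq> v" by simp
    have "x + int j + 1 \<in> v"
    proof (rule ccontr)
      assume n: "x + int j + 1 \<notin> v"
      have ju: "{x..x + int j} \<subseteq> u" using sub Suc.prems by (auto simp: q_def)
      \<comment> \<open>The letters standing between the two copies of the run: what follows the run
        in \<open>dec u\<close> and what precedes it in \<open>dec v\<close>. None of them is
        adjacent to the run.\<close>
      define W where "W = dec {r \<in> u. r < x} @ dec {r \<in> v. x + int j < r}"
      have "\<forall>i \<in> set W. i \<le> x - 2 \<or> x + int j + 2 \<le> i"
      proof
        fix i assume "i \<in> set W"
        then consider "i \<in> u" "i < x" | "i \<in> v" "x + int j < i" using fin by (auto simp: W_def)
        then show "i \<le> x - 2 \<or> x + int j + 2 \<le> i"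
        proof cases
          case 1
          then show ?thesis using xu by (cases "i = x - 1") auto
        next
          case 2
          then show ?thesis using n by (cases "i = x + int j + 1") auto
        qed
      qed
      then have nr: "\<not> reduced (run x j @ W @ run x j)" by (rule not_reduced_run)
      have "dec u @ dec v = dec {r \<in> u. x + int j < r} @ (run x j @ W @ run x j) @ dec {r \<in> v. r < x}"
        using dec_split_run[OF fin(1) ju] dec_split_run[OF fin(2) IH] by (simp add: W_def)
      from red[unfolded this] have "reduced (run x j @ W @ run x j)" by (rule reduced_middleD)
      then show False using nr by blast
    qed
    moreover have "{x..x + int (Suc j)} = insert (x + int j + 1) {x..x + int j}" by auto
    ultimately show ?case using IH by auto
  qed
  show qv: "{x..x + q} \<subseteq> v" using run_v[of "gap x u"] by (simp add: q_def)
  have flat: "height u v (x + int j) = height u v x" if "j \<le> gap x u" for j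
    using that
  proof (induction j)
    case (Suc j)
    then have "x + int j \<in> u" "x + int j + 1 \<in> v" using run_u[of j] qv by (auto simp: q_def)
    then show ?case using height_step[OF fin, of "x + int j"] Suc by (simp add: add.commute add.left_commute)
  qed simp
  show "height u v k = height u v x" if "x \<le> k" "k \<le> x + q" for k
    using flat[of "nat (k - x)"] that by (simp add: q_def)
  have "height u v (x + q + 1) \<ge> height u v (x + q)" using flat[of "gap x u"] x by (simp add: first_min_def q_def)
  then show "x + q + 1 \<notin> v" using height_step[OF fin, of "x + q"] qu by auto
qed

lemma finite_raise: "raise u v = Some (U, V) \<Longrightarrow> finite u \<Longrightarrow> finite v \<Longrightarrow> finite U \<and> finite V"
  by (elim raise_SomeE) simp

lemma card_raise:
  assumes "finite u" "finite v" "reduced (dec u @ dec v)" "raise u v = Some (U, V)"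
  shows "card U = Suc (card u)" "card v = Suc (card V)"
  using assms(4)
proof -
  obtain x where x: "first_min u v x" "U = insert (x + int (gap x u)) u" "V = v - {x}"
    using assms(4) by (rule raise_SomeE)
  note s = raise_structure[OF assms(1-3) x(1)]
  show "card U = Suc (card u)" using s(3) x(2) assms(1) by simp
  have "x \<in> v" using s(4) by force
  then show "card v = Suc (card V)" using x(3) assms(2) card_Suc_Diff1 by metis
qed

text \<open>After raising, the inserted letter \<open>x + q\<close> is the last minimum of the new
  path, which is the place where \<open>lower\<close> acts.\<close>

lemma lower_raise:
  assumes fin: "finite u" "finite v" and red: "reduced (dec u @ dec v)" and r: "raise u v = Some (U, V)"
  shows "lower U V = Some (u, v)"
proof -
  obtain x where x: "first_min u v x" "U = insert (x + int (gap x u)) u" "V = v - {x}"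
    using r by (rule raise_SomeE)
  define q where "q = int (gap x u)"
  note s = raise_structure[OF fin red x(1), folded q_def]
  have U: "U = insert (x + q) u" using x(2) by (simp add: q_def)
  have xv: "x \<in> v" using s(4) by (force simp: q_def)
  have finUV: "finite U" "finite V" using fin U x(3) by auto
  \<comment> \<open>Moving the letter lifts the path by one from \<open>x\<close> on and by one more
    beyond \<open>x + q\<close>. The old path is higher before \<open>x\<close> and flat from
    \<open>x\<close> to \<open>x + q\<close>, so the new minimum is reached at \<open>x + q\<close>
    for the last time.\<close>
  have h: "height U V k = height u v k + (if x + q < k then 1 else 0) + (if x \<le> k then 1 else 0)" for k
    unfolding U x(3) using fin s(3) xv by (simp add: height_insert_left height_remove_right)
  have q0: "q \<ge> 0" by (simp add: q_def)
  have m: "height u v x \<le> height u v k" "k < x \<Longrightarrow> height u v x < height u v k" for k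
    using x(1) by (auto simp: first_min_def)
  have hq: "height u v (x + q) = height u v x" using s(6)[of "x + q"] q0 by simp
  have main: "height U V (x + q) < height U V k" if "x + q < k" for k
    unfolding h hq using that m[of k] q0 by auto
  have main2: "height U V (x + q) \<le> height U V k" for k
    unfolding h hq using m[of k] q0 by auto
  have fm: "first_min (uminus ` V) (uminus ` U) (- (x + q))"
    unfolding first_min_def
  proof (intro conjI allI impI)
    fix k assume "k < - (x + q)"
    then have "height U V (x + q) < height U V (- k)" by (intro main) simp
    then show "height (uminus ` V) (uminus ` U) (- (x + q)) < height (uminus ` V) (uminus ` U) k"
      using height_uminus[OF finUV, of "x + q"] height_uminus[OF finUV, of "- k"] by simp
  next
    fix k
    show "height (uminus ` V) (uminus ` U) (- (x + q)) \<le> height (uminus ` V) (uminus ` U) k"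
      using height_uminus[OF finUV, of "x + q"] height_uminus[OF finUV, of "- k"] main2[of "- k"] by simp
  qed
  have g: "gap (- (x + q)) (uminus ` V) = gap x u"
  proof (rule gap_eqI)
    show "- (x + q) + int (gap x u) \<notin> uminus ` V" using x(3) by (auto simp: q_def)
    fix j assume j: "j < gap x u"
    then have "x + q - int j \<in> V" using s(4) x(3) by (auto simp: q_def)
    then show "- (x + q) + int j \<in> uminus ` V" by (intro image_eqI[of _ _ "x + q - int j"]) simp_all
  qed
  have e1: "uminus ` (insert (- (x + q) + int (gap x u)) (uminus ` V)) = v"
    using xv x(3) by (auto simp: image_image q_def)
  have e2: "uminus ` (uminus ` U - {- (x + q)}) = u"
  proof -
    have "uminus ` U - {- (x + q)} = uminus ` u" using s(3) unfolding U by (auto simp: image_iff) (smt (verit))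
    then show ?thesis by (simp add: image_image)
  qed
  show ?thesis
    unfolding lower_def raise_eqI[OF fm] g using e1 e2 by simp
qed

section \<open>Transfer between raising and lowering by the mirror symmetry\<close>

lemma raise_uminus: "raise (uminus ` v) (uminus ` u) = map_option (\<lambda>(U, V). (uminus ` V, uminus ` U)) (lower u v)"
proof -
  have "uminus ` uminus ` A = A" for A :: "int set" by (simp add: image_image)
  then show ?thesis by (cases "raise (uminus ` v) (uminus ` u)") (auto simp: lower_def)
qed

lemma lower_uminus: "lower (uminus ` v) (uminus ` u) = map_option (\<lambda>(U, V). (uminus ` V, uminus ` U)) (raise u v)"
  by (simp add: lower_def image_image option.map_comp comp_def case_prod_unfold)

lemma reduced_dec_uminus:
  assumes "finite u" "finite v"
  shows "reduced (dec (uminus ` v) @ dec (uminus ` u)) \<longleftrightarrow> reduced (dec u @ dec v)"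
  using assms reduced_star[of "dec u @ dec v"] by (simp only: dec_uminus star_append)

lemma raise_lower:
  assumes fin: "finite u" "finite v" and red: "reduced (dec u @ dec v)" and r: "lower u v = Some (U, V)"
  shows "raise U V = Some (u, v)"
proof -
  have "lower (uminus ` V) (uminus ` U) = Some (uminus ` v, uminus ` u)"
    using fin red r by (intro lower_raise) (simp_all only: finite_imageI reduced_dec_uminus raise_uminus option.map prod.case)
  then show ?thesis by (auto simp: lower_uminus inj_image_eq_iff)
qed

text \<open>The mirrored path is then nonnegative. Its value opposite a zero of the original path is
  the difference of the cardinalities.\<close>

lemma lower_NoneD:
  assumes "finite u" "finite v" "lower u v = None"
  shows "card u \<le> card v"
proof -
  have "raise (uminus ` v) (uminus ` u) = None" using assms(3) by (simp add: lower_def)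
  then have 1: "height (uminus ` v) (uminus ` u) k \<ge> 0" for k using assms by (intro raise_NoneD) auto
  obtain k where "height u v k = 0" using ex_height_0[OF assms(1,2)] by blast
  then show ?thesis using height_uminus[OF assms(1,2), of k] 1[of "- k"] by simp
qed

subsection \<open>Peeling off the first row\<close>

lemma word_perm_fixes:
  assumes "\<forall>j \<in> set c. \<bar>i - j\<bar> \<ge> 2"
  shows "word_perm c i = i" "word_perm c (i + 1) = i + 1"
  using assms by (induction c) (auto simp: word_perm_Cons transpose_def)

definition spaced :: "int set \<Rightarrow> bool" where
  "spaced S \<longleftrightarrow> (\<forall>a\<in>S. \<forall>b\<in>S. a \<noteq> b \<longrightarrow> \<bar>a - b\<bar> \<ge> 2)"

text \<open>A letter far from all others is an ascent of the product, since both \<open>i\<close>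
  and \<open>i + 1\<close> are fixed. Thus a word may be preceded by a well separated row without
  losing reducedness.\<close>

lemma reduced_append_far:
  assumes "reduced c" "distinct l" "spaced (set l)" "\<forall>i\<in>set l. \<forall>j\<in>set c. \<bar>i - j\<bar> \<ge> 2"
  shows "reduced (l @ c)"
proof -
  have "reduced (c @ l)"
    using assms
  proof (induction l rule: rev_induct)
    case (snoc i l)
    then have IH: "reduced (c @ l)" by (simp add: spaced_def)
    have "\<bar>i - j\<bar> \<ge> 2" if "j \<in> set (c @ l)" for j
    proof (cases "j \<in> set c")
      case True
      then show ?thesis using snoc.prems by simp
    next
      case False
      then show ?thesis using snoc.prems(2,3) that unfolding spaced_def by auto
    qed
    then have "word_perm (c @ l) i < word_perm (c @ l) (i + 1)" using word_perm_fixes[of "c @ l" i] by simp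
    then show ?case using IH reduced_snoc_iff[of "c @ l" i] by simp
  qed simp
  moreover have "word_perm (l @ c) = word_perm (c @ l)"
    using assms(4) by (intro word_perm_commute_words) auto
  ultimately show ?thesis using reduced_cong[of "l @ c" "c @ l"] by simp
qed

text \<open>All letters fall into the same hole of the row, just below \<open>f\<close>. The first
  one replaces \<open>f\<close>, and each later one replaces its predecessor, so the word comes out
  shifted by one place and only its last letter stays.\<close>

lemma outs_fill:
  assumes "sorted_wrt (>) (c @ [m])" "finite R" "f \<in> R" "\<forall>x\<in>set (c @ [m]). x < f" "\<forall>r\<in>R. r < m \<or> f \<le> r"
  shows "can_pass R (c @ [m])" "outs R (c @ [m]) = f # c" "final R (c @ [m]) = insert m (R - {f})"
proof -
  have "can_pass R (c @ [m]) \<and> outs R (c @ [m]) = f # c \<and> final R (c @ [m]) = insert m (R - {f})"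
    using assms
  proof (induction c arbitrary: R f)
    case Nil
    then have "bump R m = f" by (intro bump_eqI) auto
    moreover have "m \<notin> R" using Nil by auto
    ultimately show ?case using Nil by (auto simp: row_insert_def)
  next
    case (Cons a c)
    then have am: "m < a" "a < f" by (auto simp: sorted_wrt_append)
    have aR: "a \<notin> R" using Cons.prems(5) am by force
    have b: "bump R a = f" using Cons.prems am by (intro bump_eqI) force+
    have i: "row_insert R a = insert a (R - {f})" using aR b by (simp add: row_insert_def)
    have "can_pass (insert a (R - {f})) (c @ [m]) \<and> outs (insert a (R - {f})) (c @ [m]) = a # c \<and>
      final (insert a (R - {f})) (c @ [m]) = insert m (insert a (R - {f}) - {a})"
      using Cons.prems am by (intro Cons.IH) auto
    then show ?case using i b aR am Cons.prems by (auto simp: insert_Diff_if)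
  qed
  then show "can_pass R (c @ [m])" "outs R (c @ [m]) = f # c" "final R (c @ [m]) = insert m (R - {f})" by auto
qed

definition above_set :: "int \<Rightarrow> int set \<Rightarrow> int set" where
  "above_set m v = {c \<in> v. m < c}"

definition upto_set :: "int \<Rightarrow> int set \<Rightarrow> int set" where
  "upto_set m v = {c \<in> v. c \<le> m}"

text \<open>
  Let \<open>m = Min u\<close>. Inserting \<open>dec u @ dec v\<close> into a row of larger letters leaves \<open>corner m v\<close> in the row
  and, apart from letters of the original row, bumps \<open>u - {m}\<close> and \<open>rest m v\<close>.
\<close>

definition rest :: "int \<Rightarrow> int set \<Rightarrow> int set" where
  "rest m v =
     (let T = (if above_set m v = {} then {} else {Min (above_set m v)})
      in if upto_set m v = {} then v - T
         else if m \<in> v then v - {Min v} else insert m (v - {Min v} - T))"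

definition corner :: "int \<Rightarrow> int set \<Rightarrow> int set" where
  "corner m v = (if upto_set m v = {} then {m} else {Min v}) \<union>
     (if above_set m v = {} then {} else {Min (above_set m v)})"

lemma dec_remove_Min:
  assumes "finite A" "A \<noteq> {}"
  shows "dec A = dec (A - {Min A}) @ [Min A]"
proof (rule dec_eqI)
  have "Min A < z" if "z \<in> A - {Min A}" for z using that assms Min_le[of A z] by (auto simp: less_le)
  then show "sorted_wrt (>) (dec (A - {Min A}) @ [Min A])"
    using assms sorted_dec by (auto simp: sorted_wrt_append)
  show "set (dec (A - {Min A}) @ [Min A]) = A" using assms Min_in[OF assms] by (simp add: insert_absorb)
qed

lemma Min_upto_set:
  assumes "finite v" "upto_set m v \<noteq> {}"
  shows "Min v \<in> v" "Min v \<le> m" "Min (upto_set m v) = Min v"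
proof -
  obtain c where c: "c \<in> v" "c \<le> m" using assms by (auto simp: upto_set_def)
  then show 1: "Min v \<in> v" "Min v \<le> m" using assms(1) Min_in[of v] Min_le[of v c] by (metis empty_iff, linarith)
  show "Min (upto_set m v) = Min v"
    using 1 assms(1) by (intro Min_eqI) (auto simp: upto_set_def)
qed

lemma Min_above_set:
  assumes "finite v" "above_set m v \<noteq> {}"
  shows "Min (above_set m v) \<in> v" "m < Min (above_set m v)" "\<And>c. c \<in> v \<Longrightarrow> m < c \<Longrightarrow> Min (above_set m v) \<le> c"
proof -
  have fin: "finite (above_set m v)" using assms by (simp add: above_set_def)
  show "Min (above_set m v) \<in> v" "m < Min (above_set m v)" using Min_in[OF fin assms(2)] by (auto simp: above_set_def)
  show "\<And>c. c \<in> v \<Longrightarrow> m < c \<Longrightarrow> Min (above_set m v) \<le> c" using fin by (intro Min_le) (auto simp: above_set_def)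
qed

text \<open>After \<open>dec u\<close> the row is \<open>{m, g}\<close>. The letters of
  \<open>v\<close> above \<open>m\<close> fall into the hole below \<open>g\<close>, the remaining
  ones into the hole below \<open>m\<close>; \<open>outs_fill\<close> treats each block.\<close>

lemma outs_pair:
  assumes fin: "finite u" "finite v" and u: "u \<noteq> {}" "m = Min u" and mv: "m \<in> v \<Longrightarrow> m + 1 \<in> v"
    and f: "f < g" "\<forall>x\<in>u \<union> v. x < f"
  shows "can_pass {f, g} (dec u @ dec v)"
    and "outs {f, g} (dec u @ dec v) = f # dec (u - {m}) @ (if above_set m v = {} then [] else [g]) @ dec (rest m v)"
    and "final {f, g} (dec u @ dec v) = corner m v \<union> (if above_set m v = {} then {g} else {})"
proof -
  have mu: "m \<in> u" using fin u by simp
  have du: "dec u = dec (u - {m}) @ [m]" using dec_remove_Min[OF fin(1) u(1)] u(2) by simp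
  have P1: "can_pass {f, g} (dec u)" "outs {f, g} (dec u) = f # dec (u - {m})" "final {f, g} (dec u) = {m, g}"
    using outs_fill[of "dec (u - {m})" m "{f, g}" f] f mu fin sorted_dec[of u] unfolding du by auto
  define T where "T = above_set m v"
  define L where "L = upto_set m v"
  have finT: "finite T" "finite L" using fin by (auto simp: T_def L_def above_set_def upto_set_def)
  have dv: "dec v = dec T @ dec L"
  proof (rule dec_eqI)
    show "sorted_wrt (>) (dec T @ dec L)" using finT sorted_dec by (auto simp: sorted_wrt_append T_def L_def above_set_def upto_set_def)
    show "set (dec T @ dec L) = v" using finT by (auto simp: T_def L_def above_set_def upto_set_def)
  qed
  \<comment> \<open>The upper letter of the row once the letters above \<open>m\<close> have been
    inserted.\<close>
  define n where "n = (if T = {} then g else Min T)"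
  define T' where "T' = (if T = {} then {} else {Min T})"
  have mg: "m < g" using f mu by (meson UnI1 less_trans)
  have P2: "can_pass {m, g} (dec T) \<and> outs {m, g} (dec T) = (if T = {} then [] else [g]) @ dec (T - T') \<and> final {m, g} (dec T) = {m, n}"
  proof (cases "T = {}")
    case False
    have T: "m < Min T" "Min T \<in> T" using Min_in[OF finT(1) False] by (auto simp: T_def above_set_def)
    have gT: "\<forall>x\<in>T. x < g"
    proof
      fix x assume "x \<in> T"
      then have "x < f" using f by (simp add: T_def above_set_def)
      then show "x < g" using f(1) by simp
    qed
    show ?thesis
      using outs_fill[of "dec (T - {Min T})" "Min T" "{m, g}" g] T gT finT sorted_dec[of T] False mg
      unfolding dec_remove_Min[OF finT(1) False] by (auto simp: T'_def n_def)
  qed (simp add: T'_def n_def)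
  have rest_eq: "rest m v = (if L = {} then v - T' else if m \<in> v then v - {Min v} else insert m (v - {Min v} - T'))"
    by (simp add: rest_def T'_def T_def L_def Let_def)
  have mn: "m < n"
    using mg Min_in[OF finT(1)] by (auto simp: n_def T_def above_set_def)
  have main: "can_pass {m, n} (dec L) \<and> dec (T - T') @ outs {m, n} (dec L) = dec (rest m v) \<and>
     final {m, n} (dec L) = (if L = {} then {m} else {Min v}) \<union> {n}"
  proof (cases "L = {}")
    case True
    then have "v = T" by (auto simp: L_def T_def above_set_def upto_set_def)
    then have "rest m v = T - T'" using True rest_eq by simp
    then show ?thesis using True by (simp add: insert_commute)
  next
    case False
    have b: "Min v \<in> v" "Min v \<le> m" "Min L = Min v" using Min_upto_set[OF fin(2)] False by (auto simp: L_def)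
    have Tm: "m < z" if "z \<in> T" for z using that by (simp add: T_def above_set_def)
    have Lm: "z \<le> m" if "z \<in> L" for z using that by (simp add: L_def upto_set_def)
    show ?thesis
    proof (cases "m \<in> v")
      case mN: False
      have Lm': "z < m" if "z \<in> L" for z using Lm[OF that] that mN by (cases "z = m") (auto simp: L_def upto_set_def)
      have bL: "Min v \<in> L" using b by (auto simp: L_def upto_set_def)
      have "can_pass {m, n} (dec L)" "outs {m, n} (dec L) = m # dec (L - {Min v})" "final {m, n} (dec L) = {Min v, n}"
        using outs_fill[of "dec (L - {Min v})" "Min v" "{m, n}" m] Lm' bL finT sorted_dec[of L] mn
        unfolding dec_remove_Min[OF finT(2) False] b(3) by auto
      moreover have "dec (rest m v) = dec (T - T') @ m # dec (L - {Min v})"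
      proof (rule dec_eqI)
        show "sorted_wrt (>) (dec (T - T') @ m # dec (L - {Min v}))"
          using Lm' Tm finT sorted_dec by (auto simp: sorted_wrt_append intro: less_trans)
        have "rest m v = insert m (v - {Min v} - T')"
          using False mN rest_eq by simp
        moreover have "Min T \<notin> L" if "T \<noteq> {}" using Min_in[OF finT(1) that] Tm Lm by force
        moreover have "Min v \<notin> T" using Tm b(2) by force
        ultimately show "set (dec (T - T') @ m # dec (L - {Min v})) = rest m v"
          using finT by (auto simp: T'_def T_def L_def above_set_def upto_set_def)
      qed
      ultimately show ?thesis using False by auto
    next
      case True
      then have m1: "m + 1 \<in> T" using mv by (auto simp: T_def above_set_def)
      then have "Min T = m + 1" using finT Tm by (intro Min_eqI) force+
      then have n: "n = m + 1" and T': "T' = {m + 1}" using m1 by (auto simp: n_def T'_def)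
      have mL: "m \<in> L" using True by (auto simp: L_def upto_set_def)
      have dL: "dec L = m # dec (L - {m})"
      proof (rule dec_eqI)
        show "sorted_wrt (>) (m # dec (L - {m}))" using finT sorted_dec Lm by (auto simp: less_le)
      qed (use finT mL in auto)
      \<comment> \<open>The first letter of the lower block is \<open>m\<close>, which is already in
        the row together with \<open>m + 1 = n\<close>. It bumps \<open>m + 1\<close> and leaves the
        row unchanged, so the rest of the block behaves as before.\<close>
      have bm: "bump {m, m + 1} m = m + 1" by (intro bump_mem) auto
      have r: "rest m v = v - {Min v}" using False True rest_eq by simp
      have dT: "dec T = dec (T - T') @ [m + 1]" using dec_remove_Min[OF finT(1)] m1 \<open>Min T = m + 1\<close> T' by auto
      have "dec v = dec (v - {Min v}) @ [Min v]" using b(1) fin(2) by (intro dec_remove_Min) auto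
      then have dv': "dec (rest m v) @ [Min v] = dec (T - T') @ (m + 1) # m # dec (L - {m})" using dv dT dL r by simp
      show ?thesis
      proof (cases "L - {m} = {}")
        case Lm0: True
        then have L: "L = {m}" using mL by auto
        then have "Min v = m" using b(3) by simp
        then show ?thesis using dv' Lm0 L bm n by (auto simp: row_insert_def)
      next
        case Lm1: False
        have fin': "finite (L - {m})" using finT by simp
        have "Min (L - {m}) = Min v"
        proof -
          have "Min v \<noteq> m"
          proof
            assume "Min v = m"
            then have "z = m" if "z \<in> L" for z using Lm[OF that] that finT b(3) Min_le[of L z] by auto
            then show False using Lm1 by auto
          qed
          then have "Min v \<in> L - {m}" using b by (auto simp: L_def upto_set_def)
          moreover have "Min v \<le> z" if "z \<in> L - {m}" for z
            using that fin(2) by (intro Min_le) (auto simp: L_def upto_set_def)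
          ultimately show ?thesis using fin' by (intro Min_eqI) auto
        qed
        then have dL': "dec (L - {m}) = dec (L - {m} - {Min v}) @ [Min v]" using dec_remove_Min[OF fin' Lm1] by simp
        have bL: "Min v \<in> L - {m}" using Min_in[OF fin' Lm1] \<open>Min (L - {m}) = Min v\<close> by simp
        have Lm': "z < m" if "z \<in> L - {m}" for z using Lm[of z] that by auto
        have "can_pass {m, n} (dec (L - {m}))" "outs {m, n} (dec (L - {m})) = m # dec (L - {m} - {Min v})"
          "final {m, n} (dec (L - {m})) = {Min v, n}"
          using outs_fill[of "dec (L - {m} - {Min v})" "Min v" "{m, n}" m] Lm' bL fin' sorted_dec[of "L - {m}"] mn
          unfolding dL' by auto
        moreover have "outs {m, n} (dec L) = (m + 1) # outs {m, n} (dec (L - {m}))"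
          "final {m, n} (dec L) = final {m, n} (dec (L - {m}))"
          "can_pass {m, n} (dec L) \<longleftrightarrow> can_pass {m, n} (dec (L - {m}))"
          unfolding dL using bm n by (auto simp: row_insert_def)
        moreover have "dec (T - T') @ (m + 1) # m # dec (L - {m} - {Min v}) = dec (rest m v)"
          using dv' dL' by simp
        ultimately show ?thesis using False by auto
      qed
    qed
  qed
  show "can_pass {f, g} (dec u @ dec v)"
    using P1 P2 main by (simp add: dv can_pass_append)
  show "outs {f, g} (dec u @ dec v) = f # dec (u - {m}) @ (if above_set m v = {} then [] else [g]) @ dec (rest m v)"
    using P1 P2 main by (simp add: dv outs_append T_def[symmetric])
  show "final {f, g} (dec u @ dec v) = corner m v \<union> (if above_set m v = {} then {g} else {})"
    using P1 P2 main by (auto simp: dv final_append T_def[symmetric] L_def[symmetric] corner_def n_def)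
qed

lemma finite_rest: "finite v \<Longrightarrow> finite (rest m v)"
  by (simp add: rest_def Let_def)

lemma rest_bound: "\<forall>x\<in>insert m v. x \<le> M \<Longrightarrow> \<forall>x\<in>rest m v. x \<le> M"
  by (auto simp: rest_def Let_def)

lemma corner_bound:
  assumes "finite v" "\<forall>x\<in>insert m v. x \<le> M" shows "\<forall>x\<in>corner m v. x \<le> M"
  using assms Min_above_set[of v m] Min_upto_set[of v m] by (auto simp: corner_def)

lemma reduced_Min_mem:
  assumes "finite u" "finite v" "u \<noteq> {}" "reduced (dec u @ dec v)" "Min u \<in> v"
  shows "Min u + 1 \<in> v"
proof (rule ccontr)
  assume n: "Min u + 1 \<notin> v"
  define W where "W = dec {r \<in> v. Min u < r}"
  have "dec u @ dec v = dec (u - {Min u}) @ (Min u # W @ [Min u]) @ dec {r \<in> v. r < Min u}"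
    using dec_remove_Min[OF assms(1,3)] dec_split[OF assms(2,5)] by (simp add: W_def)
  from assms(4)[unfolded this] have "reduced (Min u # W @ [Min u])" by (rule reduced_middleD)
  moreover have "\<forall>j\<in>set W. \<bar>Min u - j\<bar> \<ge> 2"
  proof
    fix j assume "j \<in> set W"
    then have "j \<in> v" "Min u < j" using assms(2) by (auto simp: W_def)
    then show "\<bar>Min u - j\<bar> \<ge> 2" using n by (cases "j = Min u + 1") auto
  qed
  ultimately show False using not_reduced_repeat by blast
qed

text \<open>One frame letter for each factor. The distances keep the extended word reduced, and the
  empty place \<open>M + 1\<close> allows \<open>ck_filter\<close> to erase the frame letters
  afterwards. What remains presents the pair as a smaller pair followed by one or two trapped
  letters.\<close>

lemma peel:
  assumes fin: "finite u" "finite v" and u: "u \<noteq> {}" "m = Min u" and red: "reduced (dec u @ dec v)"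
    and M: "\<forall>x\<in>u \<union> v. x \<le> M"
  defines "F \<equiv> {M + 2, M + 4}"
  shows "can_pass F (dec u @ dec v)" "reduced (row F @ dec u @ dec v)"
    and "final F (dec u @ dec v) = corner m v \<union> (if above_set m v = {} then {M + 4} else {})"
    and "outs F (dec u @ dec v) = (M + 2) # dec (u - {m}) @ (if above_set m v = {} then [] else [M + 4]) @ dec (rest m v)"
    and "dec u @ dec v \<approx> dec (u - {m}) @ dec (rest m v) @ row (corner m v)"
proof -
  have mv: "m \<in> v \<Longrightarrow> m + 1 \<in> v" using reduced_Min_mem[OF fin u(1) red] u(2) by simp
  have f: "M + 2 < M + 4" "\<forall>x\<in>u \<union> v. x < M + 2" using M by force+
  show c: "can_pass F (dec u @ dec v)"
    and fi: "final F (dec u @ dec v) = corner m v \<union> (if above_set m v = {} then {M + 4} else {})"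
    and o: "outs F (dec u @ dec v) = (M + 2) # dec (u - {m}) @ (if above_set m v = {} then [] else [M + 4]) @ dec (rest m v)"
    using outs_pair[OF fin u mv f] unfolding F_def by auto
  have mu: "m \<in> u" using fin u by simp
  have rF: "row F = [M + 2, M + 4]" unfolding F_def by simp
  show r: "reduced (row F @ dec u @ dec v)"
    unfolding rF
  proof (rule reduced_append_far[OF red])
    show "\<forall>i\<in>set [M + 2, M + 4]. \<forall>j\<in>set (dec u @ dec v). 2 \<le> \<bar>i - j\<bar>"
    proof (intro ballI)
      fix i j assume "i \<in> set [M + 2, M + 4]" "j \<in> set (dec u @ dec v)"
      then have "i \<ge> M + 2" "j \<le> M" using fin M by auto
      then show "2 \<le> \<bar>i - j\<bar>" by simp
    qed
  qed (simp_all add: spaced_def)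
  have "M + 1 \<notin> u" "M + 1 \<notin> v" using M by (meson UnI1 UnI2 not_less zless_add1_eq order_refl)+
  then have N: "M + 1 \<notin> set (row F @ dec u @ dec v)" unfolding rF using fin by simp
  have M': "\<forall>x\<in>insert m v. x \<le> M" using M mu by blast
  have corner: "\<forall>x\<in>corner m v. x \<le> M" by (rule corner_bound[OF fin(2) M'])
  have rest: "\<forall>x\<in>rest m v. x \<le> M" by (rule rest_bound[OF M'])
  have fc: "filter (\<lambda>x. x \<le> M) (row (final F (dec u @ dec v))) = row (corner m v)"
  proof -
    have "filter (\<lambda>x. x \<le> M) (row S) = row {x \<in> S. x \<le> M}" if "finite S" for S :: "int set"
    proof -
      have "set (filter (\<lambda>x. x \<le> M) (row S)) = {x \<in> S. x \<le> M}" using that by auto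
      moreover have "sorted_wrt (<) (filter (\<lambda>x. x \<le> M) (row S))" by (simp add: sorted_wrt_filter)
      ultimately show ?thesis using row_set by metis
    qed
    moreover have "{x \<in> final F (dec u @ dec v). x \<le> M} = corner m v"
      unfolding fi using corner by auto
    moreover have "finite (final F (dec u @ dec v))" using c by (rule can_pass_final)
    ultimately show ?thesis by simp
  qed
  have "filter (\<lambda>x. x \<le> M) (dec u @ dec v) = dec u @ dec v"
    using M fin by (intro filter_True) auto
  moreover have "filter (\<lambda>x. x \<le> M) (row F) = []" unfolding rF by simp
  moreover have "filter (\<lambda>x. x \<le> M) (outs F (dec u @ dec v)) = dec (u - {m}) @ dec (rest m v)"
  proof -
    have "filter (\<lambda>x. x \<le> M) (dec (u - {m})) = dec (u - {m})" "filter (\<lambda>x. x \<le> M) (dec (rest m v)) = dec (rest m v)"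
      using M fin rest finite_rest by (auto intro!: filter_True)
    then show ?thesis unfolding o by simp
  qed
  ultimately show "dec u @ dec v \<approx> dec (u - {m}) @ dec (rest m v) @ row (corner m v)"
    using ck_filter[OF ck_outs[OF c r] N] fc by simp
qed

lemma card_rest_le:
  assumes "finite v" shows "card (rest m v) \<le> card v"
proof -
  define T where "T = (if above_set m v = {} then {} else {Min (above_set m v)})"
  consider "upto_set m v = {}" | "upto_set m v \<noteq> {}" "m \<in> v" | "upto_set m v \<noteq> {}" "m \<notin> v" by blast
  then show ?thesis
  proof cases
    case 3
    then have "card (rest m v) \<le> Suc (card (v - {Min v} - T))"
      using card_insert_le_m1 assms by (simp add: rest_def T_def[symmetric] Let_def card_insert_if)
    also have "\<dots> \<le> Suc (card (v - {Min v}))" using assms by (simp add: card_mono Diff_subset)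
    also have "\<dots> = card v" using Min_upto_set(1)[OF assms 3(1)] assms by (intro card_Suc_Diff1)
    finally show ?thesis .
  qed (use assms in \<open>simp_all add: rest_def Let_def card_mono\<close>)
qed

subsection \<open>Marked words\<close>

text \<open>In a word of pairs \<open>(i, a)\<close> the flag \<open>a\<close> tells whether the letter \<open>i\<close> is primed.\<close>

definition flagged_labels :: "(int \<times> bool) list \<Rightarrow> ((int \<times> int) \<times> bool) set" where
  "flagged_labels c = set (zip (inv_labels (map fst c)) (map snd c))"

lemma flagged_labels_append:
  "flagged_labels (c @ d) = (\<lambda>(l, f). (map_prod (word_perm (rev (map fst d))) (word_perm (rev (map fst d))) l, f)) `
     flagged_labels c \<union> flagged_labels d"
  by (simp add: flagged_labels_def inv_labels_append zip_map1 image_Un)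

text \<open>
  A braid move reverses the three flags because it reverses the three inversions labelling the letters.
\<close>

inductive mark_move :: "(int \<times> bool) list \<Rightarrow> (int \<times> bool) list \<Rightarrow> bool" where
  move_commute: "\<bar>i - j\<bar> \<ge> 2 \<Longrightarrow> mark_move (p @ [(i, a), (j, b)] @ s) (p @ [(j, b), (i, a)] @ s)"
| move_braid: "mark_move (p @ [(i, a), (i + 1, b), (i, c)] @ s) (p @ [(i + 1, c), (i, b), (i + 1, a)] @ s)"

lemma mark_move_infix: "mark_move c d \<Longrightarrow> mark_move (p @ c @ s) (p @ d @ s)"
proof (induction rule: mark_move.induct)
  case (move_commute i j p' a b s')
  then show ?case using mark_move.move_commute[of i j "p @ p'" a b "s' @ s"] by simp
next
  case (move_braid p' i a b c s')
  then show ?case using mark_move.move_braid[of "p @ p'" i a b c "s' @ s"] by simp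
qed

abbreviation mark_moves :: "(int \<times> bool) list \<Rightarrow> (int \<times> bool) list \<Rightarrow> bool" where
  "mark_moves \<equiv> mark_move\<^sup>*\<^sup>*"

lemma mark_moves_infix: "mark_moves c d \<Longrightarrow> mark_moves (p @ c @ s) (p @ d @ s)"
  by (induction rule: rtranclp_induct) (auto dest: mark_move_infix intro: rtranclp.rtrancl_into_rtrancl)

lemmas mark_moves_left = mark_moves_infix[where p = "[]", simplified]
lemmas mark_moves_right = mark_moves_infix[where s = "[]", simplified]

lemma mark_moves_trans: "mark_moves c d \<Longrightarrow> mark_moves d e \<Longrightarrow> mark_moves c e"
  by (rule rtranclp_trans)

text \<open>Labels in a prefix depend on the letters behind it only through their product, which a
  move preserves. It is therefore enough to compare the labels of the two or three letters that are
  moved.\<close>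

lemma mark_move_invariant:
  assumes "mark_move c d"
  shows "word_perm (map fst c) = word_perm (map fst d)" "length c = length d"
    "flagged_labels c = flagged_labels d"
proof -
  have *: "word_perm (map fst (p @ x @ s)) = word_perm (map fst (p @ y @ s)) \<and>
    flagged_labels (p @ x @ s) = flagged_labels (p @ y @ s)"
    if w: "word_perm (map fst x) = word_perm (map fst y)" and l: "flagged_labels x = flagged_labels y" for p x y s
  proof -
    have "word_perm (rev (map fst x)) = word_perm (rev (map fst y))" using w by (rule word_perm_rev_eq)
    then show ?thesis using w l by (simp add: flagged_labels_append word_perm_append)
  qed
  have "word_perm (map fst c) = word_perm (map fst d) \<and> flagged_labels c = flagged_labels d \<and> length c = length d"
    using assms
  proof (cases rule: mark_move.cases)
    case (move_commute i j p a b s)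
    have "word_perm (map fst [(i, a), (j, b)]) = word_perm (map fst [(j, b), (i, a)])"
      using word_perm_commute_words[of "[i]" "[j]"] move_commute by simp
    moreover have "flagged_labels [(i, a), (j, b)] = flagged_labels [(j, b), (i, a)]"
      using move_commute by (auto simp: flagged_labels_def word_perm_Cons transpose_def)
    ultimately show ?thesis using *[of "[(i, a), (j, b)]" "[(j, b), (i, a)]" p s] move_commute by auto
  next
    case (move_braid p i a b e s)
    have "word_perm (map fst [(i, a), (i + 1, b), (i, e)]) = word_perm (map fst [(i + 1, e), (i, b), (i + 1, a)])"
      using ck_base_word_perm[OF ck_braid[of i]] by simp
    moreover have "flagged_labels [(i, a), (i + 1, b), (i, e)] = flagged_labels [(i + 1, e), (i, b), (i + 1, a)]"
      by (auto simp: flagged_labels_def word_perm_Cons transpose_def)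
    ultimately show ?thesis using *[of "[(i, a), (i + 1, b), (i, e)]" "[(i + 1, e), (i, b), (i + 1, a)]" p s] move_braid by auto
  qed
  then show "word_perm (map fst c) = word_perm (map fst d)" "length c = length d"
    "flagged_labels c = flagged_labels d" by auto
qed

lemma mark_moves_invariant:
  assumes "mark_moves c d"
  shows "word_perm (map fst c) = word_perm (map fst d)" "length c = length d"
    "flagged_labels c = flagged_labels d"
  using assms by (induction rule: rtranclp_induct) (simp_all add: mark_move_invariant)

lemma mark_moves_commute_letter:
  assumes "\<forall>y \<in> set c. \<bar>fst x - fst y\<bar> \<ge> 2"
  shows "mark_moves (x # c) (c @ [x])" and "mark_moves (c @ [x]) (x # c)"
proof -
  have sw: "mark_moves (p @ [y, z] @ s) (p @ [z, y] @ s)" if "\<bar>fst y - fst z\<bar> \<ge> 2" for p s and y z :: "int \<times> bool"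
    using move_commute[of "fst y" "fst z" p "snd y" "snd z" s] that by auto
  have "mark_moves (x # c) (c @ [x]) \<and> mark_moves (c @ [x]) (x # c)"
    using assms
  proof (induction c)
    case (Cons y c)
    have xy: "\<bar>fst x - fst y\<bar> \<ge> 2" "\<bar>fst y - fst x\<bar> \<ge> 2" using Cons.prems by (auto simp: abs_minus_commute)
    have IH: "mark_moves (x # c) (c @ [x])" "mark_moves (c @ [x]) (x # c)" using Cons by auto
    have 1: "mark_moves (x # y # c) (y # x # c)" using sw[OF xy(1), of "[]" c] by simp
    have 2: "mark_moves (y # x # c) (y # c @ [x])" using mark_moves_right[OF IH(1), of "[y]"] by simp
    have 3: "mark_moves (y # c @ [x]) (y # x # c)" using mark_moves_right[OF IH(2), of "[y]"] by simp
    have 4: "mark_moves (y # x # c) (x # y # c)" using sw[OF xy(2), of "[]" c] by simp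
    show ?case using mark_moves_trans[OF 1 2] mark_moves_trans[OF 3 4] by simp
  qed simp
  then show "mark_moves (x # c) (c @ [x])" and "mark_moves (c @ [x]) (x # c)" by auto
qed

lemma mark_moves_commute:
  assumes "\<forall>x \<in> set c. \<forall>y \<in> set d. \<bar>fst x - fst y\<bar> \<ge> 2"
  shows "mark_moves (c @ d) (d @ c)"
  using assms
proof (induction c)
  case (Cons x c)
  have "mark_moves (x # c @ d) (x # d @ c)" using mark_moves_right[of "c @ d" "d @ c" "[x]"] Cons by simp
  also have "mark_moves (x # d @ c) (d @ x # c)"
    using mark_moves_left[OF mark_moves_commute_letter(1)[of d x], of c] Cons.prems by simp
  finally show ?case by simp
qed simp

section \<open>Flags carried along a run by commutations and braid moves\<close>

definition flag :: "(int \<Rightarrow> bool) \<Rightarrow> int list \<Rightarrow> (int \<times> bool) list" where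
  "flag p c = map (\<lambda>k. (k, p k)) c"

lemma flag_append [simp]: "flag p (c @ d) = flag p c @ flag p d"
  by (simp add: flag_def)

lemma flag_Nil [simp]: "flag p [] = []"
  by (simp add: flag_def)

lemma flag_Cons [simp]: "flag p (k # c) = (k, p k) # flag p c"
  by (simp add: flag_def)

lemma flag_cong: "(\<And>k. k \<in> set c \<Longrightarrow> p k = p' k) \<Longrightarrow> flag p c = flag p' c"
  by (simp add: flag_def)

lemma map_fst_flag [simp]: "map fst (flag p c) = c"
  by (simp add: flag_def comp_def)

text \<open>\<open>q\<close> letters, possibly none, whereas \<open>run x n\<close> has
  \<open>n + 1\<close> letters.\<close>

definition segment :: "int \<Rightarrow> nat \<Rightarrow> int list" where
  "segment x q = rev [x..x + int q - 1]"

lemma segment_0 [simp]: "segment x 0 = []"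
  by (simp add: segment_def)

lemma segment_Suc: "segment x (Suc q) = (x + int q) # segment x q"
proof -
  have "[x..x + int (Suc q) - 1] = [x..x + int q - 1] @ [x + int q]"
    using upto_rec2[of x "x + int q"] by simp
  then show ?thesis by (simp add: segment_def)
qed

lemma segment_Suc': "segment x (Suc q) = segment (x + 1) q @ [x]"
  using upto_rec1[of x "x + int q"] by (simp add: segment_def)

lemma set_segment [simp]: "set (segment x q) = {x..<x + int q}"
  by (auto simp: segment_def)

lemma sorted_segment: "sorted_wrt (>) (segment x q)"
  by (induction q) (auto simp: segment_Suc)

lemma dec_split_segment:
  assumes "finite A" "{x..<x + int q} \<subseteq> A"
  shows "dec A = dec {r \<in> A. x + int q \<le> r} @ segment x q @ dec {r \<in> A. r < x}"
proof (rule dec_eqI)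
  show "set (dec {r \<in> A. x + int q \<le> r} @ segment x q @ dec {r \<in> A. r < x}) = A" using assms by auto
  show "sorted_wrt (>) (dec {r \<in> A. x + int q \<le> r} @ segment x q @ dec {r \<in> A. r < x})"
    using assms(1) sorted_segment sorted_dec by (auto simp: sorted_wrt_append)
qed

text \<open>The flags after raising at \<open>x\<close> with gap \<open>q\<close>. Swapping the
  primes on a pair amounts to exchanging the two flags, the pairs concerned are
  \<open>(k, k + 1)\<close> inside the run, and the new letter \<open>x + q\<close> carries the flag
  of the removed letter \<open>x\<close>.\<close>

definition shift_left :: "int \<Rightarrow> nat \<Rightarrow> (int \<Rightarrow> bool) \<Rightarrow> (int \<Rightarrow> bool) \<Rightarrow> int \<Rightarrow> bool" where
  "shift_left x q p r k = (if x \<le> k \<and> k < x + int q then r (k + 1) else if k = x + int q then r x else p k)"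

definition shift_right :: "int \<Rightarrow> nat \<Rightarrow> (int \<Rightarrow> bool) \<Rightarrow> (int \<Rightarrow> bool) \<Rightarrow> int \<Rightarrow> bool" where
  "shift_right x q p r k = (if x < k \<and> k \<le> x + int q then p (k - 1) else r k)"

text \<open>The last letter \<open>x\<close> of the first segment commutes up to the last two
  letters \<open>x + 1, x\<close> of the second one. A braid move there creates an
  \<open>x + 1\<close> on the left, which completes the situation one step higher; the remaining
  \<open>x\<close> then joins the first factor and \<open>x + 1\<close> the second.\<close>

lemma segment_moves:
  "mark_moves (flag p (segment x q) @ flag r (segment x (Suc q)))
     (flag (shift_left x q p r) (segment x (Suc q)) @ flag (shift_right x q p r) (segment (x + 1) q))"
proof (induction q arbitrary: x p r)
  case 0
  show ?case by (simp add: segment_Suc shift_left_def)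
next
  case (Suc q)
  define A where "A = flag p (segment (x + 1) q)"
  define B where "B = flag r (segment (x + 2) q)"
  \<comment> \<open>After the braid move the leftmost of the three letters is \<open>x + 1\<close>,
    carrying the flag that belonged to \<open>x\<close> in the second word.\<close>
  define r2 where "r2 = r(x + 1 := r x)"
  define C where "C = flag (shift_left (x + 1) q p r2) (segment (x + 1) (Suc q))"
  define D where "D = flag (shift_right (x + 1) q p r2) (segment (x + 2) q)"
  have "mark_moves ((x, p x) # B) (B @ [(x, p x)])"
    by (rule mark_moves_commute_letter) (auto simp: B_def flag_def)
  from mark_moves_infix[OF this, of A "[(x + 1, r (x + 1)), (x, r x)]"]
  have 1: "mark_moves (A @ (x, p x) # B @ [(x + 1, r (x + 1)), (x, r x)])
      (A @ B @ [(x, p x), (x + 1, r (x + 1)), (x, r x)])" by simp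
  have 2: "mark_moves (A @ B @ [(x, p x), (x + 1, r (x + 1)), (x, r x)])
      (A @ B @ [(x + 1, r x), (x, r (x + 1)), (x + 1, p x)])"
    using move_braid[of "A @ B" x "p x" "r (x + 1)" "r x" "[]"] by auto
  have B: "B @ [(x + 1, r x)] = flag r2 (segment (x + 1) (Suc q))"
  proof -
    have "B = flag r2 (segment (x + 2) q)" unfolding B_def by (rule flag_cong) (auto simp: r2_def)
    then show ?thesis by (simp add: segment_Suc' r2_def add.assoc)
  qed
  have 3: "mark_moves (A @ (B @ [(x + 1, r x)]) @ [(x, r (x + 1)), (x + 1, p x)])
     ((C @ D) @ [(x, r (x + 1)), (x + 1, p x)])"
    using mark_moves_left[OF Suc.IH[where x = "x + 1" and p = p and r = r2], of "[(x, r (x + 1)), (x + 1, p x)]"]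
    unfolding B by (simp add: A_def C_def D_def add.assoc)
  have "mark_moves (D @ [(x, r (x + 1))]) ((x, r (x + 1)) # D)"
    by (rule mark_moves_commute_letter) (auto simp: D_def flag_def)
  from mark_moves_infix[OF this, of C "[(x + 1, p x)]"]
  have 4: "mark_moves (C @ D @ [(x, r (x + 1)), (x + 1, p x)]) (C @ (x, r (x + 1)) # D @ [(x + 1, p x)])"
    by simp
  have "mark_moves (A @ (x, p x) # B @ [(x + 1, r (x + 1)), (x, r x)]) (C @ (x, r (x + 1)) # D @ [(x + 1, p x)])"
    using mark_moves_trans[OF 1 mark_moves_trans[OF 2]] mark_moves_trans[OF 3] 4 by simp
  moreover have "flag p (segment x (Suc q)) = A @ [(x, p x)]"
    by (simp add: segment_Suc' A_def)
  moreover have "flag r (segment x (Suc (Suc q))) = B @ [(x + 1, r (x + 1)), (x, r x)]"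
    by (simp add: segment_Suc' B_def add.assoc)
  moreover have "flag (shift_left x (Suc q) p r) (segment x (Suc (Suc q))) = C @ [(x, r (x + 1))]"
  proof -
    have "C = flag (shift_left x (Suc q) p r) (segment (x + 1) (Suc q))"
      unfolding C_def by (rule flag_cong) (auto simp: shift_left_def r2_def)
    then show ?thesis by (subst segment_Suc') (simp add: shift_left_def)
  qed
  moreover have "flag (shift_right x (Suc q) p r) (segment (x + 1) (Suc q)) = D @ [(x + 1, p x)]"
  proof -
    have "D = flag (shift_right x (Suc q) p r) (segment (x + 2) q)"
      unfolding D_def by (rule flag_cong) (auto simp: shift_right_def r2_def)
    then show ?thesis by (subst segment_Suc') (simp add: shift_right_def add.assoc)
  qed
  ultimately show ?case by simp
qed

text \<open>By \<open>raise_structure\<close> the letters of \<open>u\<close> below the run and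
  those of \<open>v\<close> above it are not adjacent to it. They commute out of the way, the runs
  interact as in \<open>segment_moves\<close>, and the same letters commute back.\<close>

lemma raise_moves:
  assumes fin: "finite u" "finite v" and red: "reduced (dec u @ dec v)" and x: "first_min u v x"
  defines "q \<equiv> gap x u"
  shows "mark_moves (flag p (dec u) @ flag r (dec v))
    (flag (shift_left x q p r) (dec (insert (x + int q) u)) @ flag (shift_right x q p r) (dec (v - {x})))"
proof -
  note s = raise_structure[OF fin red x, folded q_def]
  define Hu where "Hu = {z \<in> u. x + int q < z}"
  define Lu where "Lu = {z \<in> u. z < x}"
  define Hv where "Hv = {z \<in> v. x + int q < z}"
  define Lv where "Lv = {z \<in> v. z < x}"
  define p' where "p' = shift_left x q p r"
  define r' where "r' = shift_right x q p r"
  have fins: "finite Hu" "finite Lu" "finite Hv" "finite Lv" using fin by (auto simp: Hu_def Lu_def Hv_def Lv_def)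
  have "{z \<in> u. x + int q \<le> z} = Hu" using s(3) by (auto simp: Hu_def order.order_iff_strict)
  then have du: "dec u = dec Hu @ segment x q @ dec Lu"
    using dec_split_segment[OF fin(1) s(2)] by (simp add: Lu_def)
  have "{x..<x + int (Suc q)} \<subseteq> v" using s(4) by auto
  moreover have "{z \<in> v. x + int (Suc q) \<le> z} = Hv" by (auto simp: Hv_def)
  ultimately have dv: "dec v = dec Hv @ segment x (Suc q) @ dec Lv"
    using dec_split_segment[OF fin(2), of x "Suc q"] by (simp add: Lv_def)
  have "{x..<x + int (Suc q)} = insert (x + int q) {x..<x + int q}" by auto
  then have "{x..<x + int (Suc q)} \<subseteq> insert (x + int q) u" using s(2) by auto
  moreover have "{z \<in> insert (x + int q) u. x + int (Suc q) \<le> z} = Hu" "{z \<in> insert (x + int q) u. z < x} = Lu"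
    by (auto simp: Hu_def Lu_def)
  ultimately have dU: "dec (insert (x + int q) u) = dec Hu @ segment x (Suc q) @ dec Lu"
    using dec_split_segment[of "insert (x + int q) u" x "Suc q"] fin by simp
  have "{x + 1..<x + 1 + int q} \<subseteq> v - {x}" using s(4) by auto
  moreover have "{z \<in> v - {x}. x + 1 + int q \<le> z} = Hv" "{z \<in> v - {x}. z < x + 1} = Lv"
    by (auto simp: Hv_def Lv_def)
  ultimately have dV: "dec (v - {x}) = dec Hv @ segment (x + 1) q @ dec Lv"
    using dec_split_segment[of "v - {x}" "x + 1" q] fin by simp
  have Lu2: "z \<le> x - 2" if "z \<in> Lu" for z using that s(1) by (cases "z = x - 1") (auto simp: Lu_def)
  have Hv2: "x + int q + 2 \<le> z" if "z \<in> Hv" for z using that s(5) by (cases "z = x + int q + 1") (auto simp: Hv_def)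
  have fHu: "flag p (dec Hu) = flag p' (dec Hu)" and fLu: "flag p (dec Lu) = flag p' (dec Lu)"
    using fins by (auto intro!: flag_cong simp: p'_def shift_left_def Hu_def Lu_def)
  have fHv: "flag r (dec Hv) = flag r' (dec Hv)" and fLv: "flag r (dec Lv) = flag r' (dec Lv)"
    using fins by (auto intro!: flag_cong simp: r'_def shift_right_def Hv_def Lv_def)
  let ?Hu = "flag p' (dec Hu)" and ?Lu = "flag p' (dec Lu)" and ?Hv = "flag r' (dec Hv)" and ?Lv = "flag r' (dec Lv)"
  let ?s1 = "flag p (segment x q)" and ?s2 = "flag r (segment x (Suc q))"
    and ?s3 = "flag p' (segment x (Suc q))" and ?s4 = "flag r' (segment (x + 1) q)"
  have "mark_moves (?Lu @ (?Hv @ ?s2)) ((?Hv @ ?s2) @ ?Lu)"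
    by (rule mark_moves_commute) (use Lu2 Hv2 fins in \<open>fastforce simp: flag_def\<close>)
  from mark_moves_infix[OF this, of "?Hu @ ?s1" "?Lv"]
  have 1: "mark_moves (?Hu @ ?s1 @ ?Lu @ ?Hv @ ?s2 @ ?Lv) (?Hu @ ?s1 @ ?Hv @ ?s2 @ ?Lu @ ?Lv)" by simp
  have "mark_moves (?s1 @ ?Hv) (?Hv @ ?s1)"
    by (rule mark_moves_commute) (use Hv2 fins in \<open>fastforce simp: flag_def\<close>)
  from mark_moves_infix[OF this, of ?Hu "?s2 @ ?Lu @ ?Lv"]
  have 2: "mark_moves (?Hu @ ?s1 @ ?Hv @ ?s2 @ ?Lu @ ?Lv) (?Hu @ ?Hv @ ?s1 @ ?s2 @ ?Lu @ ?Lv)" by simp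
  have 3: "mark_moves (?Hu @ ?Hv @ ?s1 @ ?s2 @ ?Lu @ ?Lv) (?Hu @ ?Hv @ ?s3 @ ?s4 @ ?Lu @ ?Lv)"
    using mark_moves_infix[OF segment_moves[of p x q r], of "?Hu @ ?Hv" "?Lu @ ?Lv"] by (simp add: p'_def r'_def)
  have "mark_moves (?Hv @ ?s3) (?s3 @ ?Hv)"
    by (rule mark_moves_commute) (use Hv2 fins in \<open>fastforce simp: flag_def\<close>)
  from mark_moves_infix[OF this, of ?Hu "?s4 @ ?Lu @ ?Lv"]
  have 4: "mark_moves (?Hu @ ?Hv @ ?s3 @ ?s4 @ ?Lu @ ?Lv) (?Hu @ ?s3 @ ?Hv @ ?s4 @ ?Lu @ ?Lv)" by simp
  have "mark_moves ((?Hv @ ?s4) @ ?Lu) (?Lu @ (?Hv @ ?s4))"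
    by (rule mark_moves_commute) (use Lu2 Hv2 fins in \<open>fastforce simp: flag_def\<close>)
  from mark_moves_infix[OF this, of "?Hu @ ?s3" "?Lv"]
  have 5: "mark_moves (?Hu @ ?s3 @ ?Hv @ ?s4 @ ?Lu @ ?Lv) (?Hu @ ?s3 @ ?Lu @ ?Hv @ ?s4 @ ?Lv)" by simp
  have "mark_moves (?Hu @ ?s1 @ ?Lu @ ?Hv @ ?s2 @ ?Lv) (?Hu @ ?s3 @ ?Lu @ ?Hv @ ?s4 @ ?Lv)"
    by (rule mark_moves_trans[OF 1 mark_moves_trans[OF 2 mark_moves_trans[OF 3 mark_moves_trans[OF 4 5]]]])
  then show ?thesis unfolding du dv dU dV flag_append fHu fLu fHv fLv p'_def[symmetric] r'_def[symmetric] by simp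
qed

lemma word_perm_raise:
  assumes fin: "finite u" "finite v" and red: "reduced (dec u @ dec v)" and r: "raise u v = Some (U, V)"
  shows "word_perm (dec U @ dec V) = word_perm (dec u @ dec v)"
    and "reduced (dec U @ dec V)"
proof -
  obtain x where x: "first_min u v x" "U = insert (x + int (gap x u)) u" "V = v - {x}"
    using r by (rule raise_SomeE)
  define f where "f = (\<lambda>_::int. False)"
  note m = mark_moves_invariant[OF raise_moves[OF fin red x(1), of f f], folded x(2,3)]
  show "word_perm (dec U @ dec V) = word_perm (dec u @ dec v)" using m(1) by simp
  moreover have "length (dec U @ dec V) = length (dec u @ dec v)" using m(2) by (simp add: flag_def)
  ultimately show "reduced (dec U @ dec V)" using red reduced_cong by blast
qed

subsection \<open>Raising is a Coxeter--Knuth equivalence\<close>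

text \<open>Raising survives peeling. In each position of \<open>x\<close> relative to
  \<open>m\<close> the trapped letters are the same before and after, and the smaller pair is raised
  too: at \<open>x\<close> if \<open>m < x\<close>, at \<open>m + 1\<close> if \<open>x = m\<close>,
  and at \<open>m\<close> if \<open>x < m\<close>.\<close>

lemma raise_rest:
  assumes fin: "finite u" "finite v" and u: "u \<noteq> {}" "m = Min u" and red: "reduced (dec u @ dec v)"
    and r: "raise u v = Some (U, V)"
  shows "U \<noteq> {} \<and> corner (Min U) V = corner m v \<and>
    ((U - {Min U}, rest (Min U) V) = (u - {m}, rest m v) \<or>
     raise (u - {m}) (rest m v) = Some (U - {Min U}, rest (Min U) V))"
proof -
  obtain x where x: "first_min u v x" "U = insert (x + int (gap x u)) u" "V = v - {x}"
    using r by (rule raise_SomeE)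
  define q where "q = int (gap x u)"
  note s = raise_structure[OF fin red x(1), folded q_def]
  have q0: "q \<ge> 0" by (simp add: q_def)
  have U: "U = insert (x + q) u" using x(2) by (simp add: q_def)
  have xv: "x \<in> v" using s(4) q0 by auto
  have xm: "height u v x \<le> height u v k" "k < x \<Longrightarrow> height u v x < height u v k" for k
    using x(1) by (auto simp: first_min_def)
  have mu: "m \<in> u" using fin u by simp
  have mle: "m \<le> y" if "y \<in> u" for y using that fin u by simp
  have m1: "m \<in> v \<Longrightarrow> m + 1 \<in> v" using reduced_Min_mem[OF fin u(1) red] u(2) by simp
  define L where "L = upto_set m v"
  define T where "T = above_set m v"
  define n where "n = Min T"
  define b where "b = Min v"
  define u0 where "u0 = u - {m}"
  define v0 where "v0 = rest m v"
  \<comment> \<open>Thus \<open>- t\<close> is the height of the path at \<open>m\<close>, since no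
    letter of \<open>u\<close> lies below \<open>m\<close>; all comparisons are made with this
    level.\<close>
  define t where "t = int (card L)"
  have finT: "finite T" "finite L" using fin by (auto simp: T_def L_def above_set_def upto_set_def)
  have finu0: "finite u0" using fin by (simp add: u0_def)
  have hlow: "height u v k = - int (card {c \<in> v. c \<le> k})" if "k \<le> m" for k
  proof -
    have "{y \<in> u. y < k} = {}" using mle that by force
    then have "card {y \<in> u. y < k} = 0" by (simp only: card.empty)
    then show ?thesis by (simp add: height_def)
  qed
  have h1: "height u v k \<ge> - t" if "k \<le> m" for k
  proof -
    have "{c \<in> v. c \<le> k} \<subseteq> L" using that by (auto simp: L_def upto_set_def)
    then show ?thesis using card_mono[OF finT(2)] that by (simp add: hlow t_def)
  qed
  have hm: "height u v m = - t" by (simp add: hlow t_def L_def upto_set_def)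
  have h2: "height u v k \<ge> 1 - t" if "m < k" "T = {} \<or> k < n" for k
  proof -
    have "{c \<in> v. c \<le> k} = L"
    proof -
      have "c \<le> m" if c: "c \<in> v" "c \<le> k" for c
      proof (rule ccontr)
        assume "\<not> c \<le> m"
        then have "c \<in> T" using c by (simp add: T_def above_set_def)
        then have "n \<le> c" "T \<noteq> {}" unfolding n_def using finT by (auto intro: Min_le)
        then show False using \<open>T = {} \<or> k < n\<close> c by simp
      qed
      then show ?thesis using \<open>m < k\<close> by (auto simp: L_def upto_set_def)
    qed
    moreover have "card {y \<in> u. y < k} \<ge> 1"
      using mu \<open>m < k\<close> fin card_mono[of "{y \<in> u. y < k}" "{m}"] by auto
    ultimately show ?thesis by (simp add: height_def t_def)
  qed
  have bL: "b \<in> v" "b \<le> m" "b \<in> L" "\<And>c. c \<in> v \<Longrightarrow> b \<le> c" if "L \<noteq> {}"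
    using Min_upto_set[OF fin(2), of m] that fin by (auto simp: b_def L_def upto_set_def)
  have nT: "n \<in> v" "m < n" "n \<in> T" "\<And>c. c \<in> v \<Longrightarrow> m < c \<Longrightarrow> n \<le> c" if "T \<noteq> {}"
    using Min_above_set[OF fin(2), of m] Min_in[OF finT(1)] that by (auto simp: n_def T_def)
  have TL: "T = {} \<Longrightarrow> v = L" "L = {} \<Longrightarrow> v = T" by (auto simp: T_def L_def above_set_def upto_set_def)
  have v0: "v0 = (if L = {} then v - (if T = {} then {} else {n}) else if m \<in> v then v - {b}
      else insert m (v - {b} - (if T = {} then {} else {n})))"
    by (simp add: v0_def rest_def L_def T_def n_def b_def Let_def)
  have corner: "corner m v = (if L = {} then {m} else {b}) \<union> (if T = {} then {} else {n})"
    by (simp add: corner_def L_def T_def n_def b_def)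
  have hu0: "height u0 w k = height u w k - (if m < k then 1 else 0)" for w k
    unfolding u0_def by (rule height_remove_left[OF fin(1) mu])
  have Une: "U \<noteq> {}" by (simp add: U)
  show ?thesis
  proof (cases "m < x")
    \<comment> \<open>From \<open>n\<close> on the old and the new path agree. Before
      \<open>n\<close> the new path stays at or above \<open>- t\<close>, which is higher than the
      value at \<open>x\<close>; so the first minimum remains at \<open>x\<close>.\<close>
    case True
    have Tne: "T \<noteq> {}" using True xv by (auto simp: T_def above_set_def)
    note nT = nT[OF Tne]
    have xn: "x \<noteq> n"
    proof
      assume xn: "x = n"
      show False
      proof (cases "m = n - 1")
        case True
        then show False using s(1) mu xn by simp
      next
        case False
        then have "height u v (n - 1) \<ge> 1 - t" using nT(2) by (intro h2) auto
        then have "height u v n \<ge> - t"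
          using height_step[OF fin, of "n - 1"] by (auto split: if_splits)
        then show False using xm(2)[of m] xn hm nT(2) by simp
      qed
    qed
    then have nx: "n < x" using nT(4)[OF xv True] by simp
    have hx: "height u v x < - t" using xm(2)[OF True] hm by simp
    have H0: "(n \<le> k \<longrightarrow> height u0 v0 k = height u v k) \<and> (k < n \<longrightarrow> height u0 v0 k \<ge> - t)" for k
    proof -
      consider "L = {}" | "L \<noteq> {}" "m \<in> v" | "L \<noteq> {}" "m \<notin> v" by blast
      then show ?thesis
      proof cases
        case 1
        then have e: "v0 = v - {n}" using v0 Tne by simp
        have "height u0 v0 k = height u v k - (if m < k then 1 else 0) + (if n \<le> k then 1 else 0)"
          unfolding e hu0 using fin nT by (simp add: height_remove_right)
        then show ?thesis using h1[of k] h2[of k] nT(2) by auto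
      next
        case 2
        then have e: "v0 = v - {b}" using v0 by simp
        have "height u0 v0 k = height u v k - (if m < k then 1 else 0) + (if b \<le> k then 1 else 0)"
          unfolding e hu0 using fin bL[OF 2(1)] by (simp add: height_remove_right)
        then show ?thesis using h1[of k] h2[of k] nT(2) bL(2)[OF 2(1)] by auto
      next
        case 3
        then have e: "v0 = insert m (v - {b} - {n})" using v0 Tne by simp
        have "b \<noteq> n" using bL(2)[OF 3(1)] nT(2) by simp
        then have "height u0 v0 k = height u v k - (if m < k then 1 else 0) + (if b \<le> k then 1 else 0)
            + (if n \<le> k then 1 else 0) - (if m \<le> k then 1 else 0)"
          unfolding e hu0 using fin bL[OF 3(1)] nT 3(2) by (simp add: height_remove_right height_insert_right)
        then show ?thesis using h1[of k] h2[of k] hm nT(2) bL(2)[OF 3(1)] by (cases "k = m") auto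
      qed
    qed
    have fm0: "first_min u0 v0 x"
      unfolding first_min_def
    proof (intro conjI allI impI)
      fix k
      show "height u0 v0 x \<le> height u0 v0 k" using H0[of k] H0[of x] nx hx xm(1)[of k] by (cases "k < n") auto
      assume "k < x"
      then show "height u0 v0 x < height u0 v0 k" using H0[of k] H0[of x] nx hx xm(2)[of k] by (cases "k < n") auto
    qed
    have g0: "gap x u0 = gap x u"
    proof (rule gap_eqI)
      show "x + int (gap x u) \<notin> u0" using gap_not_in[OF fin(1)] by (simp add: u0_def)
      show "x + int j \<in> u0" if "j < gap x u" for j using gap_less[OF that] True by (simp add: u0_def)
    qed
    have raise0: "raise u0 v0 = Some (insert (x + q) u0, v0 - {x})"
      using raise_eqI[OF fm0] by (simp add: g0 q_def)
    have MinU: "Min U = m" unfolding U using fin True q0 mu mle by (intro Min_eqI) auto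
    have U0: "U - {Min U} = insert (x + q) u0" using MinU True q0 by (auto simp: U u0_def)
    have L': "upto_set m V = L" using True by (auto simp: L_def upto_set_def x(3))
    have T': "above_set m V = T - {x}" by (auto simp: T_def above_set_def x(3))
    have nT': "n \<in> T - {x}" using nT xn by simp
    have n': "Min (T - {x}) = n"
      using finT nT' nT(4) by (intro Min_eqI) (auto simp: T_def above_set_def)
    have mV: "m \<in> V \<longleftrightarrow> m \<in> v" using True x(3) by auto
    have b': "Min V = b" if "L \<noteq> {}"
      using bL[OF that] True fin x(3) by (intro Min_eqI) auto
    have "corner m V = corner m v"
      unfolding corner corner_def[of m V] L' T' using nT' n' b' Tne by auto
    moreover have "rest m V = v0 - {x}"
    proof -
      have "rest m V = (if L = {} then V - {n} else if m \<in> v then V - {b} else insert m (V - {b} - {n}))"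
        unfolding rest_def L' T' mV using nT' n' b' by (auto simp: Let_def)
      then show ?thesis unfolding v0 using Tne True xn x(3) by auto
    qed
    ultimately show ?thesis using raise0 U0 MinU Une by (simp add: u0_def v0_def)
  next
    case False
    then have xle: "x \<le> m" by simp
    have Lne: "L \<noteq> {}" using xv xle by (auto simp: L_def upto_set_def)
    note bL = bL[OF Lne]
    have sub: "{c \<in> v. c \<le> x} \<subseteq> L" using xle by (auto simp: L_def upto_set_def)
    have "int (card {c \<in> v. c \<le> x}) \<ge> t" using xm(1)[of m] hlow[OF xle] hm by simp
    then have "card {c \<in> v. c \<le> x} = card L" using card_mono[OF finT(2) sub] by (simp add: t_def)
    \<comment> \<open>The path has reached \<open>- t\<close> already at \<open>x\<close>, so
      \<open>v\<close> has no letters after \<open>x\<close> up to \<open>m\<close>.\<close>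
    then have Lx: "{c \<in> v. c \<le> x} = L" by (rule card_subset_eq[OF finT(2) sub])
    have hx: "height u v x = - t" using hlow[OF xle] Lx by (simp add: t_def)
    have gt: "height u v k \<ge> - t" "k < x \<Longrightarrow> height u v k > - t" for k using xm[of k] hx by auto
    have bx: "b \<le> x" using bL(4)[OF xv] .
    have xL: "x \<in> L" using xv xle by (simp add: L_def upto_set_def)
    have noV: "c \<le> x \<or> m < c" if "c \<in> v" for c
    proof (rule ccontr)
      assume n: "\<not> (c \<le> x \<or> m < c)"
      then have "c \<in> L" using that by (simp add: L_def upto_set_def)
      then show False using Lx n by auto
    qed
    have "x < c \<longleftrightarrow> m < c" if "c \<in> v" for c using noV[OF that] xle by auto
    then have T': "above_set x V = T" using xle by (auto simp: T_def above_set_def x(3))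
    show ?thesis
    proof (cases "x = m")
      \<comment> \<open>Now \<open>n = m + 1\<close>. Removing \<open>m\<close> from
        \<open>u\<close> and \<open>b\<close> from \<open>v\<close> lifts the old minimum at
        \<open>m\<close> by one but keeps the level from \<open>m + 1\<close> on, so the flat
        stretch starts one step later and the gap is one shorter.\<close>
      case True
      have g: "gap m u \<noteq> 0" using gap_not_in[OF fin(1), of m] mu by (metis add.right_neutral of_nat_0)
      then have q1: "q \<ge> 1" by (simp add: q_def True)
      have mv: "m \<in> v" using xv True by simp
      then have "m + 1 \<in> T" using m1 by (simp add: T_def above_set_def)
      then have Tne: "T \<noteq> {}" by auto
      note nT = nT[OF Tne]
      have n: "n = m + 1" using nT(2) nT(4)[of "m + 1"] m1[OF mv] by simp
      have e: "v0 = v - {b}" using v0 mv Lne by simp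
      have H0: "height u0 v0 k = height u v k - (if m < k then 1 else 0) + (if b \<le> k then 1 else 0)" for k
        unfolding e hu0 using fin bL by (simp add: height_remove_right)
      have hm1: "height u v (m + 1) = - t" using s(6)[of "m + 1"] True q1 hx by simp
      have fm0: "first_min u0 v0 (m + 1)"
        unfolding first_min_def
      proof (intro conjI allI impI)
        fix k
        show "height u0 v0 (m + 1) \<le> height u0 v0 k" unfolding H0 using hm1 gt(1)[of k] bL(2) by auto
        assume "k < m + 1"
        then show "height u0 v0 (m + 1) < height u0 v0 k"
          unfolding H0 using hm1 gt(1)[of k] gt(2)[of k] bL(2) True by auto
      qed
      have g0: "gap (m + 1) u0 = gap m u - 1"
      proof (rule gap_eqI)
        show "m + 1 + int (gap m u - 1) \<notin> u0" using gap_not_in[OF fin(1), of m] g by (simp add: u0_def)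
        show "m + 1 + int j \<in> u0" if "j < gap m u - 1" for j
          using gap_less[of "Suc j" m u] that by (simp add: u0_def add.assoc)
      qed
      have raise0: "raise u0 v0 = Some (insert (m + q) u0, v0 - {m + 1})"
        using raise_eqI[OF fm0] g by (simp add: g0 q_def True)
      have MinU: "Min U = m" unfolding U using fin True q0 mu mle by (intro Min_eqI) auto
      have U0: "U - {Min U} = insert (m + q) u0" using MinU True q1 by (auto simp: U u0_def)
      have V: "V = v - {m}" using x(3) True by simp
      have L': "upto_set m V = L - {m}" by (auto simp: L_def upto_set_def V)
      have T'': "above_set m V = T" using T' True by simp
      have MinV: "b \<noteq> m" "Min V = b" if "L - {m} \<noteq> {}"
      proof -
        obtain c where "c \<in> L" "c \<noteq> m" using \<open>L - {m} \<noteq> {}\<close> by blast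
        then have "c \<in> v" "c < m" by (auto simp: L_def upto_set_def)
        then show bm: "b \<noteq> m" using bL(4)[of c] by auto
        show "Min V = b" unfolding V using fin bL bm by (intro Min_eqI) auto
      qed
      have bm: "b = m" if "L - {m} = {}" using that bL(3) by auto
      have "corner m V = corner m v"
        unfolding corner corner_def[of m V] L' T'' n_def using MinV bm Lne by auto
      moreover have "rest m V = v0 - {m + 1}"
      proof -
        have "rest m V = (if L - {m} = {} then V - {m + 1} else insert m (V - {b} - {m + 1}))"
          unfolding rest_def L' T'' using Tne n MinV by (auto simp: Let_def n_def V)
        then show ?thesis unfolding e V using bm MinV(1) mv by auto
      qed
      ultimately show ?thesis using raise0 U0 MinU Une by (simp add: u0_def v0_def)
    next
      \<comment> \<open>\<open>x\<close> lies below all of \<open>u\<close> and becomes the new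
        minimum of the first factor, so that peeling it off leaves \<open>u\<close>. In the smaller
        pair, \<open>rest\<close> has put \<open>m\<close> into the second factor, and raising
        returns it to the first.\<close>
      case False
      then have xltm: "x < m" using xle by simp
      have xu: "x \<notin> u" using mle[of x] xltm by auto
      then have q: "q = 0" by (simp add: q_def gap_0)
      have mv: "m \<notin> v" using noV[of m] xltm by auto
      have e: "v0 = insert m (v - {b} - (if T = {} then {} else {n}))" using v0 mv Lne by simp
      have H0: "height u0 v0 k = height u v k - (if m < k then 1 else 0) + (if b \<le> k then 1 else 0)
          + (if T \<noteq> {} \<and> n \<le> k then 1 else 0) - (if m \<le> k then 1 else 0)" for k
      proof (cases "T = {}")
        case True
        then show ?thesis
          unfolding e hu0 using fin bL mv by (simp add: height_remove_right height_insert_right)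
      next
        case False
        then have "b \<noteq> n" using bL(2) nT(2) by simp
        then show ?thesis
          unfolding e hu0 using fin bL mv nT[OF False] False by (simp add: height_remove_right height_insert_right)
      qed
      have nm: "\<not> (T \<noteq> {} \<and> n \<le> m)" using nT(2) by (metis not_le)
      then have nm': "\<not> (T \<noteq> {} \<and> n \<le> k)" if "k \<le> m" for k using that by auto
      have H0m: "height u0 v0 m = - t" unfolding H0 using hm bL(2) nm by simp
      have fm0: "first_min u0 v0 m"
        unfolding first_min_def
      proof (intro conjI allI impI)
        fix k
        show "height u0 v0 m \<le> height u0 v0 k"
          unfolding H0m H0[of k] using gt(1)[of k] h2[of k] bL(2) nm' by (cases "k \<le> m") auto
        assume "k < m"
        then show "height u0 v0 m < height u0 v0 k"
          unfolding H0m H0[of k] using gt(1)[of k] gt(2)[of k] bx xltm nm' by auto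
      qed
      have "m \<notin> u0" by (simp add: u0_def)
      then have raise0: "raise u0 v0 = Some (insert m u0, v0 - {m})"
        using raise_eqI[OF fm0] by (simp add: gap_0)
      have MinU: "Min U = x" unfolding U q using fin xltm mle by (intro Min_eqI) force+
      have U0: "U - {Min U} = u" "insert m u0 = u" using MinU xu q mu by (auto simp: U u0_def)
      have L': "upto_set x V = L - {x}" using Lx by (auto simp: upto_set_def x(3))
      have MinV: "b \<noteq> x" "Min V = b" if "L - {x} \<noteq> {}"
      proof -
        obtain c where c: "c \<in> L" "c \<noteq> x" using \<open>L - {x} \<noteq> {}\<close> by blast
        then have "c \<in> v" "c < x" using Lx by auto
        then show bxn: "b \<noteq> x" using bL(4)[of c] by auto
        show "Min V = b" unfolding x(3) using fin bL bxn by (intro Min_eqI) auto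
      qed
      have bxe: "b = x" if "L - {x} = {}" using that bL(3) by auto
      have "corner x V = corner m v"
        unfolding corner corner_def[of x V] L' T' n_def using MinV bxe Lne by auto
      moreover have "rest x V = v0 - {m}"
      proof -
        have xV: "x \<notin> V" using x(3) by simp
        have "rest x V = (if L - {x} = {} then V - (if T = {} then {} else {n})
            else insert x (V - {b} - (if T = {} then {} else {n})))"
          unfolding rest_def L' T' using xV MinV by (auto simp: Let_def n_def)
        moreover have "T \<noteq> {} \<Longrightarrow> x \<noteq> n" using nT(2) xltm by auto
        ultimately show ?thesis unfolding e x(3) using bxe MinV(1) mv xv by auto
      qed
      ultimately show ?thesis using raise0 U0 MinU Une by (simp add: u0_def v0_def)
    qed
  qed
qed

text \<open>Both products peel to a smaller pair followed by the same trapped letters, and by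
  \<open>raise_rest\<close> the smaller pairs are again related by raising.\<close>

lemma raise_ck:
  assumes "finite u" "finite v" "reduced (dec u @ dec v)" "raise u v = Some (U, V)"
  shows "dec u @ dec v \<approx> dec U @ dec V"
  using assms
proof (induction "card u + card v" arbitrary: u v U V rule: less_induct)
  case less
  note fin = less.prems(1,2) and red = less.prems(3) and r = less.prems(4)
  obtain x where x: "first_min u v x" "U = insert (x + int (gap x u)) u" "V = v - {x}"
    using r by (rule raise_SomeE)
  note s = raise_structure[OF fin red x(1)]
  have xv: "x \<in> v" using s(4) by auto
  have finUV: "finite U" "finite V" using finite_raise[OF r fin] by auto
  show ?case
  proof (cases "u = {}")
    case True
    \<comment> \<open>Without letters in \<open>u\<close> the path only falls, so its first minimum
      is at the largest letter of \<open>v\<close>. Moving this letter to the first factor does not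
      change the concatenated word.\<close>
    then have U: "U = {x}" using x(2) by (simp add: gap_0)
    have "y \<le> x" if "y \<in> v" for y
    proof (rule ccontr)
      assume n: "\<not> y \<le> x"
      then have "y \<in> {c \<in> v. c \<le> y} - {c \<in> v. c \<le> x}" using that by simp
      moreover have "{c \<in> v. c \<le> x} \<subseteq> {c \<in> v. c \<le> y}" using n by auto
      ultimately have "{c \<in> v. c \<le> x} \<subset> {c \<in> v. c \<le> y}" by blast
      then have "card {c \<in> v. c \<le> x} < card {c \<in> v. c \<le> y}" using fin(2) by (intro psubset_card_mono) auto
      moreover have "card {c \<in> v. c \<le> y} \<le> card {c \<in> v. c \<le> x}"
        using x(1) True by (simp add: first_min_def height_def)
      ultimately show False by simp
    qed
    then have "dec v = x # dec V"
      using finUV xv x(3) sorted_dec by (intro dec_eqI) (auto simp: less_le)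
    then show ?thesis using U True by simp
  next
    case False
    define m where "m = Min u"
    obtain M where M: "\<forall>y\<in>u \<union> v \<union> U \<union> V. y \<le> M" using fin finUV by (metis Max_ge finite_UnI)
    have M1: "\<forall>y\<in>u \<union> v. y \<le> M" and M2: "\<forall>y\<in>U \<union> V. y \<le> M" using M by auto
    note R = raise_rest[OF fin False m_def red r]
    note p = peel(5)[OF fin False m_def red M1]
    have red0: "reduced (dec (u - {m}) @ dec (rest m v))"
      using p ck_reduced[OF p] red reduced_appendD(1)[of "dec (u - {m}) @ dec (rest m v)"] by simp
    have UV: "reduced (dec U @ dec V)" by (rule word_perm_raise(2)[OF fin red r])
    have "U \<noteq> {}" using R by simp
    note p' = peel(5)[OF finUV this refl UV M2]
    have "m \<in> u" unfolding m_def using fin(1) False by (rule Min_in)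
    then have "card (u - {m}) < card u" by (rule card_Diff1_less[OF fin(1)])
    then have "card (u - {m}) + card (rest m v) < card u + card v"
      using card_rest_le[OF fin(2), of m] by simp
    moreover have "finite (u - {m})" "finite (rest m v)" using fin finite_rest by auto
    ultimately have IH: "dec (u - {m}) @ dec (rest m v) \<approx> dec U0 @ dec V0"
      if "raise (u - {m}) (rest m v) = Some (U0, V0)" for U0 V0
      by (rule less.hyps[OF _ _ _ red0 that])
    have "dec (u - {m}) @ dec (rest m v) \<approx> dec (U - {Min U}) @ dec (rest (Min U) V)"
    proof (cases "raise (u - {m}) (rest m v) = Some (U - {Min U}, rest (Min U) V)")
      case True
      then show ?thesis by (rule IH)
    next
      case False
      then show ?thesis using R by simp
    qed
    from ck_append_right[OF this, of "row (corner m v)"]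
    have "dec (u - {m}) @ dec (rest m v) @ row (corner m v) \<approx> dec (U - {Min U}) @ dec (rest (Min U) V) @ row (corner (Min U) V)"
      using R by simp
    then show ?thesis using ck_trans[OF ck_trans[OF p] ck_sym[OF p']] by blast
  qed
qed

section \<open>A pair is determined by its class and the factor lengths\<close>

lemma lower_facts:
  assumes fin: "finite u" "finite v" and red: "reduced (dec u @ dec v)" and l: "lower u v = Some (U, V)"
  shows "finite U" "finite V" "reduced (dec U @ dec V)" "raise U V = Some (u, v)"
    "dec u @ dec v \<approx> dec U @ dec V" "card u = Suc (card U)" "card V = Suc (card v)"
proof -
  have r: "raise (uminus ` v) (uminus ` u) = Some (uminus ` V, uminus ` U)" by (simp add: raise_uminus l)
  have fin': "finite (uminus ` v)" "finite (uminus ` u)" using fin by auto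
  have red': "reduced (dec (uminus ` v) @ dec (uminus ` u))" using red reduced_dec_uminus[OF fin] by blast
  show F: "finite U" "finite V" using finite_raise[OF r fin'] by (auto simp: finite_image_iff)
  show R: "reduced (dec U @ dec V)" using word_perm_raise(2)[OF fin' red' r] reduced_dec_uminus[OF F] by blast
  show r': "raise U V = Some (u, v)" by (rule raise_lower[OF fin red l])
  show "dec u @ dec v \<approx> dec U @ dec V" using raise_ck[OF F R r'] by (rule ck_sym)
  show "card u = Suc (card U)" "card V = Suc (card v)" using card_raise[OF F R r'] by auto
qed

lemma length_dec [simp]: "length (dec A) = card A"
  by simp

lemma dec_inject: "finite A \<Longrightarrow> finite B \<Longrightarrow> dec A = dec B \<longleftrightarrow> A = B"
  using set_dec by metis

text \<open>Both pairs pass through the same frame. The outputs are equivalent, so by induction the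
  smaller pairs coincide; the final rows coincide as well, and insertion can be undone from output
  and final row.\<close>

lemma pair_ck_unique:
  assumes "finite u" "finite v" "finite u2" "finite v2" "reduced (dec u @ dec v)"
    "dec u @ dec v \<approx> dec u2 @ dec v2" "card u = card u2"
  shows "u = u2 \<and> v = v2"
  using assms
proof (induction "card u + card v" arbitrary: u v u2 v2 rule: less_induct)
  case (less u v u2 v2)
  \<comment> \<open>Stated for all pairs of the given total size with a nonempty first factor. If
    \<open>u\<close> is empty, the claim is applied to \<open>v\<close> as first and the empty set
    as second factor.\<close>
  have N: "w = w2 \<and> z = z2"
    if prems: "finite w" "finite z" "finite w2" "finite z2" "reduced (dec w @ dec z)"
      "dec w @ dec z \<approx> dec w2 @ dec z2" "card w = card w2" and ne: "w \<noteq> {}"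
      and card: "card w + card z = card u + card v" for w z w2 z2
  proof -
    note fin = prems(1,2) and fin2 = prems(3,4) and red = prems(5)
    have red2: "reduced (dec w2 @ dec z2)" using ck_reduced[OF prems(6)] red by blast
    have ne2: "w2 \<noteq> {}" using ne prems by auto
    obtain M where M: "\<forall>y\<in>w \<union> z \<union> w2 \<union> z2. y \<le> M" using fin fin2 by (metis Max_ge finite_UnI)
    have M1: "\<forall>y\<in>w \<union> z. y \<le> M" and M2: "\<forall>y\<in>w2 \<union> z2. y \<le> M" using M by auto
    define m where "m = Min w"
    define m2 where "m2 = Min w2"
    define F where "F = {M + 2, M + 4}"
    note p = peel[OF fin ne m_def red M1, folded F_def] and p2 = peel[OF fin2 ne2 m2_def red2 M2, folded F_def]
    have mw: "m \<in> w" "m2 \<in> w2" using fin ne fin2 ne2 by (auto simp: m_def m2_def)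
    have M3: "\<forall>y\<in>insert m z. y \<le> M" "\<forall>y\<in>insert m2 z2. y \<le> M" using M1 M2 mw by blast+
    note b = rest_bound[OF M3(1)] rest_bound[OF M3(2)]
    note bc = corner_bound[OF fin(2) M3(1)] corner_bound[OF fin2(2) M3(2)]
    have finr: "finite (w - {m})" "finite (rest m z)" "finite (w2 - {m2})" "finite (rest m2 z2)"
      using fin fin2 finite_rest by auto
    have flt: "filter (\<lambda>x. x \<le> M) (dec S) = dec S" if "finite S" "\<forall>y\<in>S. y \<le> M" for S
      using that by (intro filter_True) simp
    have nM: "M + 1 \<notin> S" if "\<forall>y\<in>S. y \<le> M" for S using that by (metis not_less zless_add1_eq order_refl)
    have M4: "\<forall>y\<in>w - {m}. y \<le> M" "\<forall>y\<in>w2 - {m2}. y \<le> M" using M1 M2 by blast+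
    note T = outs_ck[OF prems(6) p(2,1)]
    have "M + 1 \<notin> set (outs F (dec w @ dec z))"
      unfolding p(4) using finr nM[OF M4(1)] nM[OF b(1)] by simp
    from ck_filter[OF T(3) this]
    have eq0: "dec (w - {m}) @ dec (rest m z) \<approx> dec (w2 - {m2}) @ dec (rest m2 z2)"
      unfolding p(4) p2(4) filter.simps filter_append
      using flt[OF finr(1) M4(1)] flt[OF finr(2) b(1)] flt[OF finr(3) M4(2)] flt[OF finr(4) b(2)]
      by (simp split: if_splits)
    have red0: "reduced (dec (w - {m}) @ dec (rest m z))"
      using ck_reduced[OF p(5)] red reduced_appendD(1)[of "dec (w - {m}) @ dec (rest m z)"] by simp
    have "card (w - {m}) < card w" by (rule card_Diff1_less[OF fin(1) mw(1)])
    then have "card (w - {m}) + card (rest m z) < card u + card v"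
      using card_rest_le[OF fin(2), of m] card by simp
    then have IH: "w - {m} = w2 - {m2} \<and> rest m z = rest m2 z2"
      using fin fin2 mw prems(7) by (intro less.hyps[OF _ finr(1,2,3,4) red0 eq0]) simp_all
    \<comment> \<open>The smaller pairs do not yet give the whole output. Whether
      \<open>M + 4\<close> was bumped is read off from the final row.\<close>
    have "M + 4 \<notin> corner m z" "M + 4 \<notin> corner m2 z2" using bc by (auto dest: bspec)
    then have "M + 4 \<in> final F (dec w @ dec z) \<longleftrightarrow> above_set m z = {}"
      "M + 4 \<in> final F (dec w2 @ dec z2) \<longleftrightarrow> above_set m2 z2 = {}" unfolding p(3) p2(3) by simp_all
    then have "above_set m z = {} \<longleftrightarrow> above_set m2 z2 = {}" using T(2) by simp
    then have "outs F (dec w @ dec z) = outs F (dec w2 @ dec z2)" unfolding p(4) p2(4) using IH by simp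
    from outs_inj(1)[OF p(1,2) p2(1,2) this T(2)[symmetric]]
    have "dec w @ dec z = dec w2 @ dec z2" .
    then have "dec w = dec w2 \<and> dec z = dec z2" using prems(7) by (subst (asm) append_eq_append_conv) simp_all
    then show ?thesis using fin fin2 dec_inject by blast
  qed
  show ?case
  proof (cases "u = {}")
    case False
    then show ?thesis using N[of u v u2 v2] less.prems by blast
  next
    case True
    then have u2: "u2 = {}" using less.prems by auto
    have e: "dec v @ dec {} \<approx> dec v2 @ dec {}" using less.prems(6) True u2 by simp
    have c: "card v = card v2" using ck_length[OF e] by simp
    show ?thesis
    proof (cases "v = {}")
      case True
      then show ?thesis using c less.prems \<open>u = {}\<close> u2 by auto
    next
      case False
      have "reduced (dec v @ dec {})" using less.prems(5) True by simp
      then show ?thesis using N[OF less.prems(2) finite.emptyI less.prems(4) finite.emptyI _ e c False] True u2 by simp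
    qed
  qed
qed

text \<open>If \<open>lower U V\<close> exists, it is a pair of the right sizes in the class, hence
  \<open>(u, v)\<close>, and raising undoes it. If not, \<open>V\<close> has at least as many
  letters as \<open>U\<close>, so \<open>v\<close> has more letters than \<open>u\<close>; the path
  of \<open>(u, v)\<close> then ends below zero, \<open>raise u v\<close> exists, and uniqueness
  identifies it.\<close>

lemma raise_of_ck:
  assumes fin: "finite u" "finite v" "finite U" "finite V" and red: "reduced (dec u @ dec v)"
    and ck: "dec u @ dec v \<approx> dec U @ dec V" and card: "card U = Suc (card u)"
  shows "raise u v = Some (U, V)"
proof (cases "lower U V")
  case None
  then have "card U \<le> card V" using fin by (intro lower_NoneD)
  moreover have "card u + card v = card U + card V" using ck_length[OF ck] by simp
  ultimately have "int (card u) - int (card v) < 0" using card by simp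
  then obtain k where "height u v k < 0" using height_high[OF fin(1,2)] by metis
  then obtain p q where r: "raise u v = Some (p, q)" using raise_NoneD[OF fin(1,2), of k] by (cases "raise u v") auto
  have "dec p @ dec q \<approx> dec U @ dec V" using ck_trans[OF ck_sym[OF raise_ck[OF fin(1,2) red r]] ck] .
  moreover have "card p = card U" using card_raise(1)[OF fin(1,2) red r] card by simp
  ultimately have "p = U \<and> q = V"
    using finite_raise[OF r fin(1,2)] fin word_perm_raise(2)[OF fin(1,2) red r] by (intro pair_ck_unique) auto
  then show ?thesis using r by simp
next
  case (Some z)
  obtain p q where l: "lower U V = Some (p, q)" using Some by (cases z) auto
  have redUV: "reduced (dec U @ dec V)" using ck_reduced[OF ck] red by blast
  note lf = lower_facts[OF fin(3,4) redUV l]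
  have "dec p @ dec q \<approx> dec u @ dec v" using ck_trans[OF ck ck_sym[OF ck_sym[OF lf(5)]]] by (rule ck_sym)
  then have "p = u \<and> q = v" using lf fin card by (intro pair_ck_unique) auto
  then show ?thesis using lf(4) by simp
qed

subsection \<open>Row insertion commutes with raising and lowering\<close>

definition pass :: "int set \<Rightarrow> int set \<Rightarrow> int set" where
  "pass R u = set (outs R (dec u))"

abbreviation after :: "int set \<Rightarrow> int set \<Rightarrow> int set" where
  "after R u \<equiv> final R (dec u)"

lemma finite_pass [simp]: "finite (pass R u)"
  by (simp add: pass_def)

lemma dec_pass: "can_pass R (dec u) \<Longrightarrow> dec (pass R u) = outs R (dec u)"
  unfolding pass_def using sorted_outs[OF sorted_dec] by (rule dec_set)

lemma card_pass: "can_pass R (dec u) \<Longrightarrow> card (pass R u) = card u"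
  using dec_pass[of R u] length_dec[of "pass R u"] by simp

text \<open>Lifting is insertion of the mirrored word, and this preserves decreasing factors and
  their lengths; so a pair equivalent to the output comes from a pair and not merely from some
  word.\<close>

lemma pass_lift:
  assumes cp: "can_pass R (dec u @ dec v)" and red: "reduced (row R @ dec u @ dec v)"
    and fin: "finite p" "finite q"
    and ck: "dec (pass R u) @ dec (pass (after R u) v) \<approx> dec p @ dec q"
  shows "\<exists>d e. finite d \<and> finite e \<and> card d = card p \<and> card e = card q \<and> dec d @ dec e \<approx> dec u @ dec v"
proof -
  have c: "can_pass R (dec u)" "can_pass (after R u) (dec v)" using cp by (auto simp: can_pass_append)
  have "outs R (dec u @ dec v) \<approx> dec p @ dec q" using ck c by (simp add: dec_pass outs_append)
  from outs_ck_lift[OF cp red this] obtain w where w: "w \<approx> dec u @ dec v"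
    "star w = outs (uminus ` final R (dec u @ dec v)) (star (dec p @ dec q))"
    "can_pass (uminus ` final R (dec u @ dec v)) (star (dec p @ dec q))" by blast
  define R1 where "R1 = uminus ` final R (dec u @ dec v)"
  define R2 where "R2 = final R1 (star (dec q))"
  have w2: "star w = outs R1 (star (dec q)) @ outs R2 (star (dec p))"
    and c2: "can_pass R1 (star (dec q))" "can_pass R2 (star (dec p))"
    using w(2,3) by (auto simp: star_append outs_append can_pass_append R1_def R2_def)
  define d where "d = set (star (outs R2 (star (dec p))))"
  define e where "e = set (star (outs R1 (star (dec q))))"
  have s: "sorted_wrt (>) (star (outs R2 (star (dec p))))" "sorted_wrt (>) (star (outs R1 (star (dec q))))"
    using sorted_outs[OF _ c2(2)] sorted_outs[OF _ c2(1)] sorted_dec by (simp_all add: sorted_star)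
  have de: "dec d = star (outs R2 (star (dec p)))" "dec e = star (outs R1 (star (dec q)))"
    unfolding d_def e_def using s by (intro dec_set; simp)+
  have "w = dec d @ dec e" unfolding de using w2 by (metis star_append star_star)
  moreover have "card d = card p" "card e = card q"
    using arg_cong[OF de(1), of length] arg_cong[OF de(2), of length] by simp_all
  moreover have "finite d" "finite e" by (simp_all add: d_def e_def)
  ultimately show ?thesis using w(1) by blast
qed

text \<open>The result of an operator is characterized by class and lengths. Insertion carries such
  a result forward by \<open>outs_ck\<close>. Conversely, a result after insertion lifts back by
  \<open>pass_lift\<close>, so an operator undefined before a pass remains undefined after
  it.\<close>

lemma raise_pass:
  assumes fin: "finite u" "finite v" and cp: "can_pass R (dec u @ dec v)" and red: "reduced (row R @ dec u @ dec v)"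
  shows "raise u v = None \<Longrightarrow> raise (pass R u) (pass (after R u) v) = None"
    and "lower u v = None \<Longrightarrow> lower (pass R u) (pass (after R u) v) = None"
    and "raise u v = Some (U, V) \<Longrightarrow> can_pass R (dec U @ dec V) \<and> final R (dec U @ dec V) = final R (dec u @ dec v) \<and>
      raise (pass R u) (pass (after R u) v) = Some (pass R U, pass (after R U) V)"
    and "lower u v = Some (U, V) \<Longrightarrow> can_pass R (dec U @ dec V) \<and> final R (dec U @ dec V) = final R (dec u @ dec v) \<and>
      lower (pass R u) (pass (after R u) v) = Some (pass R U, pass (after R U) V)"
proof -
  let ?u = "pass R u" and ?v = "pass (after R u) v"
  have c: "can_pass R (dec u)" "can_pass (after R u) (dec v)" using cp by (auto simp: can_pass_append)
  have red1: "reduced (dec u @ dec v)" using red by (rule reduced_appendD)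
  have o: "outs R (dec u @ dec v) = dec ?u @ dec ?v" using c by (simp add: dec_pass outs_append)
  have red': "reduced (dec ?u @ dec ?v)" using reduced_outs[OF cp red] unfolding o .
  have cu: "card ?u = card u" using c card_pass by blast
  {
    assume n: "raise u v = None"
    show "raise ?u ?v = None"
    proof (rule ccontr)
      assume "raise ?u ?v \<noteq> None"
      then obtain p q where r: "raise ?u ?v = Some (p, q)" by auto
      have f: "finite p" "finite q" using finite_raise[OF r] by simp_all
      obtain d e where de: "finite d" "finite e" "card d = card p" "dec d @ dec e \<approx> dec u @ dec v"
        using pass_lift[OF cp red f raise_ck[OF _ _ red' r]] by auto
      have "card p = Suc (card ?u)" using card_raise(1)[OF _ _ red' r] by simp
      then have "raise u v = Some (d, e)" using de fin red1 cu by (intro raise_of_ck ck_sym[OF de(4)]) auto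
      then show False using n by simp
    qed
  }
  {
    assume n: "lower u v = None"
    show "lower ?u ?v = None"
    proof (rule ccontr)
      assume "lower ?u ?v \<noteq> None"
      then obtain p q where r: "lower ?u ?v = Some (p, q)" by auto
      note lf = lower_facts[OF finite_pass finite_pass red' r]
      obtain d e where de: "finite d" "finite e" "card d = card p" "dec d @ dec e \<approx> dec u @ dec v"
        using pass_lift[OF cp red lf(1,2,5)] by auto
      have rde: "reduced (dec d @ dec e)" using ck_reduced[OF de(4)] red1 by blast
      have "raise d e = Some (u, v)" using de fin rde lf(6) cu by (intro raise_of_ck de(4)) auto
      then have "lower u v = Some (d, e)" using de rde by (intro lower_raise)
      then show False using n by simp
    qed
  }
  have step: "can_pass R (dec U @ dec V) \<and> final R (dec U @ dec V) = final R (dec u @ dec v) \<and>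
      reduced (row R @ dec U @ dec V) \<and>
      dec ?u @ dec ?v \<approx> dec (pass R U) @ dec (pass (after R U) V) \<and> card (pass R U) = card U"
    if ck: "dec u @ dec v \<approx> dec U @ dec V" for U V
  proof -
    note T = outs_ck[OF ck red cp]
    have c: "can_pass R (dec U)" "can_pass (after R U) (dec V)" using T(1) by (auto simp: can_pass_append)
    have "outs R (dec U @ dec V) = dec (pass R U) @ dec (pass (after R U) V)" using c by (simp add: dec_pass outs_append)
    then show ?thesis using T o card_pass[OF c(1)] ck_reduced[OF ck_append_left[OF ck]] red by simp
  qed
  {
    assume r: "raise u v = Some (U, V)"
    note st = step[OF raise_ck[OF fin red1 r]]
    have "card U = Suc (card u)" using card_raise(1)[OF fin red1 r] .
    then have "raise ?u ?v = Some (pass R U, pass (after R U) V)"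
      using st cu red' by (intro raise_of_ck) auto
    then show "can_pass R (dec U @ dec V) \<and> final R (dec U @ dec V) = final R (dec u @ dec v) \<and>
      raise ?u ?v = Some (pass R U, pass (after R U) V)" using st by blast
  }
  {
    assume l: "lower u v = Some (U, V)"
    note lf = lower_facts[OF fin red1 l]
    note st = step[OF lf(5)]
    have redU: "reduced (dec (pass R U) @ dec (pass (after R U) V))" using st ck_reduced red' by blast
    have "raise (pass R U) (pass (after R U) V) = Some (?u, ?v)"
      using st ck_sym cu lf(6) redU by (intro raise_of_ck) auto
    then have "lower ?u ?v = Some (pass R U, pass (after R U) V)"
      using redU by (intro lower_raise) auto
    then show "can_pass R (dec U @ dec V) \<and> final R (dec U @ dec V) = final R (dec u @ dec v) \<and>
      lower ?u ?v = Some (pass R U, pass (after R U) V)" using st by blast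
  }
qed

subsection \<open>The signature rule, recursively\<close>

text \<open>The number of unmatched closing brackets. The truncated subtraction is intended: an
  opening bracket that finds no free closing bracket stays unmatched and is not counted.\<close>

fun closing :: "nat \<Rightarrow> nat list \<Rightarrow> nat" where
  "closing i [] = 0"
| "closing i (x # b) = (if x = i then Suc (closing i b) else if x = Suc i then closing i b - 1 else closing i b)"

fun rec_e :: "nat \<Rightarrow> nat list \<Rightarrow> nat list option" where
  "rec_e i [] = None"
| "rec_e i (x # b) = (if x = Suc i \<and> closing i b = 0 then Some (i # b) else map_option (Cons x) (rec_e i b))"

text \<open>An opening head cancels the leftmost closing bracket left over in the tail. The
  rightmost one, which is the one to change, is unaffected unless it was the only one, and then the
  first test applies.\<close>

fun rec_f :: "nat \<Rightarrow> nat list \<Rightarrow> nat list option" where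
  "rec_f i [] = None"
| "rec_f i (x # b) = (if closing i (x # b) = 0 then None
     else if x = i \<and> closing i b = 0 then Some (Suc i # b) else map_option (Cons x) (rec_f i b))"

text \<open>The starting position \<open>n\<close> is arbitrary because the positions in the tail
  begin one later. The lists \<open>ps\<close> and \<open>qs\<close> are the two blocks of the
  cancelled signature.\<close>

lemma signature_shift:
  "\<exists>ps qs. foldr (cancel_cons i) (filter (\<lambda>(k, x). x = i \<or> x = Suc i) (enumerate n b)) [] = ps @ qs \<and>
     (\<forall>p\<in>set ps. snd p = i) \<and> (\<forall>p\<in>set qs. snd p = Suc i) \<and> (\<forall>p\<in>set (ps @ qs). n \<le> fst p) \<and>
     length ps = closing i b \<and>
     rec_e i b = (if qs = [] then None else Some (b[fst (hd qs) - n := i])) \<and>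
     rec_f i b = (if ps = [] then None else Some (b[fst (last ps) - n := Suc i]))"
proof (induction b arbitrary: n)
  case (Cons x b)
  obtain ps qs where IH:
    "foldr (cancel_cons i) (filter (\<lambda>(k, x). x = i \<or> x = Suc i) (enumerate (Suc n) b)) [] = ps @ qs"
    "\<forall>p\<in>set ps. snd p = i" "\<forall>p\<in>set qs. snd p = Suc i" "\<forall>p\<in>set (ps @ qs). Suc n \<le> fst p"
    "length ps = closing i b"
    "rec_e i b = (if qs = [] then None else Some (b[fst (hd qs) - Suc n := i]))"
    "rec_f i b = (if ps = [] then None else Some (b[fst (last ps) - Suc n := Suc i]))"
    using Cons.IH[of "Suc n"] by blast
  have le: "\<forall>p\<in>set (ps @ qs). n \<le> fst p"
  proof
    fix p assume "p \<in> set (ps @ qs)"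
    then have "Suc n \<le> fst p" using IH(4) by blast
    then show "n \<le> fst p" by simp
  qed
  have upd: "x # b[k - Suc n := y] = (x # b)[k - n := y]" if "Suc n \<le> k" for k y
  proof -
    have "k - n = Suc (k - Suc n)" using that by simp
    then show ?thesis by simp
  qed
  have hd: "qs \<noteq> [] \<Longrightarrow> Suc n \<le> fst (hd qs)" and la: "ps \<noteq> [] \<Longrightarrow> Suc n \<le> fst (last ps)"
    using IH(4) by auto
  have e: "map_option (Cons x) (rec_e i b) = (if qs = [] then None else Some ((x # b)[fst (hd qs) - n := i]))"
    using IH(6) upd hd by auto
  have f: "map_option (Cons x) (rec_f i b) = (if ps = [] then None else Some ((x # b)[fst (last ps) - n := Suc i]))"
    using IH(7) upd la by auto
  consider "x = i" | "x = Suc i" "ps = []" | r rs where "x = Suc i" "ps = r # rs" | "x \<noteq> i" "x \<noteq> Suc i"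
    by (cases ps) auto
  then show ?case
  proof cases
    case 1
    have "cancel_cons i (n, i) (ps @ qs) = ((n, i) # ps) @ qs" by (cases "ps @ qs") auto
    then show ?thesis using 1 IH e f le
      by (intro exI[of _ "(n, i) # ps"] exI[of _ qs]) auto
  next
    case 2
    have "cancel_cons i (n, Suc i) (ps @ qs) = [] @ ((n, Suc i) # qs)" using 2 IH(3) by (cases qs) auto
    then show ?thesis using 2 IH f le
      by (intro exI[of _ "[]"] exI[of _ "(n, Suc i) # qs"]) auto
  next
    case 3
    have "cancel_cons i (n, Suc i) (ps @ qs) = rs @ qs" using 3 IH(2) by auto
    moreover have "rec_f i (x # b) = (if rs = [] then None else Some ((x # b)[fst (last rs) - n := Suc i]))"
    proof (cases rs)
      case Nil
      then show ?thesis using 3 IH(5) by simp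
    next
      case (Cons r' rs')
      then have "closing i (x # b) \<noteq> 0" "x \<noteq> i" using 3 IH(5) by auto
      then have "rec_f i (x # b) = map_option (Cons x) (rec_f i b)" by simp
      then show ?thesis using f 3 Cons by simp
    qed
    moreover have "rec_e i (x # b) = (if qs = [] then None else Some ((x # b)[fst (hd qs) - n := i]))"
      using e 3 IH(5) by auto
    moreover have "foldr (cancel_cons i) (filter (\<lambda>(k, x). x = i \<or> x = Suc i) (enumerate n (x # b))) [] =
      cancel_cons i (n, Suc i) (ps @ qs)" using 3 IH(1) by simp
    moreover have "\<forall>p\<in>set rs. snd p = i" using 3(2) IH(2) by simp
    moreover have "\<forall>p\<in>set (rs @ qs). n \<le> fst p" using 3(2) le by simp
    moreover have "length rs = closing i (x # b)"
      using arg_cong[OF 3(2), of length] IH(5) 3(1) by simp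
    ultimately show ?thesis using IH(3) by (intro exI[of _ rs] exI[of _ qs] conjI) simp_all
  next
    case 4
    moreover have "rec_f i (x # b) = (if ps = [] then None else Some ((x # b)[fst (last ps) - n := Suc i]))"
      using f 4 IH(5) by auto
    moreover have "rec_e i (x # b) = (if qs = [] then None else Some ((x # b)[fst (hd qs) - n := i]))"
      using e 4 by simp
    moreover have "foldr (cancel_cons i) (filter (\<lambda>(k, x). x = i \<or> x = Suc i) (enumerate n (x # b))) [] = ps @ qs"
      "length ps = closing i (x # b)" using 4 IH(1,5) by simp_all
    ultimately show ?thesis using IH(2,3) le by (intro exI[of _ ps] exI[of _ qs] conjI) simp_all
  qed
qed simp

lemma tensor_e_rec: "tensor_e i b = rec_e i b" and tensor_f_rec: "tensor_f i b = rec_f i b"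
proof -
  obtain ps qs where *: "cancelled_signature i b = ps @ qs"
    "\<forall>p\<in>set ps. snd p = i" "\<forall>p\<in>set qs. snd p = Suc i"
    "rec_e i b = (if qs = [] then None else Some (b[fst (hd qs) := i]))"
    "rec_f i b = (if ps = [] then None else Some (b[fst (last ps) := Suc i]))"
    using signature_shift[of i 0 b] unfolding cancelled_signature_def signature_def by auto
  have "unmatched_positions i b (Suc i) = map fst qs" "unmatched_positions i b i = map fst ps"
    using *(1-3) by (auto simp: unmatched_positions_def filter_empty_conv intro!: filter_True)
  then show "tensor_e i b = rec_e i b" and "tensor_f i b = rec_f i b"
    using *(4,5) by (simp_all add: tensor_e_def tensor_f_def hd_map last_map)
qed

lemma closing_rec_e: "rec_e i b = Some c \<Longrightarrow> closing i c = Suc (closing i b)"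
  by (induction b arbitrary: c) (auto split: if_splits)

lemma rec_f_None: "rec_f i b = None \<longleftrightarrow> closing i b = 0"
proof (induction b)
  case (Cons x b)
  then show ?case by (auto split: if_splits)
qed simp

lemma rec_f_rec_e: "rec_e i b = Some c \<Longrightarrow> rec_f i c = Some b"
proof (induction b arbitrary: c)
  case (Cons x b)
  show ?case
  proof (cases "x = Suc i \<and> closing i b = 0")
    case True
    then show ?thesis using Cons.prems by auto
  next
    case False
    then obtain d where d: "rec_e i b = Some d" "c = x # d" using Cons.prems by (auto split: if_splits)
    then have "rec_f i d = Some b" "closing i d = Suc (closing i b)" using Cons.IH closing_rec_e by auto
    then show ?thesis using False d by auto
  qed
qed simp

lemma closing_rec_f: "rec_f i b = Some c \<Longrightarrow> closing i b = Suc (closing i c)"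
proof (induction b arbitrary: c)
  case (Cons x b)
  then show ?case by (auto split: if_splits)
qed simp

lemma rec_e_rec_f: "rec_f i b = Some c \<Longrightarrow> rec_e i c = Some b"
proof (induction b arbitrary: c)
  case (Cons x b)
  then show ?case by (auto split: if_splits dest: closing_rec_f)
qed simp

lemma tensor_e_f: "tensor_e i b = Some c \<longleftrightarrow> tensor_f i c = Some b"
  unfolding tensor_e_rec tensor_f_rec using rec_e_rec_f rec_f_rec_e by blast

text \<open>The number of unmatched closing brackets is the largest excess of closing over opening
  brackets in a prefix, and the prefixes of a decreasing list are its upper sets. The free bound
  \<open>m\<close> absorbs the contribution of the head in the induction.\<close>

lemma closing_le_iff:
  fixes L :: "int list"
  assumes "sorted_wrt (>) L"
  shows "closing i (map c L) \<le> m \<longleftrightarrow>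
    (\<forall>k. card {z \<in> set L. k \<le> z \<and> c z = i} \<le> m + card {z \<in> set L. k \<le> z \<and> c z = Suc i})"
  using assms
proof (induction L arbitrary: m)
  case (Cons z L)
  have lt: "\<forall>y\<in>set L. y < z" using Cons.prems by simp
  have IH: "closing i (map c L) \<le> m \<longleftrightarrow>
    (\<forall>k. card {z \<in> set L. k \<le> z \<and> c z = i} \<le> m + card {z \<in> set L. k \<le> z \<and> c z = Suc i})" for m
    using Cons.prems by (intro Cons.IH) simp
  define A where "A j k = card {y \<in> set L. k \<le> y \<and> c y = j}" for j k
  have A0: "A j k = 0" if "z \<le> k" for j k
  proof -
    have "{y \<in> set L. k \<le> y \<and> c y = j} = {}"
    proof (rule equals0I)
      fix y assume "y \<in> {y \<in> set L. k \<le> y \<and> c y = j}"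
      then show False using lt that by auto
    qed
    then show ?thesis by (simp only: A_def card.empty)
  qed
  have zL: "z \<notin> set L" using lt by auto
  have B: "card {y \<in> set (z # L). k \<le> y \<and> c y = j} = A j k + (if k \<le> z \<and> c z = j then 1 else 0)" for j k
  proof -
    have "{y \<in> set (z # L). k \<le> y \<and> c y = j} =
       (if k \<le> z \<and> c z = j then insert z {y \<in> set L. k \<le> y \<and> c y = j} else {y \<in> set L. k \<le> y \<and> c y = j})"
      by auto
    then show ?thesis using zL by (simp add: A_def)
  qed
  note IH' = IH[folded A_def]
  show ?case
  proof (cases "c z = i")
    case True
    show ?thesis
    proof (cases m)
      case 0
      then show ?thesis unfolding B using True A0[of z] by (auto intro!: exI[of _ z])
    next
      case (Suc m')
      have "(\<forall>k. A i k \<le> m' + A (Suc i) k) \<longleftrightarrow>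
        (\<forall>k. A i k + (if k \<le> z \<and> c z = i then 1 else 0) \<le> m + (A (Suc i) k + (if k \<le> z \<and> c z = Suc i then 1 else 0)))"
        (is "?l \<longleftrightarrow> ?r")
      proof
        assume l: ?l
        show ?r
        proof
          fix k show "A i k + (if k \<le> z \<and> c z = i then 1 else 0) \<le> m + (A (Suc i) k + (if k \<le> z \<and> c z = Suc i then 1 else 0))"
            using l[rule_format, of k] True Suc by simp
        qed
      next
        assume r: ?r
        show ?l
        proof
          fix k show "A i k \<le> m' + A (Suc i) k" using r[rule_format, of k] True Suc A0[of k] by (cases "k \<le> z") auto
        qed
      qed
      then show ?thesis unfolding B using True Suc IH'[of m'] by simp
    qed
  next
    case F: False
    show ?thesis
    proof (cases "c z = Suc i")
      case True
      have "(\<forall>k. A i k \<le> Suc m + A (Suc i) k) \<longleftrightarrow>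
        (\<forall>k. A i k + (if k \<le> z \<and> c z = i then 1 else 0) \<le> m + (A (Suc i) k + (if k \<le> z \<and> c z = Suc i then 1 else 0)))"
        (is "?l \<longleftrightarrow> ?r")
      proof
        assume l: ?l
        show ?r
        proof
          fix k show "A i k + (if k \<le> z \<and> c z = i then 1 else 0) \<le> m + (A (Suc i) k + (if k \<le> z \<and> c z = Suc i then 1 else 0))"
            using l[rule_format, of k] True A0[of k] by (cases "k \<le> z") auto
        qed
      next
        assume r: ?r
        show ?l
        proof
          fix k show "A i k \<le> Suc m + A (Suc i) k" using r[rule_format, of k] True by (auto split: if_splits)
        qed
      qed
      moreover have "closing i (map c L) - 1 \<le> m \<longleftrightarrow> closing i (map c L) \<le> Suc m" by auto
      ultimately show ?thesis unfolding B using True IH'[of "Suc m"] by simp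
    next
      case False
      then show ?thesis unfolding B using F IH'[of m] by simp
    qed
  qed
qed simp

lemma closing_0_iff:
  assumes "finite S"
  shows "closing i (map c (dec S)) = 0 \<longleftrightarrow> (\<forall>k. card {z \<in> S. k \<le> z \<and> c z = i} \<le> card {z \<in> S. k \<le> z \<and> c z = Suc i})"
  using closing_le_iff[OF sorted_dec, of i c S 0] assms by simp

lemma rec_e_map_None:
  assumes "\<And>L1 z L2. L = L1 @ z # L2 \<Longrightarrow> c z = Suc i \<Longrightarrow> closing i (map c L2) \<noteq> 0"
  shows "rec_e i (map c L) = None"
  using assms
proof (induction L)
  case (Cons y L)
  have "rec_e i (map c L) = None"
  proof (rule Cons.IH)
    show "closing i (map c L2) \<noteq> 0" if "L = L1 @ z # L2" "c z = Suc i" for L1 z L2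
      using Cons.prems[of "y # L1" z L2] that by simp
  qed
  then show ?case using Cons.prems[of "[]" y L] by auto
qed simp

lemma rec_e_map_Some:
  assumes "distinct (L1 @ x # L2)" "c x = Suc i" "closing i (map c L2) = 0"
    "\<And>M1 z M2. L1 = M1 @ z # M2 \<Longrightarrow> c z = Suc i \<Longrightarrow> closing i (map c (M2 @ x # L2)) \<noteq> 0"
  shows "rec_e i (map c (L1 @ x # L2)) = Some (map (c(x := i)) (L1 @ x # L2))"
  using assms
proof (induction L1)
  case Nil
  then have "map (c(x := i)) L2 = map c L2" by auto
  then show ?case using Nil by simp
next
  case (Cons y L1)
  have "rec_e i (map c (L1 @ x # L2)) = Some (map (c(x := i)) (L1 @ x # L2))"
  proof (rule Cons.IH)
    show "closing i (map c (M2 @ x # L2)) \<noteq> 0" if "L1 = M1 @ z # M2" "c z = Suc i" for M1 z M2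
      using Cons.prems(4)[of "y # M1" z M2] that by simp
  qed (use Cons.prems in simp_all)
  moreover have "c y = Suc i \<Longrightarrow> closing i (map c (L1 @ x # L2)) \<noteq> 0"
    using Cons.prems(4)[of "[]" y L1] by simp
  ultimately show ?case using Cons.prems(1) by auto
qed

lemma height_diff:
  assumes "finite u" "finite v" "k < z"
  shows "height u v z - height u v k = int (card {b \<in> u. k \<le> b \<and> b < z}) - int (card {c \<in> v. k < c \<and> c \<le> z})"
proof -
  have "{b \<in> u. b < z} = {b \<in> u. b < k} \<union> {b \<in> u. k \<le> b \<and> b < z}"
    "{c \<in> v. c \<le> z} = {c \<in> v. c \<le> k} \<union> {c \<in> v. k < c \<and> c \<le> z}" using assms(3) by auto
  moreover have "card ({b \<in> u. b < k} \<union> {b \<in> u. k \<le> b \<and> b < z}) = card {b \<in> u. b < k} + card {b \<in> u. k \<le> b \<and> b < z}"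
    "card ({c \<in> v. c \<le> k} \<union> {c \<in> v. k < c \<and> c \<le> z}) = card {c \<in> v. c \<le> k} + card {c \<in> v. k < c \<and> c \<le> z}"
    using assms by (intro card_Un_disjoint; auto)+
  ultimately show ?thesis by (simp add: height_def)
qed

text \<open>In the decreasing reading the letters below \<open>z\<close> follow it. The left side
  says that the opening bracket at \<open>z\<close> remains unmatched, the right side that the path
  at \<open>z\<close> is lower than everywhere before.\<close>

lemma closing_below_iff:
  fixes c :: "int \<Rightarrow> nat" and i :: nat
  assumes "finite S" "z \<in> S" "c z = Suc i"
  defines "u \<equiv> {y \<in> S. c y = i}" and "v \<equiv> {y \<in> S. c y = Suc i}"
  shows "closing i (map c (dec {y \<in> S. y < z})) = 0 \<longleftrightarrow> (\<forall>k<z. height u v z < height u v k)"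
proof -
  have fin: "finite u" "finite v" using assms by (auto simp: u_def v_def)
  define U where "U k = card {b \<in> u. k \<le> b \<and> b < z}" for k
  define V where "V k = card {y \<in> v. k < y \<and> y < z}" for k
  have UV: "height u v z < height u v k \<longleftrightarrow> U k \<le> V k" if "k < z" for k
  proof -
    have "{y \<in> v. k < y \<and> y \<le> z} = insert z {y \<in> v. k < y \<and> y < z}"
      using assms that by (auto simp: v_def)
    then have "card {y \<in> v. k < y \<and> y \<le> z} = Suc (V k)" using fin by (simp add: V_def)
    then have "height u v z - height u v k = int (U k) - int (Suc (V k))"
      using height_diff[OF fin that] by (simp add: U_def)
    then show ?thesis by linarith
  qed
  have "closing i (map c (dec {y \<in> S. y < z})) = 0 \<longleftrightarrow>
    (\<forall>k. U k \<le> card {y \<in> v. k \<le> y \<and> y < z})"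
  proof -
    have "{y \<in> {y \<in> S. y < z}. k \<le> y \<and> c y = i} = {b \<in> u. k \<le> b \<and> b < z}"
      "{y \<in> {y \<in> S. y < z}. k \<le> y \<and> c y = Suc i} = {y \<in> v. k \<le> y \<and> y < z}" for k
      by (auto simp: u_def v_def)
    then show ?thesis using closing_0_iff[of "{y \<in> S. y < z}" i c] assms(1) by (simp add: U_def)
  qed
  also have "\<dots> \<longleftrightarrow> (\<forall>k<z. U k \<le> V k)"
  proof
    assume l: "\<forall>k. U k \<le> card {y \<in> v. k \<le> y \<and> y < z}"
    show "\<forall>k<z. U k \<le> V k"
    proof (intro allI impI)
      fix k assume "k < z"
      show "U k \<le> V k"
      proof (cases "k \<in> v")
        case True
        \<comment> \<open>Since \<open>k\<close> lies in \<open>v\<close> it is not in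
          \<open>u\<close>, so \<open>k + 1\<close> gives the same count in \<open>u\<close> and
          excludes \<open>k\<close> from the count in \<open>v\<close>.\<close>
        then have "k \<notin> u" by (auto simp: u_def v_def)
        then have "{b \<in> u. k \<le> b \<and> b < z} = {b \<in> u. k + 1 \<le> b \<and> b < z}" by (auto simp: order.order_iff_strict)
        moreover have "{y \<in> v. k + 1 \<le> y \<and> y < z} = {y \<in> v. k < y \<and> y < z}" by auto
        ultimately show ?thesis using l[rule_format, of "k + 1"] by (simp add: U_def V_def)
      next
        case False
        then have "{y \<in> v. k \<le> y \<and> y < z} = {y \<in> v. k < y \<and> y < z}" by (auto simp: order.order_iff_strict)
        then show ?thesis using l[rule_format, of k] by (simp add: V_def)
      qed
    qed
  next
    assume r: "\<forall>k<z. U k \<le> V k"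
    show "\<forall>k. U k \<le> card {y \<in> v. k \<le> y \<and> y < z}"
    proof
      fix k
      show "U k \<le> card {y \<in> v. k \<le> y \<and> y < z}"
      proof (cases "k < z")
        case True
        have "V k \<le> card {y \<in> v. k \<le> y \<and> y < z}" unfolding V_def using fin by (intro card_mono) auto
        then show ?thesis using r True by (meson le_trans)
      next
        case False
        then have "{b \<in> u. k \<le> b \<and> b < z} = {}" by auto
        then have "U k = 0" by (simp only: U_def card.empty)
        then show ?thesis by simp
      qed
    qed
  qed
  finally show ?thesis using UV by auto
qed

text \<open>The leftmost unmatched opening bracket is the largest letter at which the path is lower
  than everywhere before, and this is its first minimum \<open>x\<close>. A letter has only one
  index, so \<open>x\<close> is not in \<open>u\<close>, the gap is 0, and raising merely changes
  the index of \<open>x\<close>.\<close>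

lemma tensor_e_raise:
  fixes c :: "int \<Rightarrow> nat" and i :: nat
  assumes fin: "finite S"
  defines "u \<equiv> {y \<in> S. c y = i}" and "v \<equiv> {y \<in> S. c y = Suc i}"
  shows "raise u v = None \<Longrightarrow> tensor_e i (map c (dec S)) = None"
    and "raise u v = Some (U, V) \<Longrightarrow> \<exists>x. x \<in> v \<and> U = insert x u \<and> V = v - {x} \<and>
      tensor_e i (map c (dec S)) = Some (map (c(x := i)) (dec S))"
proof -
  have finuv: "finite u" "finite v" using fin by (auto simp: u_def v_def)
  have tail: "M2 = dec {y \<in> S. y < z}" if "dec S = M1 @ z # M2" for M1 z M2
  proof -
    have "sorted_wrt (>) (M1 @ z # M2)" using sorted_dec[of S] that by simp
    moreover have "S = set (M1 @ z # M2)" using that[symmetric] fin by simp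
    ultimately show ?thesis
      by (intro dec_eqI[symmetric]) (auto simp: sorted_wrt_append dest: less_trans)
  qed
  {
    assume n: "raise u v = None"
    have "rec_e i (map c (dec S)) = None"
    proof (rule rec_e_map_None)
      fix M1 z M2 assume d: "dec S = M1 @ z # M2" and cz: "c z = Suc i"
      have "z \<in> set (dec S)" unfolding d by simp
      then have zS: "z \<in> S" using fin by simp
      show "closing i (map c M2) \<noteq> 0"
      proof
        assume "closing i (map c M2) = 0"
        then have "\<forall>k<z. height u v z < height u v k"
          using closing_below_iff[OF fin zS, of c i] cz tail[OF d] by (simp add: u_def v_def)
        moreover obtain k where "height u v k = 0" "k < z" using ex_height_0[OF finuv] by blast
        ultimately have "height u v z < 0" by force
        then show False using raise_NoneD[OF finuv n, of z] by simp
      qed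
    qed
    then show "tensor_e i (map c (dec S)) = None" by (simp add: tensor_e_rec)
  }
  assume r: "raise u v = Some (U, V)"
  then obtain x where x: "first_min u v x" "U = insert (x + int (gap x u)) u" "V = v - {x}"
    by (rule raise_SomeE)
  have "height u v x < height u v (x - 1)" using x(1) by (simp add: first_min_def)
  then have xv: "x \<in> v" using height_step[OF finuv, of "x - 1"] by (auto split: if_splits)
  then have "x \<notin> u" and xS: "x \<in> S" and cx: "c x = Suc i" by (auto simp: u_def v_def)
  then have U: "U = insert x u" using x(2) by (simp add: gap_0)
  define L1 where "L1 = dec {y \<in> S. x < y}"
  define L2 where "L2 = dec {y \<in> S. y < x}"
  have d: "dec S = L1 @ x # L2" using dec_split[OF fin xS] by (simp add: L1_def L2_def)
  have "rec_e i (map c (L1 @ x # L2)) = Some (map (c(x := i)) (L1 @ x # L2))"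
  proof (rule rec_e_map_Some)
    show "distinct (L1 @ x # L2)" unfolding d[symmetric] by simp
    show "c x = Suc i" by (rule cx)
    show "closing i (map c L2) = 0"
      using closing_below_iff[of S x c i, OF fin xS cx] x(1) by (simp add: L2_def u_def v_def first_min_def)
    fix M1 z M2 assume l: "L1 = M1 @ z # M2" and cz: "c z = Suc i"
    have dz: "dec S = M1 @ z # (M2 @ x # L2)" using d l by simp
    have "z \<in> set L1" by (simp add: l)
    then have zS: "z \<in> S" "x < z" using fin by (auto simp: L1_def)
    show "closing i (map c (M2 @ x # L2)) \<noteq> 0"
    proof
      assume "closing i (map c (M2 @ x # L2)) = 0"
      then have "\<forall>k<z. height u v z < height u v k"
        using closing_below_iff[OF fin zS(1), of c i] cz tail[OF dz] by (simp add: u_def v_def)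
      then show False using zS(2) x(1) by (auto simp: first_min_def not_less[symmetric])
    qed
  qed
  then show "\<exists>x. x \<in> v \<and> U = insert x u \<and> V = v - {x} \<and>
      tensor_e i (map c (dec S)) = Some (map (c(x := i)) (dec S))"
    using xv U x(3) d by (intro exI[of _ x]) (simp add: tensor_e_rec)
qed

text \<open>The undefined case alone is treated here; the defined one follows from
  \<open>tensor_e_raise\<close>, because the operators are inverse to each other on both
  sides.\<close>

lemma tensor_f_lower_None:
  fixes c :: "int \<Rightarrow> nat" and i :: nat
  assumes fin: "finite S"
  defines "u \<equiv> {y \<in> S. c y = i}" and "v \<equiv> {y \<in> S. c y = Suc i}"
  assumes l: "lower u v = None"
  shows "tensor_f i (map c (dec S)) = None"
proof -
  have finuv: "finite u" "finite v" using fin by (auto simp: u_def v_def)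
  have "raise (uminus ` v) (uminus ` u) = None" using l by (simp add: lower_def)
  then have h: "height (uminus ` v) (uminus ` u) k \<ge> 0" for k using finuv by (intro raise_NoneD) auto
  have "card {z \<in> S. k \<le> z \<and> c z = i} \<le> card {z \<in> S. k \<le> z \<and> c z = Suc i}" for k
  proof -
    have "{b \<in> uminus ` v. b < - k} = uminus ` {z \<in> v. k < z}" "{b \<in> uminus ` u. b \<le> - k} = uminus ` {z \<in> u. k \<le> z}"
      by auto
    then have "card {z \<in> u. k \<le> z} \<le> card {z \<in> v. k < z}"
      using h[of "- k"] by (simp add: height_def card_image)
    also have "\<dots> \<le> card {z \<in> v. k \<le> z}" using finuv by (intro card_mono) auto
    finally show ?thesis by (simp add: u_def v_def conj_commute conj_left_commute)
  qed
  then show ?thesis using closing_0_iff[OF fin, of i c] by (simp add: tensor_f_rec rec_f_None)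
qed

subsection \<open>Factorizations\<close>

definition word :: "int set list \<Rightarrow> int list" where
  "word a = concat (map dec a)"

definition op_at ::
  "(int set \<Rightarrow> int set \<Rightarrow> (int set \<times> int set) option) \<Rightarrow> nat \<Rightarrow> int set list \<Rightarrow> int set list option" where
  "op_at opr i a = map_option (\<lambda>(U, V). a[i - 1 := U, i := V]) (opr (a ! (i - 1)) (a ! i))"

fun passes :: "int set \<Rightarrow> int set list \<Rightarrow> int set list" where
  "passes R [] = []"
| "passes R (u # a) = pass R u # passes (after R u) a"

definition passable :: "int set \<Rightarrow> int set list \<Rightarrow> bool" where
  "passable R a \<longleftrightarrow> can_pass R (word a) \<and> reduced (row R @ word a) \<and> (\<forall>u\<in>set a. finite u)"

lemma word_simps [simp]: "word [] = []" "word (u # a) = dec u @ word a" "word (a @ b) = word a @ word b"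
  by (simp_all add: word_def)

lemma set_word: "(\<forall>u\<in>set a. finite u) \<Longrightarrow> set (word a) = \<Union> (set a)"
  by (auto simp: word_def)

lemma factor_split:
  assumes "1 \<le> i" "i < length a"
  obtains p u v s where "a = p @ u # v # s" "i = Suc (length p)"
proof
  show "a = take (i - 1) a @ a ! (i - 1) # a ! i # drop (Suc i) a"
    using assms id_take_nth_drop[of "i - 1" a] Cons_nth_drop_Suc[of i a] by simp
  show "i = Suc (length (take (i - 1) a))" using assms by simp
qed

lemma op_at_split:
  "op_at opr (Suc (length p)) (p @ u # v # s) = map_option (\<lambda>(U, V). p @ U # V # s) (opr u v)"
  by (simp add: op_at_def nth_append list_update_append split_def)

lemma op_facts:
  assumes "opr = raise \<or> opr = lower" "finite u" "finite v" "reduced (dec u @ dec v)" "opr u v = Some (U, V)"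
  shows "finite U" "finite V" "dec u @ dec v \<approx> dec U @ dec V"
proof -
  have "finite U \<and> finite V \<and> dec u @ dec v \<approx> dec U @ dec V"
    using assms(1)
  proof
    assume "opr = raise"
    then have r: "raise u v = Some (U, V)" using assms(5) by simp
    show ?thesis using finite_raise[OF r assms(2,3)] raise_ck[OF assms(2-4) r] by blast
  next
    assume "opr = lower"
    then have r: "lower u v = Some (U, V)" using assms(5) by simp
    show ?thesis using lower_facts[OF assms(2-4) r] by blast
  qed
  then show "finite U" "finite V" "dec u @ dec v \<approx> dec U @ dec V" by auto
qed

lemma op_at_facts:
  assumes "opr = raise \<or> opr = lower" "\<forall>u\<in>set a. finite u" "reduced (word a)" "1 \<le> i" "i < length a"
    "op_at opr i a = Some b"
  shows "\<forall>u\<in>set b. finite u" "word a \<approx> word b" "length b = length a"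
proof -
  obtain p u v s where a: "a = p @ u # v # s" "i = Suc (length p)" using factor_split[OF assms(4,5)] .
  then obtain U V where UV: "opr u v = Some (U, V)" "b = p @ U # V # s"
    using assms(6) unfolding a op_at_split by auto
  have "reduced (word p @ (dec u @ dec v) @ word s)" using assms(3) by (simp add: a)
  then have red: "reduced (dec u @ dec v)" by (rule reduced_middleD)
  have fin: "finite u" "finite v" using assms(2) by (simp_all add: a)
  note f = op_facts[OF assms(1) fin red UV(1)]
  show "\<forall>u\<in>set b. finite u" "length b = length a" using f(1,2) assms(2) by (auto simp: UV(2) a)
  show "word a \<approx> word b" using ck_append[OF f(3), of "word p" "word s"] by (simp add: UV(2) a)
qed

lemma passes_append: "passes R (a @ b) = passes R a @ passes (final R (word a)) b"
  by (induction a arbitrary: R) (simp_all add: final_append)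

lemma length_passes [simp]: "length (passes R a) = length a"
  by (induction a arbitrary: R) simp_all

lemma finite_passes: "\<forall>u\<in>set (passes R a). finite u"
  by (induction a arbitrary: R) simp_all

lemma word_passes: "can_pass R (word a) \<Longrightarrow> word (passes R a) = outs R (word a)"
  by (induction a arbitrary: R) (simp_all add: can_pass_append outs_append dec_pass)

lemma card_passes: "can_pass R (word a) \<Longrightarrow> map card (passes R a) = map card a"
  by (induction a arbitrary: R) (simp_all add: can_pass_append card_pass)

text \<open>The factors before the pair prepare the row. The row after the pair is unchanged by the
  operator, so the factors behind it bump the same letters as before.\<close>

lemma passes_op:
  assumes opr: "opr = raise \<or> opr = lower" and pa: "passable R a" and i: "1 \<le> i" "i < length a"
  shows "op_at opr i (passes R a) = map_option (passes R) (op_at opr i a)"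
    and "op_at opr i a = Some b \<Longrightarrow> final R (word b) = final R (word a)"
proof -
  obtain p u v s where a: "a = p @ u # v # s" "i = Suc (length p)" using factor_split[OF i] .
  define R1 where "R1 = final R (word p)"
  define R2 where "R2 = final R1 (dec u @ dec v)"
  have cp: "can_pass R (word p)" "can_pass R1 (dec u @ dec v)"
    using pa by (auto simp: passable_def a can_pass_append R1_def)
  have red: "reduced (row R @ word p @ (dec u @ dec v) @ word s)" using pa by (simp add: passable_def a)
  have "reduced (row R1 @ (dec u @ dec v) @ word s)"
    using reduced_final(2)[OF cp(1) red] by (simp add: R1_def)
  then have red1: "reduced (row R1 @ dec u @ dec v)"
    using reduced_appendD(1)[of "row R1 @ dec u @ dec v" "word s"] by simp
  have fin: "finite u" "finite v" using pa by (simp_all add: passable_def a)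
  note RP = raise_pass[OF fin cp(2) red1]
  have key: "opr (pass R1 u) (pass (after R1 u) v) =
      map_option (\<lambda>(U, V). (pass R1 U, pass (after R1 U) V)) (opr u v)"
  proof (cases "opr u v")
    case None
    then show ?thesis using opr RP(1,2) by auto
  next
    case (Some z)
    then obtain U V where "opr u v = Some (U, V)" by (cases z) auto
    then show ?thesis using opr RP(3,4)[of U V] by auto
  qed
  have fi: "final R1 (dec U @ dec V) = R2" if "opr u v = Some (U, V)" for U V
    using opr RP(3,4)[of U V] that by (auto simp: R2_def)
  have pas: "passes R (p @ U # V # s) = passes R p @ pass R1 U # pass (after R1 U) V # passes (final R1 (dec U @ dec V)) s" for U V
    by (simp add: passes_append R1_def[symmetric] final_append)
  have "op_at opr i (passes R a) =
      map_option (\<lambda>(U, V). passes R p @ U # V # passes R2 s) (opr (pass R1 u) (pass (after R1 u) v))"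
    unfolding a pas R2_def[symmetric] using op_at_split[of opr "passes R p"] by simp
  also have "\<dots> = map_option (passes R) (op_at opr i a)"
    unfolding key a op_at_split by (cases "opr u v") (auto simp: pas fi)
  finally show "op_at opr i (passes R a) = map_option (passes R) (op_at opr i a)" .
  assume "op_at opr i a = Some b"
  then obtain U V where UV: "opr u v = Some (U, V)" "b = p @ U # V # s"
    unfolding a op_at_split by auto
  show "final R (word b) = final R (word a)"
    using fi[OF UV(1)] by (simp add: UV(2) a final_append R1_def[symmetric] R2_def)
qed

lemma word_inject:
  assumes "word a = word b" "map card a = map card b" "\<forall>u\<in>set a. finite u" "\<forall>u\<in>set b. finite u"
  shows "a = b"
  using assms
proof (induction a arbitrary: b)
  case (Cons u a)
  then obtain v b' where b: "b = v # b'" by (cases b) auto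
  have "dec u = dec v \<and> word a = word b'"
    using Cons.prems(1,2) unfolding b by (subst append_eq_append_conv[symmetric]) simp_all
  then show ?case using Cons dec_inject[of u v] by (simp add: b)
qed simp

lemma passes_inj:
  assumes "passable R a" "passable R b" "passes R a = passes R b" "final R (word a) = final R (word b)"
  shows "a = b"
proof (rule word_inject)
  have c: "can_pass R (word a)" "reduced (row R @ word a)" "can_pass R (word b)" "reduced (row R @ word b)"
    using assms(1,2) by (auto simp: passable_def)
  show "word a = word b"
    using outs_inj(1)[OF c _ assms(4)] word_passes[OF c(1)] word_passes[OF c(3)] assms(3) by simp
  show "map card a = map card b" using card_passes[OF c(1)] card_passes[OF c(3)] assms(3) by simp
qed (use assms in \<open>auto simp: passable_def\<close>)

subsection \<open>Spreading out the letters\<close>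

text \<open>The frame starts at \<open>B + 2\<close>, two above the largest possible letter. With
  \<open>N\<close> the length of the word there is a letter to bump for every insertion.\<close>

definition frame :: "int \<Rightarrow> nat \<Rightarrow> int set" where
  "frame B N = (\<lambda>i. B + 2 * int i) ` {1..N}"

lemma finite_frame [simp]: "finite (frame B N)"
  by (simp add: frame_def)

lemma card_frame: "card (frame B N) = N"
  by (simp add: frame_def card_image inj_on_def)

lemma frame_bounds: "z \<in> frame B N \<Longrightarrow> B + 2 \<le> z \<and> z \<le> B + 2 * int N"
  by (auto simp: frame_def)

lemma spaced_frame: "spaced (frame B N)"
  by (auto simp: spaced_def frame_def)

lemma card_row_insert:
  assumes "finite R" "\<exists>r\<in>R. x < r" shows "card (row_insert R x) = card R"
proof (cases "x \<in> R")
  case False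
  then have "card (row_insert R x) = Suc (card (R - {bump R x}))" using assms(1) by (simp add: row_insert_def)
  also have "\<dots> = card R" using assms(1) bump(1)[OF assms] by (rule card_Suc_Diff1)
  finally show ?thesis .
qed (simp add: row_insert_def)

lemma card_final: "can_pass R c \<Longrightarrow> card (final R c) = card R"
  by (induction c arbitrary: R) (auto simp: card_row_insert)

text \<open>Each insertion uses up at most one row letter above \<open>B\<close>.\<close>

lemma can_pass_card:
  assumes "finite R" "length c \<le> card {r \<in> R. B < r}" "\<forall>z\<in>set c. z \<le> B"
  shows "can_pass R c"
  using assms
proof (induction c arbitrary: R)
  case (Cons x c)
  have "{r \<in> R. B < r} \<noteq> {}" using Cons.prems(2) by (metis card.empty le_zero_eq length_Cons nat.distinct(1))
  then obtain r where "r \<in> R" "x < r" using Cons.prems(3) by fastforce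
  then have ex: "\<exists>r\<in>R. x < r" by blast
  have "{r \<in> R. B < r} - {bump R x} \<subseteq> {r \<in> row_insert R x. B < r}" by (auto simp: row_insert_def)
  then have "card ({r \<in> R. B < r} - {bump R x}) \<le> card {r \<in> row_insert R x. B < r}"
    using Cons.prems(1) by (intro card_mono) auto
  moreover have "card {r \<in> R. B < r} - 1 \<le> card ({r \<in> R. B < r} - {bump R x})"
    by (simp add: card_Diff_singleton_if)
  ultimately have "can_pass (row_insert R x) c" using Cons.prems by (intro Cons.IH) auto
  then show ?case using ex Cons.prems(1) by simp
qed simp

text \<open>A small inserted letter enters the row, and a large one bumps only a still larger one,
  so small letters in the row are expelled only by small letters.\<close>

lemma final_small:
  assumes "can_pass R c" "\<exists>z\<in>R \<union> set c. z \<le> M"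
  shows "\<exists>z\<in>final R c. z \<le> M"
  using assms
proof (induction c arbitrary: R)
  case (Cons x c)
  then have ex: "finite R" "\<exists>r\<in>R. x < r" by auto
  have "\<exists>z\<in>row_insert R x \<union> set c. z \<le> M"
  proof (cases "x \<le> M")
    case True
    then show ?thesis using row_insert_mem by blast
  next
    case False
    then obtain z where z: "z \<in> R \<union> set c" "z \<le> M" using Cons.prems(2) by auto
    have "z \<noteq> bump R x" using z(2) False bump(2)[OF ex] by auto
    then show ?thesis using z by (auto simp: row_insert_def)
  qed
  then show ?case using Cons.prems(1) Cons.IH[of "row_insert R x"] by simp
qed simp

lemma mset_row: "finite R \<Longrightarrow> mset (row R) = mset_set R"
  using mset_set_set[of "row R"] by simp

text \<open>An insertion exchanges letters between word and row, except when \<open>x\<close> is in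
  the row already and turns into \<open>x + 1\<close>. Distinctness of the large letters excludes
  this for \<open>x > M\<close>, the empty place \<open>M + 1\<close> excludes it for
  \<open>x = M\<close>, and below \<open>M\<close> the large letters are not concerned.\<close>

lemma outs_big:
  assumes "can_pass R c" "reduced (row R @ c)" "M + 1 \<notin> R \<union> set c" "distinct (filter (\<lambda>z. M < z) (c @ row R))"
  shows "mset (filter (\<lambda>z. M < z) (outs R c @ row (final R c))) = mset (filter (\<lambda>z. M < z) (c @ row R))"
  using assms
proof (induction c arbitrary: R)
  case (Cons x c)
  define y where "y = bump R x"
  define R' where "R' = row_insert R x"
  have ex: "finite R" "\<exists>r\<in>R. x < r" and cp: "can_pass R' c" using Cons.prems(1) by (auto simp: R'_def)
  note y = bump[OF ex, folded y_def]
  have fin': "finite R'" using ex by (simp add: R'_def)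
  have step: "mset (filter (\<lambda>z. M < z) (y # row R')) = mset (filter (\<lambda>z. M < z) (x # row R))"
  proof (cases "x \<in> R")
    case True
    then have "x + 1 \<in> R" using reduced_row_mem[OF Cons.prems(2) ex(1)] by blast
    then have yx: "y = x + 1" unfolding y_def using bump_mem ex(1) by blast
    have "\<not> M < x" using Cons.prems(4) True ex(1) by (auto split: if_splits)
    moreover have "x \<noteq> M" using \<open>x + 1 \<in> R\<close> Cons.prems(3) by auto
    ultimately show ?thesis using True yx by (simp add: R'_def row_insert_def)
  next
    case False
    then have "R' = insert x (R - {y})" by (simp add: R'_def row_insert_def y_def)
    then have "mset_set R' = add_mset x (mset_set (R - {y}))" using ex(1) False by simp
    moreover have "mset_set R = add_mset y (mset_set (R - {y}))" using ex(1) y(1) by (simp add: mset_set.remove)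
    ultimately have "mset (y # row R') = mset (x # row R)" using ex(1) fin' by (simp add: mset_row)
    then show ?thesis by (metis mset_filter)
  qed
  have "reduced (row R @ [x] @ c)" using Cons.prems(2) by simp
  then have red: "reduced (row R' @ c)" using reduced_final(2)[of R "[x]" c] ex by (simp add: R'_def)
  have n: "M + 1 \<notin> R' \<union> set c" using Cons.prems(3) by (auto simp: R'_def row_insert_def)
  have a1: "mset (filter (\<lambda>z. M < z) (h # l1 @ l2)) = mset (filter (\<lambda>z. M < z) (h # l2)) + mset (filter (\<lambda>z. M < z) l1)"
    for h and l1 l2 :: "int list" by simp
  have e: "mset (filter (\<lambda>z. M < z) (y # c @ row R')) = mset (filter (\<lambda>z. M < z) (x # c @ row R))"
    unfolding a1 step ..
  have "distinct (filter (\<lambda>z. M < z) (x # c @ row R))" using Cons.prems(4) by simp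
  then have "distinct (filter (\<lambda>z. M < z) (y # c @ row R'))"
    by (simp only: mset_eq_imp_distinct_iff[OF e])
  then have "distinct (filter (\<lambda>z. M < z) (c @ row R'))" by (auto split: if_splits)
  note IH = Cons.IH[OF cp red n this]
  have a2: "mset (filter (\<lambda>z. M < z) (h # l)) = mset (filter (\<lambda>z. M < z) [h]) + mset (filter (\<lambda>z. M < z) l)"
    for h and l :: "int list" by simp
  have "mset (filter (\<lambda>z. M < z) (y # outs R' c @ row (final R' c))) = mset (filter (\<lambda>z. M < z) (x # c @ row R))"
    unfolding e[symmetric] by (subst (1 2) a2) (simp only: IH)
  then show ?case by (simp only: outs.simps final.simps append_Cons y_def R'_def)
qed simp

text \<open>
  Every pass through a fresh frame traps one of the letters up to \<open>M\<close> in the row, and the frame letters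
  that replace them are pairwise at distance at least 2. The number \<open>k\<close> bounds the letters still to be
  replaced. The empty place \<open>M + 1\<close> keeps the small letters apart from the large ones.
\<close>

definition stage :: "int \<Rightarrow> nat \<Rightarrow> nat \<Rightarrow> int \<Rightarrow> int set list \<Rightarrow> bool" where
  "stage M N k B a \<longleftrightarrow> (\<forall>u\<in>set a. finite u) \<and> reduced (word a) \<and> length (word a) = N \<and> M \<le> B \<and>
     (\<forall>z\<in>set (word a). z \<le> B \<and> z \<noteq> M + 1) \<and> distinct (filter (\<lambda>z. M < z) (word a)) \<and>
     spaced {z \<in> set (word a). M < z} \<and> length (filter (\<lambda>z. z \<le> M) (word a)) \<le> k"

lemma spaced_subset: "spaced S \<Longrightarrow> T \<subseteq> S \<Longrightarrow> spaced T"
  unfolding spaced_def by blast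

lemma stage_passable:
  assumes "stage M N k B a" shows "passable (frame B N) a"
proof -
  define c where "c = word a"
  have c: "reduced c" "length c = N" "\<forall>z\<in>set c. z \<le> B" using assms by (auto simp: stage_def c_def)
  have "{r \<in> frame B N. B < r} = frame B N" using frame_bounds by force
  then have "can_pass (frame B N) c" using c card_frame by (intro can_pass_card[of _ _ B]) auto
  moreover have "reduced (row (frame B N) @ c)"
  proof (rule reduced_append_far[OF c(1)])
    show "\<forall>i\<in>set (row (frame B N)). \<forall>j\<in>set c. 2 \<le> \<bar>i - j\<bar>"
    proof (intro ballI)
      fix i j assume "i \<in> set (row (frame B N))" "j \<in> set c"
      then have "B + 2 \<le> i" "j \<le> B" using c(3) frame_bounds[of i B N] by auto
      then show "2 \<le> \<bar>i - j\<bar>" by simp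
    qed
  qed (simp_all add: spaced_frame)
  ultimately show ?thesis using assms by (simp add: passable_def stage_def c_def)
qed

lemma stage_step:
  assumes "stage M N (Suc k) B a"
  shows "stage M N k (B + 2 * int N) (passes (frame B N) a)"
proof -
  define c where "c = word a"
  define F where "F = frame B N"
  define R where "R = final F c"
  define w where "w = outs F c"
  have c: "reduced c" "length c = N" "M \<le> B" "\<forall>z\<in>set c. z \<le> B \<and> z \<noteq> M + 1"
    "distinct (filter (\<lambda>z. M < z) c)" "spaced {z \<in> set c. M < z}" "length (filter (\<lambda>z. z \<le> M) c) \<le> Suc k"
    using assms by (auto simp: stage_def c_def)
  have pa: "can_pass F c" "reduced (row F @ c)"
    using stage_passable[OF assms] by (auto simp: passable_def F_def c_def)
  have Fb: "B + 2 \<le> z" "z \<le> B + 2 * int N" if "z \<in> F" for z using frame_bounds that by (auto simp: F_def)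
  have finF: "finite F" by (simp add: F_def)
  have finR: "finite R" unfolding R_def using pa(1) by (rule can_pass_final)
  have nF: "M + 1 \<notin> F \<union> set c" using Fb[of "M + 1"] c(3,4) by auto
  have bigF: "filter (\<lambda>z. M < z) (row F) = row F"
  proof (rule filter_True)
    show "\<forall>z\<in>set (row F). M < z" using Fb c(3) finF by fastforce
  qed
  have "set c \<inter> F = {}" using Fb c(4) by fastforce
  then have d: "distinct (filter (\<lambda>z. M < z) (c @ row F))" using c(5) bigF finF by auto
  note E = outs_big[OF pa nF d, folded w_def R_def]
  have dw: "distinct (filter (\<lambda>z. M < z) (w @ row R))" using d E mset_eq_imp_distinct_iff by blast
  have "set (filter (\<lambda>z. M < z) (w @ row R)) = set (filter (\<lambda>z. M < z) (c @ row F))"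
    using E by (rule mset_eq_setD)
  then have sub: "{z \<in> set w. M < z} \<subseteq> {z \<in> set c. M < z} \<union> F" using finF finR by auto
  have sp: "spaced ({z \<in> set c. M < z} \<union> F)"
    unfolding spaced_def
  proof (intro ballI impI)
    fix x y assume x: "x \<in> {z \<in> set c. M < z} \<union> F" and y: "y \<in> {z \<in> set c. M < z} \<union> F" and ne: "x \<noteq> y"
    consider "x \<in> {z \<in> set c. M < z}" "y \<in> {z \<in> set c. M < z}" | "x \<in> F" "y \<in> F"
      | "x \<in> set c" "y \<in> F" | "x \<in> F" "y \<in> set c" using x y by auto
    then show "2 \<le> \<bar>x - y\<bar>"
    proof cases
      case 1
      then show ?thesis using c(6) ne unfolding spaced_def by blast
    next
      case 2
      then show ?thesis using spaced_frame[of B N] ne unfolding spaced_def F_def by blast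
    next
      case 3
      then have "x \<le> B" "B + 2 \<le> y" using c(4) Fb by auto
      then show ?thesis by simp
    next
      case 4
      then have "y \<le> B" "B + 2 \<le> x" using c(4) Fb by auto
      then show ?thesis by simp
    qed
  qed
  \<comment> \<open>The row keeps its length and the number of large letters in word and row
    together is constant. So the word loses exactly as many small letters as are trapped in the row,
    at least one by \<open>final_small\<close> if there were any.\<close>
  have len: "length (filter (\<lambda>z. z \<le> M) w) \<le> k"
  proof -
    have split: "length (filter (\<lambda>z. z \<le> M) l) + length (filter (\<lambda>z. M < z) l) = length l" for l :: "int list"
      using sum_length_filter_compl[of "\<lambda>z. z \<le> M" l] by (simp add: not_le)
    have "length (filter (\<lambda>z. M < z) (w @ row R)) = length (filter (\<lambda>z. M < z) (c @ row F))"
      using E by (metis size_mset)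
    moreover have "length w = length c" by (simp add: w_def)
    moreover have "length (row R) = length (row F)" unfolding R_def using card_final[OF pa(1)] by simp
    ultimately have eq: "length (filter (\<lambda>z. z \<le> M) w) + length (filter (\<lambda>z. z \<le> M) (row R)) = length (filter (\<lambda>z. z \<le> M) c)"
      using split[of w] split[of "row R"] split[of c] bigF by simp
    show ?thesis
    proof (cases "\<exists>z\<in>set c. z \<le> M")
      case True
      then have "\<exists>z\<in>R. z \<le> M" unfolding R_def using final_small[OF pa(1), of M] by blast
      then have "filter (\<lambda>z. z \<le> M) (row R) \<noteq> []" using finR by (auto simp: filter_empty_conv)
      then have "length (filter (\<lambda>z. z \<le> M) (row R)) \<ge> 1" by (cases "filter (\<lambda>z. z \<le> M) (row R)") auto
      then show ?thesis using eq c(7) by simp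
    next
      case False
      then have "filter (\<lambda>z. z \<le> M) c = []" by (auto simp: filter_empty_conv)
      then show ?thesis using eq by simp
    qed
  qed
  have W: "word (passes F a) = w" using word_passes[of F a] pa(1) by (simp add: c_def w_def)
  have bd: "\<forall>z\<in>set w. z \<le> B + 2 * int N \<and> z \<noteq> M + 1"
  proof
    fix z assume z: "z \<in> set w"
    show "z \<le> B + 2 * int N \<and> z \<noteq> M + 1"
    proof (cases "M < z")
      case True
      then have "z \<in> set c \<or> z \<in> F" using sub z by auto
      then show ?thesis using c(4) Fb[of z] nF by fastforce
    next
      case False
      then show ?thesis using c(3) by auto
    qed
  qed
  have "reduced w" unfolding w_def using reduced_outs[OF pa] .
  then show ?thesis
    unfolding stage_def F_def[symmetric] W
    using finite_passes[of F a] c(2,3) bd dw spaced_subset[OF sp sub] len by (simp add: w_def)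
qed

fun spread :: "nat \<Rightarrow> nat \<Rightarrow> int \<Rightarrow> int set list \<Rightarrow> int set list" where
  "spread 0 N B a = a"
| "spread (Suc k) N B a = spread k N (B + 2 * int N) (passes (frame B N) a)"

text \<open>The final rows, which are exactly the information lost by the passes.\<close>

fun trace :: "nat \<Rightarrow> nat \<Rightarrow> int \<Rightarrow> int set list \<Rightarrow> int set list" where
  "trace 0 N B a = []"
| "trace (Suc k) N B a = final (frame B N) (word a) # trace k N (B + 2 * int N) (passes (frame B N) a)"

lemma stage_spread:
  assumes "stage M N k B a"
  shows "\<exists>B'. stage M N 0 B' (spread k N B a)" "map card (spread k N B a) = map card a"
proof -
  have "(\<exists>B'. stage M N 0 B' (spread k N B a)) \<and> map card (spread k N B a) = map card a"
    using assms
  proof (induction k arbitrary: B a)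
    case (Suc k)
    have "can_pass (frame B N) (word a)" using stage_passable[OF Suc.prems] by (simp add: passable_def)
    then show ?case using Suc.IH[OF stage_step[OF Suc.prems]] card_passes[of "frame B N" a] by simp
  qed auto
  then show "\<exists>B'. stage M N 0 B' (spread k N B a)" "map card (spread k N B a) = map card a" by auto
qed

lemma spread_op:
  assumes "opr = raise \<or> opr = lower" "stage M N k B a" "1 \<le> i" "i < length a"
  shows "op_at opr i (spread k N B a) = map_option (spread k N B) (op_at opr i a) \<and>
    (\<forall>b. op_at opr i a = Some b \<longrightarrow> trace k N B b = trace k N B a)"
  using assms(2-)
proof (induction k arbitrary: B a)
  case 0
  then show ?case by (cases "op_at opr i a") simp_all
next
  case (Suc k)
  define F where "F = frame B N"
  note pa = stage_passable[OF Suc.prems(1), folded F_def]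
  note P = passes_op[OF assms(1) pa Suc.prems(2,3)]
  have IH: "op_at opr i (spread k N (B + 2 * int N) (passes F a)) =
      map_option (spread k N (B + 2 * int N)) (op_at opr i (passes F a)) \<and>
    (\<forall>b. op_at opr i (passes F a) = Some b \<longrightarrow> trace k N (B + 2 * int N) b = trace k N (B + 2 * int N) (passes F a))"
    using Suc.prems stage_step[OF Suc.prems(1)] by (intro Suc.IH) (simp_all add: F_def)
  show ?case
  proof (cases "op_at opr i a")
    case None
    then show ?thesis using IH P(1) by (simp add: F_def)
  next
    case (Some b)
    then show ?thesis using IH P(1) P(2)[OF Some] by (simp add: F_def)
  qed
qed

lemma spread_inj:
  assumes "stage M N k B a" "stage M N k B b" "spread k N B a = spread k N B b" "trace k N B a = trace k N B b"
  shows "a = b"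
  using assms
proof (induction k arbitrary: B a b)
  case (Suc k)
  have t: "final (frame B N) (word a) = final (frame B N) (word b)"
    "trace k N (B + 2 * int N) (passes (frame B N) a) = trace k N (B + 2 * int N) (passes (frame B N) b)"
    "spread k N (B + 2 * int N) (passes (frame B N) a) = spread k N (B + 2 * int N) (passes (frame B N) b)"
    using Suc.prems(3,4) by simp_all
  have "passes (frame B N) a = passes (frame B N) b"
    by (rule Suc.IH[OF stage_step[OF Suc.prems(1)] stage_step[OF Suc.prems(2)] t(3,2)])
  then show ?case
    by (rule passes_inj[OF stage_passable[OF Suc.prems(1)] stage_passable[OF Suc.prems(2)] _ t(1)])
qed simp

subsection \<open>Reading words with distinct letters\<close>

text \<open>Indices start at 1, like the entries of the standard crystal. A letter in no factor
  receives \<open>length a + 1\<close>.\<close>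

fun factor_index :: "int set list \<Rightarrow> int \<Rightarrow> nat" where
  "factor_index [] z = 1"
| "factor_index (u # a) z = (if z \<in> u then 1 else Suc (factor_index a z))"

definition reading :: "int set list \<Rightarrow> nat list" where
  "reading a = map (factor_index a) (dec (set (word a)))"

lemma factor_index_pos: "factor_index a z \<ge> 1"
  by (cases a) auto

lemma factor_index_fiber:
  assumes "distinct (word a)" "\<forall>u\<in>set a. finite u" "j < length a"
  shows "{z \<in> set (word a). factor_index a z = Suc j} = a ! j"
  using assms
proof (induction a arbitrary: j)
  case (Cons u a)
  have disj: "u \<inter> set (word a) = {}" and d: "distinct (word a)" using Cons.prems by auto
  have fu: "set (dec u) = u" using Cons.prems by simp
  show ?case
  proof (cases j)
    case 0
    have n0: "factor_index a z = 0 \<longleftrightarrow> False" for z using factor_index_pos[of a z] by simp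
    show ?thesis using 0 fu by (auto simp: n0 split: if_splits)
  next
    case (Suc j')
    have IH: "{z \<in> set (word a). factor_index a z = Suc j'} = a ! j'"
      using Cons d Suc by auto
    have "{z \<in> set (word (u # a)). factor_index (u # a) z = Suc j} = {z \<in> set (word a). factor_index a z = Suc j'}"
      using Suc fu disj by auto
    then show ?thesis using IH Suc by simp
  qed
qed simp

lemma factor_index_le:
  assumes "z \<in> set (word a)" "\<forall>u\<in>set a. finite u"
  shows "factor_index a z \<le> length a"
  using assms by (induction a) auto

lemma factor_index_eq:
  assumes "distinct (word a)" "\<forall>u\<in>set a. finite u" "j < length a" "z \<in> a ! j"
  shows "factor_index a z = Suc j"
  using factor_index_fiber[OF assms(1-3)] assms(4) by blast

lemma reading_raise:
  assumes d: "distinct (word a)" and red: "reduced (word a)" and fin: "\<forall>u\<in>set a. finite u" and i: "1 \<le> i" "i < length a"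
    and r: "op_at raise i a = Some b"
  shows "tensor_e i (reading a) = Some (reading b)" "set (word b) = set (word a)" "distinct (word b)"
proof -
  define S where "S = set (word a)"
  obtain U V where UV: "raise (a ! (i - 1)) (a ! i) = Some (U, V)" "b = a[i - 1 := U, i := V]"
    using r by (auto simp: op_at_def)
  note F = op_at_facts[OF disjI1[OF refl] fin red i r]
  have u: "{y \<in> S. factor_index a y = i} = a ! (i - 1)" and v: "{y \<in> S. factor_index a y = Suc i} = a ! i"
    using factor_index_fiber[OF d fin, of "i - 1"] factor_index_fiber[OF d fin, of i] i by (auto simp: S_def)
  obtain x where x: "x \<in> a ! i" "U = insert x (a ! (i - 1))" "V = a ! i - {x}"
    "tensor_e i (map (factor_index a) (dec S)) = Some (map ((factor_index a)(x := i)) (dec S))"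
    using tensor_e_raise(2)[of S "factor_index a" i U V] UV(1) unfolding u v by (auto simp: S_def)
  show Sb: "set (word b) = set (word a)" using ck_set[OF F(2)] by simp
  \<comment> \<open>Distinctness survives because the operator preserves both the set of letters and
    the length of the word.\<close>
  have "card (set (word b)) = length (word b)"
    using Sb d ck_length[OF F(2)] by (simp add: distinct_card)
  then show db: "distinct (word b)" by (rule card_distinct)
  have "factor_index b z = ((factor_index a)(x := i)) z" if "z \<in> S" for z
  proof (cases "z = x")
    case True
    have "x \<in> b ! (i - 1)" using i by (simp add: UV(2) x(2))
    then show ?thesis using factor_index_eq[OF db F(1), of "i - 1" x] i True F(3) by simp
  next
    case False
    obtain j where j: "j < length a" "z \<in> a ! j"
      using \<open>z \<in> S\<close> fin by (auto simp: S_def set_word in_set_conv_nth)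
    then have "z \<in> b ! j" using False i by (auto simp: UV(2) x(2,3) nth_list_update)
    then show ?thesis
      using factor_index_eq[OF db F(1), of j z] factor_index_eq[OF d fin j] j F(3) False by simp
  qed
  then have "reading b = map ((factor_index a)(x := i)) (dec S)"
    unfolding reading_def Sb S_def[symmetric] by (simp add: S_def)
  then show "tensor_e i (reading a) = Some (reading b)" using x(4) by (simp add: reading_def S_def)
qed

lemma reading_ops:
  assumes d: "distinct (word a)" and red: "reduced (word a)" and fin: "\<forall>u\<in>set a. finite u" and i: "1 \<le> i" "i < length a"
  shows "tensor_e i (reading a) = map_option reading (op_at raise i a)"
    and "tensor_f i (reading a) = map_option reading (op_at lower i a)"
    and "op_at lower i a = Some b \<Longrightarrow> set (word b) = set (word a)"
proof -
  define S where "S = set (word a)"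
  have u: "{y \<in> S. factor_index a y = i} = a ! (i - 1)" and v: "{y \<in> S. factor_index a y = Suc i} = a ! i"
    using factor_index_fiber[OF d fin, of "i - 1"] factor_index_fiber[OF d fin, of i] i by (auto simp: S_def)
  have finS: "finite S" by (simp add: S_def)
  show "tensor_e i (reading a) = map_option reading (op_at raise i a)"
  proof (cases "op_at raise i a")
    case None
    then have "raise (a ! (i - 1)) (a ! i) = None" by (simp add: op_at_def)
    then show ?thesis
      using tensor_e_raise(1)[OF finS, of "factor_index a" i] None unfolding u v by (simp add: reading_def S_def)
  next
    case (Some b)
    then show ?thesis using reading_raise[OF d red fin i Some] by simp
  qed
  \<comment> \<open>Lowering is undone by raising, so \<open>reading_raise\<close> applies to the
    result \<open>b\<close>, and \<open>tensor_e_f\<close> reverses the arrow.\<close>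
  have L: "tensor_f i (reading a) = Some (reading b) \<and> set (word b) = set (word a)" if l: "op_at lower i a = Some b" for b
  proof -
    note F = op_at_facts[OF disjI2[OF refl] fin red i l]
    have redb: "reduced (word b)" using ck_reduced[OF F(2)] red by blast
    have Sb: "set (word b) = set (word a)" using ck_set[OF F(2)] by simp
    have "card (set (word b)) = length (word b)"
      using Sb d ck_length[OF F(2)] by (simp add: distinct_card)
    then have db: "distinct (word b)" by (rule card_distinct)
    obtain p u v s where a: "a = p @ u # v # s" "i = Suc (length p)" using factor_split[OF i] .
    then obtain U V where UV: "lower u v = Some (U, V)" "b = p @ U # V # s"
      using l unfolding a op_at_split by auto
    have "reduced (word p @ (dec u @ dec v) @ word s)" using red by (simp add: a)
    then have "reduced (dec u @ dec v)" by (rule reduced_middleD)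
    then have "raise U V = Some (u, v)" using fin UV(1) by (intro raise_lower) (simp_all add: a)
    then have r: "op_at raise i b = Some a" unfolding UV(2) a op_at_split by simp
    have "i < length b" using i F(3) by simp
    then have "tensor_e i (reading b) = Some (reading a)"
      using reading_raise(1)[OF db redb F(1) i(1) _ r] by simp
    then show ?thesis using Sb by (simp add: tensor_e_f)
  qed
  show "tensor_f i (reading a) = map_option reading (op_at lower i a)"
  proof (cases "op_at lower i a")
    case None
    then have "lower (a ! (i - 1)) (a ! i) = None" by (simp add: op_at_def)
    then show ?thesis
      using tensor_f_lower_None[OF finS, of "factor_index a" i] None unfolding u v by (simp add: reading_def S_def)
  next
    case (Some b)
    then show ?thesis using L by simp
  qed
  show "op_at lower i a = Some b \<Longrightarrow> set (word b) = set (word a)" using L by blast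
qed

lemma reading_inj:
  assumes "distinct (word a)" "\<forall>u\<in>set a. finite u" "distinct (word b)" "\<forall>u\<in>set b. finite u"
    and "length a = length b" "set (word a) = set (word b)" "reading a = reading b"
  shows "a = b"
proof (rule nth_equalityI)
  fix j assume j: "j < length a"
  have "factor_index a z = factor_index b z" if "z \<in> set (word a)" for z
    using assms(6,7) that by (simp add: reading_def)
  then have "{z \<in> set (word a). factor_index a z = Suc j} = {z \<in> set (word b). factor_index b z = Suc j}"
    using assms(6) by auto
  then show "a ! j = b ! j"
    using factor_index_fiber[OF assms(1,2) j] factor_index_fiber[OF assms(3,4), of j] j assms(5) by simp
qed (rule assms(5))

lemma reading_wt:
  assumes "distinct (word a)" "\<forall>u\<in>set a. finite u" "1 \<le> j" "j \<le> length a"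
  shows "(\<Sum>x\<leftarrow>reading a. if x = j then 1 else 0) = int (card (a ! (j - 1)))"
proof -
  have count: "(\<Sum>x\<leftarrow>map f l. if x = j then 1 else 0) = int (card {z \<in> set l. f z = j})" if "distinct l" for f and l :: "int list"
    using that
  proof (induction l)
    case (Cons y l)
    have "{z \<in> set (y # l). f z = j} = (if f y = j then insert y {z \<in> set l. f z = j} else {z \<in> set l. f z = j})" by auto
    then show ?case using Cons by auto
  qed simp
  have "(\<Sum>x\<leftarrow>reading a. if x = j then 1 else 0) = int (card {z \<in> set (word a). factor_index a z = j})"
    unfolding reading_def by (subst count) simp_all
  then show ?thesis using factor_index_fiber[OF assms(1,2), of "j - 1"] assms(3,4) by simp
qed

theorem tensor_embedding:
  assumes finX: "finite X" and X: "\<And>a. a \<in> X \<Longrightarrow> length a = n \<and> (\<forall>u\<in>set a. finite u) \<and> reduced (word a) \<and> length (word a) = N"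
  obtains \<Phi> :: "int set list \<Rightarrow> nat list" and I :: "int set list \<Rightarrow> int set list"
  where "\<And>a. a \<in> X \<Longrightarrow> \<Phi> a \<in> elems (tensor_power n N)"
    and "\<And>a j. a \<in> X \<Longrightarrow> j \<in> {1..n} \<Longrightarrow> wt (tensor_power n N) (\<Phi> a) j = int (card (a ! (j - 1)))"
    and "\<And>a i. a \<in> X \<Longrightarrow> i \<in> {1..<n} \<Longrightarrow> tensor_e i (\<Phi> a) = map_option \<Phi> (op_at raise i a)"
    and "\<And>a i. a \<in> X \<Longrightarrow> i \<in> {1..<n} \<Longrightarrow> tensor_f i (\<Phi> a) = map_option \<Phi> (op_at lower i a)"
    and "\<And>a b i. a \<in> X \<Longrightarrow> i \<in> {1..<n} \<Longrightarrow> op_at raise i a = Some b \<or> op_at lower i a = Some b \<Longrightarrow> I b = I a"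
    and "\<And>a b. a \<in> X \<Longrightarrow> b \<in> X \<Longrightarrow> \<Phi> a = \<Phi> b \<Longrightarrow> I a = I b \<Longrightarrow> a = b"
proof -
  have "finite (\<Union> (set ` word ` X))" using finX by auto
  \<comment> \<open>One bound for all of \<open>X\<close>, so that the same frames serve every
    element and the results are comparable.\<close>
  then obtain M where M: "\<And>a z. a \<in> X \<Longrightarrow> z \<in> set (word a) \<Longrightarrow> z \<le> M" by (metis Max_ge UN_I imageI)
  \<comment> \<open>\<open>N\<close> passes are enough: a word has \<open>N\<close> letters, and
    every pass reduces the number of letters up to \<open>M\<close> until none is left.\<close>
  define sp where "sp = spread N N M"
  \<comment> \<open>The reading records only factor indices, so the set of letters is kept along
    with the trace.\<close>
  define I where "I a = set (word (sp a)) # trace N N M a" for a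
  have st: "stage M N N M a" if "a \<in> X" for a
  proof -
    have le: "\<forall>z\<in>set (word a). z \<le> M" using M that by blast
    then have "filter (\<lambda>z. M < z) (word a) = []" by (auto simp: filter_empty_conv)
    moreover have "{z \<in> set (word a). M < z} = {}" using le by auto
    ultimately show ?thesis using X[OF that] le by (auto simp: stage_def spaced_def)
  qed
  have spd: "distinct (word (sp a))" "\<forall>u\<in>set (sp a). finite u" "reduced (word (sp a))" "length (word (sp a)) = N"
    "map card (sp a) = map card a" "length (sp a) = n" if "a \<in> X" for a
  proof -
    obtain B' where B: "stage M N 0 B' (sp a)" using stage_spread(1)[OF st[OF \<open>a \<in> X\<close>]] by (auto simp: sp_def)
    then have "filter (\<lambda>z. z \<le> M) (word (sp a)) = []" by (simp add: stage_def)
    then have "filter (\<lambda>z. M < z) (word (sp a)) = word (sp a)" by (intro filter_True) (auto simp: filter_empty_conv)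
    then show "distinct (word (sp a))" "\<forall>u\<in>set (sp a). finite u" "reduced (word (sp a))" "length (word (sp a)) = N"
      using B by (simp_all add: stage_def)
    show mc: "map card (sp a) = map card a" using stage_spread(2)[OF st[OF that]] by (simp add: sp_def)
    show "length (sp a) = n" using arg_cong[OF mc, of length] X[OF that] by simp
  qed
  have SO: "op_at opr i (sp a) = map_option sp (op_at opr i a) \<and>
    (\<forall>b. op_at opr i a = Some b \<longrightarrow> trace N N M b = trace N N M a)"
    if "opr = raise \<or> opr = lower" "a \<in> X" "i \<in> {1..<n}" for opr i a
    using spread_op[OF that(1) st[OF that(2)], of i] that(3) X[OF that(2)] by (simp add: sp_def)
  have RO: "tensor_e i (reading (sp a)) = map_option reading (op_at raise i (sp a))"
    "tensor_f i (reading (sp a)) = map_option reading (op_at lower i (sp a))"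
    if "a \<in> X" "i \<in> {1..<n}" for a i
    using reading_ops(1,2)[OF spd(1,3,2)[OF that(1)], of i] that(2) spd(6)[OF that(1)] by simp_all
  show ?thesis
  proof (rule that[of "reading \<circ> sp" I])
    fix a assume a: "a \<in> X"
    note sa = spd[OF a]
    have "length (reading (sp a)) = N" using sa(1,4) by (simp add: reading_def distinct_card)
    moreover have "set (reading (sp a)) \<subseteq> {1..n}"
      using factor_index_pos factor_index_le[OF _ sa(2)] sa(6) by (auto simp: reading_def)
    ultimately show "(reading \<circ> sp) a \<in> elems (tensor_power n N)" by (simp add: tensor_power_def)
    fix j assume j: "j \<in> {1..n}"
    have "card (sp a ! (j - 1)) = card (a ! (j - 1))"
    proof -
      have "j - 1 < length (sp a)" "j - 1 < length a" using j sa(6) X[OF a] by auto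
      then show ?thesis using nth_map[of "j - 1" "sp a" card] nth_map[of "j - 1" a card] sa(5) by simp
    qed
    then show "wt (tensor_power n N) ((reading \<circ> sp) a) j = int (card (a ! (j - 1)))"
      using reading_wt[OF sa(1,2), of j] j sa(6) by (simp add: tensor_power_def)
  next
    fix a i assume a: "a \<in> X" "i \<in> {1..<n}"
    show "tensor_e i ((reading \<circ> sp) a) = map_option (reading \<circ> sp) (op_at raise i a)"
      using RO(1)[OF a] SO[OF disjI1[OF refl] a] by (simp add: option.map_comp)
    show "tensor_f i ((reading \<circ> sp) a) = map_option (reading \<circ> sp) (op_at lower i a)"
      using RO(2)[OF a] SO[OF disjI2[OF refl] a] by (simp add: option.map_comp)
  next
    fix a b i assume a: "a \<in> X" "i \<in> {1..<n}" and b: "op_at raise i a = Some b \<or> op_at lower i a = Some b"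
    note sa = spd[OF a(1)]
    have "1 \<le> i" "i < length (sp a)" using a(2) sa(6) by auto
    note RR = reading_raise(2)[OF sa(1,3,2) this] reading_ops(3)[OF sa(1,3,2) this]
    from b show "I b = I a"
    proof
      assume "op_at raise i a = Some b"
      then show ?thesis using SO[OF disjI1[OF refl] a] RR(1)[of "sp b"] by (simp add: I_def)
    next
      assume "op_at lower i a = Some b"
      then show ?thesis using SO[OF disjI2[OF refl] a] RR(2)[of "sp b"] by (simp add: I_def)
    qed
  next
    fix a b assume ab: "a \<in> X" "b \<in> X" "(reading \<circ> sp) a = (reading \<circ> sp) b" "I a = I b"
    have "sp a = sp b"
      using ab spd[OF ab(1)] spd[OF ab(2)] by (intro reading_inj) (simp_all add: I_def)
    then show "a = b" using ab(4) by (intro spread_inj[OF st[OF ab(1)] st[OF ab(2)]]) (simp_all add: I_def sp_def)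
  qed
qed

subsection \<open>Primed letters\<close>

definition letter :: "int \<Rightarrow> bool \<Rightarrow> rat" where
  "letter k b = of_int k - (if b then 1 / 2 else 0)"

lemma ceiling_letter [simp]: "\<lceil>letter k b\<rceil> = k"
  by (auto simp: letter_def ceiling_eq_iff)

lemma letter_primed [simp]: "letter k b \<in> primed_ints \<longleftrightarrow> b"
proof
  assume "letter k b \<in> primed_ints"
  then obtain m where m: "letter k b = of_int m - 1 / 2" by (auto simp: primed_ints_def)
  show b
  proof (rule ccontr)
    assume "\<not> b"
    then have "(of_int (2 * k) :: rat) = of_int (2 * m - 1)" using m by (simp add: letter_def field_simps)
    then have "2 * k = 2 * m - 1" by (rule of_int_eq_iff[THEN iffD1])
    then show False by presburger
  qed
qed (auto simp: letter_def primed_ints_def)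

lemma letter_ceiling:
  assumes "x \<in> \<int> \<union> primed_ints" shows "letter \<lceil>x\<rceil> (x \<in> primed_ints) = x"
proof -
  obtain m where "x = of_int m \<or> x = of_int m - 1 / 2" using assms by (auto simp: primed_ints_def elim: Ints_cases)
  then have "x = letter m False \<or> x = letter m True" by (simp add: letter_def)
  then show ?thesis by (metis ceiling_letter letter_primed)
qed

lemma letter_in: "letter k b \<in> \<int> \<union> primed_ints"
proof (cases b)
  case False
  then show ?thesis by (simp add: letter_def)
qed simp

lemma letter_inject [simp]: "letter k b = letter k' b' \<longleftrightarrow> k = k' \<and> b = b'"
proof
  assume e: "letter k b = letter k' b'"
  show "k = k' \<and> b = b'" using ceiling_letter[of k b] letter_primed[of k b] unfolding e by simp
qed simp

lemma toggle_letter [simp]: "toggle_prime (letter k b) = letter k (\<not> b)"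
  unfolding toggle_prime_def letter_primed by (cases b) (simp_all add: letter_def)

lemma letter_add: "letter k b + of_nat q = letter (k + int q) b"
  by (simp add: letter_def)

lemma letter_diff: "letter k b - of_nat q = letter (k - int q) b"
  by (simp add: letter_def)

lemma letter_less: "k < k' \<Longrightarrow> letter k b < letter k' b'"
proof -
  assume "k < k'"
  then have "(of_int k :: rat) + 1 \<le> of_int k'" by (metis of_int_1 of_int_add of_int_le_iff zless_imp_add1_zle)
  then show ?thesis by (simp add: letter_def)
qed

lemma strict_mono_letter: "strict_mono (\<lambda>k. letter k (p k))"
  by (rule strict_monoI) (rule letter_less)

lemma inj_letter: "inj (\<lambda>k. letter k (p k))"
  by (rule injI) simp

definition primed :: "int set \<Rightarrow> (int \<Rightarrow> bool) \<Rightarrow> rat list" where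
  "primed S p = map (\<lambda>k. letter k (p k)) (dec S)"

lemma map_ceiling_primed [simp]: "map ceiling (primed S p) = dec S"
  by (simp add: primed_def comp_def)

lemma set_primed: "finite S \<Longrightarrow> set (primed S p) = (\<lambda>k. letter k (p k)) ` S"
  by (simp add: primed_def)

lemma ceiling_set_primed: "finite S \<Longrightarrow> ceiling ` set (primed S p) = S"
  by (simp add: set_primed image_image)

lemma primed_cong: "finite S \<Longrightarrow> (\<And>k. k \<in> S \<Longrightarrow> p k = p' k) \<Longrightarrow> primed S p = primed S p'"
  by (simp add: primed_def)

lemma primed_repr:
  assumes "sorted_wrt (>) (map ceiling u)" "primed_word u"
  shows "u = primed (ceiling ` set u) (\<lambda>k. letter k True \<in> set u)"
proof -
  have "dec (ceiling ` set u) = map ceiling u" using assms(1) by (intro dec_eqI) auto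
  moreover have inj: "inj_on ceiling (set u)"
    using assms(1) by (metis distinct_map sorted_wrt_rev strict_sorted_iff distinct_rev rev_map sorted_wrt_map)
  moreover have "letter \<lceil>x\<rceil> (letter \<lceil>x\<rceil> True \<in> set u) = x" if x: "x \<in> set u" for x
  proof -
    have eq: "letter \<lceil>x\<rceil> (x \<in> primed_ints) = x"
      using assms(2) x by (intro letter_ceiling) (auto simp: primed_word_def)
    have "letter \<lceil>x\<rceil> True \<in> set u \<longleftrightarrow> x \<in> primed_ints"
    proof
      assume "letter \<lceil>x\<rceil> True \<in> set u"
      then have "letter \<lceil>x\<rceil> True = x" using inj_onD[OF inj, of "letter \<lceil>x\<rceil> True" x] x by simp
      then show "x \<in> primed_ints" by (metis letter_primed)
    next
      assume "x \<in> primed_ints"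
      then show "letter \<lceil>x\<rceil> True \<in> set u" using eq x by simp
    qed
    then show ?thesis using eq by simp
  qed
  ultimately show ?thesis by (simp add: primed_def map_idI comp_def)
qed

subsection \<open>The pairing\<close>

fun int_pairing :: "int set \<Rightarrow> int list \<Rightarrow> (int \<times> int) set" where
  "int_pairing U [] = {}"
| "int_pairing U (c # cs) =
     (let B = {b \<in> U. b < c}
      in if B = {} then int_pairing U cs
         else insert (Max B, c) (int_pairing (U - {Max B}) cs))"

lemma pairing_from_letters:
  assumes "finite U"
  shows "pairing_from ((\<lambda>k. letter k (p k)) ` U) (map (\<lambda>k. letter k (r k)) cs) =
    (\<lambda>(b, c). (letter b (p b), letter c (r c))) ` int_pairing U cs"
  using assms
proof (induction cs arbitrary: U)
  case (Cons c cs)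
  let ?g = "\<lambda>k. letter k (p k)"
  define B where "B = {b \<in> U. b < c}"
  have B: "{b \<in> ?g ` U. \<lceil>b\<rceil> < \<lceil>letter c (r c)\<rceil>} = ?g ` B" by (auto simp: B_def)
  have finB: "finite B" using Cons.prems by (simp add: B_def)
  show ?case
  proof (cases "B = {}")
    case True
    then show ?thesis using Cons by (simp add: B[simplified] B_def[symmetric] Let_def del: pairing_from.simps(1))
  next
    case False
    have M: "Max (?g ` B) = ?g (Max B)"
      using strict_mono_mono[OF strict_mono_letter] finB False by (rule mono_Max_commute[symmetric])
    have D: "?g ` U - {?g (Max B)} = ?g ` (U - {Max B})" by auto
    have "finite (U - {Max B})" using Cons.prems by simp
    from Cons.IH[OF this] show ?thesis
      using False by (simp add: B[simplified] B_def[symmetric] Let_def M D)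
  qed
qed simp

text \<open>The properties of the pairing that control its unpaired letters, free of the order of
  treatment: it is a matching of letters of \<open>u\<close> with larger letters of
  \<open>v\<close>, no two unpaired letters could still be paired, no unpaired letter lies under an
  arc, and arcs are nested or disjoint.\<close>

definition greedy :: "int set \<Rightarrow> int set \<Rightarrow> (int \<times> int) set \<Rightarrow> bool" where
  "greedy u v P \<longleftrightarrow>
     (\<forall>b c. (b, c) \<in> P \<longrightarrow> b \<in> u \<and> c \<in> v \<and> b < c) \<and>
     (\<forall>b c b' c'. (b, c) \<in> P \<longrightarrow> (b', c') \<in> P \<longrightarrow> (b = b' \<longleftrightarrow> c = c')) \<and>
     (\<forall>b \<in> u. \<forall>c \<in> v. b < c \<longrightarrow> b \<in> fst ` P \<or> c \<in> snd ` P) \<and>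
     (\<forall>b c b'. (b, c) \<in> P \<longrightarrow> b' \<in> u \<longrightarrow> b < b' \<longrightarrow> b' < c \<longrightarrow> b' \<in> fst ` P) \<and>
     (\<forall>b c c'. (b, c) \<in> P \<longrightarrow> c' \<in> v \<longrightarrow> b < c' \<longrightarrow> c' < c \<longrightarrow> c' \<in> snd ` P) \<and>
     (\<forall>b c b' c'. (b, c) \<in> P \<longrightarrow> (b', c') \<in> P \<longrightarrow> b < c' \<longrightarrow> c' < c \<longrightarrow> b < b')"

lemma greedyD:
  assumes "greedy u v P"
  shows "(b, c) \<in> P \<Longrightarrow> b \<in> u \<and> c \<in> v \<and> b < c"
    and "(b, c) \<in> P \<Longrightarrow> (b', c') \<in> P \<Longrightarrow> b = b' \<longleftrightarrow> c = c'"
    and "b \<in> u \<Longrightarrow> c \<in> v \<Longrightarrow> b < c \<Longrightarrow> b \<in> fst ` P \<or> c \<in> snd ` P"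
    and "(b, c) \<in> P \<Longrightarrow> b' \<in> u \<Longrightarrow> b < b' \<Longrightarrow> b' < c \<Longrightarrow> b' \<in> fst ` P"
    and "(b, c) \<in> P \<Longrightarrow> c' \<in> v \<Longrightarrow> b < c' \<Longrightarrow> c' < c \<Longrightarrow> c' \<in> snd ` P"
    and "(b, c) \<in> P \<Longrightarrow> (b', c') \<in> P \<Longrightarrow> b < c' \<Longrightarrow> c' < c \<Longrightarrow> b < b'"
  using assms unfolding greedy_def by simp_all

text \<open>The smallest letter \<open>c\<close> is treated first and takes the largest letter
  \<open>m\<close> below it. Nothing of \<open>u\<close> lies under the new arc, and a later arc
  ends above \<open>c\<close>, so it either encloses the new arc or starts no earlier than
  \<open>c\<close>.\<close>

lemma greedy_int_pairing:
  assumes "finite U" "sorted_wrt (<) cs"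
  shows "greedy U (set cs) (int_pairing U cs)"
  using assms
proof (induction cs arbitrary: U)
  case Nil
  show ?case by (simp add: greedy_def)
next
  case (Cons c cs)
  define B where "B = {b \<in> U. b < c}"
  have lt: "c < z" if "z \<in> set cs" for z using Cons.prems that by simp
  have s: "sorted_wrt (<) cs" using Cons.prems by simp
  have finB: "finite B" using Cons.prems by (simp add: B_def)
  show ?case
  proof (cases "B = {}")
    case True
    define P where "P = int_pairing U cs"
    have P: "int_pairing U (c # cs) = P" using True by (simp add: B_def P_def)
    have IH: "greedy U (set cs) P" unfolding P_def by (rule Cons.IH[OF Cons.prems(1) s])
    note D = greedyD[OF IH]
    have ge: "c \<le> b" if "b \<in> U" for b using True that by (auto simp: B_def not_less[symmetric])
    show ?thesis
      unfolding P greedy_def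
    proof (intro conjI allI ballI impI)
      fix b z assume "(b, z) \<in> P"
      then show "b \<in> U" "z \<in> set (c # cs)" "b < z" using D(1) by simp_all
    next
      fix b z b' z' assume bz: "(b, z) \<in> P" "(b', z') \<in> P"
      then show "b = b' \<longleftrightarrow> z = z'" by (rule D(2))
      assume "b < z'" "z' < z"
      then show "b < b'" by (rule D(6)[OF bz])
    next
      fix b z assume bz: "b \<in> U" "z \<in> set (c # cs)" "b < z"
      then have "z \<in> set cs" using ge[of b] by auto
      then show "b \<in> fst ` P \<or> z \<in> snd ` P" using D(3) bz by blast
    next
      fix b z b' assume "(b, z) \<in> P" "b' \<in> U" "b < b'" "b' < z"
      then show "b' \<in> fst ` P" by (rule D(4))
    next
      fix b z z' assume bz: "(b, z) \<in> P" "z' \<in> set (c # cs)" "b < z'" "z' < z"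
      then have "z' \<in> set cs" using ge[of b] D(1)[OF bz(1)] by auto
      then show "z' \<in> snd ` P" using D(5) bz by blast
    qed
  next
    case False
    define m where "m = Max B"
    define P' where "P' = int_pairing (U - {m}) cs"
    define P where "P = insert (m, c) P'"
    have P: "int_pairing U (c # cs) = P"
      using False by (simp add: B_def[symmetric] P'_def P_def m_def Let_def)
    have "finite (U - {m})" using Cons.prems by simp
    then have IH: "greedy (U - {m}) (set cs) P'" unfolding P'_def by (rule Cons.IH[OF _ s])
    note D = greedyD[OF IH]
    have m: "m \<in> U" "m < c" using Max_in[OF finB False] by (auto simp: m_def B_def)
    have mx: "b \<le> m" if "b \<in> U" "b < c" for b unfolding m_def using that finB by (intro Max_ge) (auto simp: B_def)
    have sub: "b \<in> U \<and> b \<noteq> m \<and> z \<in> set cs \<and> b < z \<and> c < z \<and> z \<noteq> c" if "(b, z) \<in> P'" for b z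
      using D(1)[OF that] lt[of z] by auto
    have fstP: "fst ` P = insert m (fst ` P')" and sndP: "snd ` P = insert c (snd ` P')" by (simp_all add: P_def)
    have mem: "(b, z) \<in> P \<longleftrightarrow> b = m \<and> z = c \<or> (b, z) \<in> P'" for b z by (auto simp: P_def)
    show ?thesis
      unfolding P greedy_def
    proof (intro conjI allI ballI impI)
      fix b z assume "(b, z) \<in> P"
      then show "b \<in> U" "z \<in> set (c # cs)" "b < z" using sub[of b z] m by (auto simp: mem)
    next
      fix b z b' z' assume bz: "(b, z) \<in> P" "(b', z') \<in> P"
      show "b = b' \<longleftrightarrow> z = z'"
        using bz sub[of b z] sub[of b' z'] D(2)[of b z b' z'] unfolding mem by blast
      assume l: "b < z'" "z' < z"
      consider "b = m" "z = c" | "(b, z) \<in> P'" "b' = m" "z' = c" | "(b, z) \<in> P'" "(b', z') \<in> P'"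
        using bz unfolding mem by blast
      then show "b < b'"
      proof cases
        case 1
        then show ?thesis using l bz sub[of b' z'] unfolding mem by auto
      next
        case 2
        then show ?thesis using sub[OF 2(1)] mx[of b] l by auto
      next
        case 3
        then show ?thesis using D(6)[OF 3 l] by simp
      qed
    next
      fix b z assume bz: "b \<in> U" "z \<in> set (c # cs)" "b < z"
      show "b \<in> fst ` P \<or> z \<in> snd ` P"
        using D(3)[of b z] bz unfolding fstP sndP by auto
    next
      fix b z b' assume bz: "(b, z) \<in> P" "b' \<in> U" "b < b'" "b' < z"
      show "b' \<in> fst ` P"
      proof (cases "(b, z) \<in> P'")
        case True
        then show ?thesis using D(4)[OF True, of b'] bz unfolding fstP by auto
      next
        case False
        then show ?thesis using bz mx[of b'] unfolding mem by auto
      qed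
    next
      fix b z z' assume bz: "(b, z) \<in> P" "z' \<in> set (c # cs)" "b < z'" "z' < z"
      show "z' \<in> snd ` P"
      proof (cases "(b, z) \<in> P'")
        case True
        then show ?thesis using D(5)[OF True, of z'] bz unfolding sndP by auto
      next
        case False
        then show ?thesis using bz lt[of z'] unfolding mem sndP by auto
      qed
    qed
  qed
qed

context
  fixes u v P
  assumes fin: "finite u" "finite v" and g: "greedy u v P"
begin

lemma greedy_pair: "(b, c) \<in> P \<Longrightarrow> b \<in> u \<and> c \<in> v \<and> b < c"
  by (rule greedyD(1)[OF g])

lemma greedy_inj: "(b, c) \<in> P \<Longrightarrow> (b', c') \<in> P \<Longrightarrow> b = b' \<longleftrightarrow> c = c'"
  by (rule greedyD(2)[OF g])

lemma greedy_unpaired: "b \<in> u - fst ` P \<Longrightarrow> c \<in> v - snd ` P \<Longrightarrow> \<not> b < c"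
  using greedyD(3)[OF g, of b c] by blast

lemmas greedy_under = greedyD(4,5)[OF g]
lemmas greedy_noncrossing = greedyD(6)[OF g]

lemma card_pairs_left:
  assumes "finite T" "\<And>z. z \<in> S \<Longrightarrow> \<exists>y\<in>T. (z, y) \<in> P" shows "card S \<le> card T"
proof -
  obtain f where f: "\<And>z. z \<in> S \<Longrightarrow> f z \<in> T \<and> (z, f z) \<in> P" using assms(2) by metis
  show ?thesis
  proof (rule card_inj_on_le[of f])
    show "inj_on f S" by (rule inj_onI) (metis f greedy_inj)
  qed (use f assms(1) in auto)
qed

lemma card_pairs_right:
  assumes "finite T" "\<And>z. z \<in> S \<Longrightarrow> \<exists>y\<in>T. (y, z) \<in> P" shows "card S \<le> card T"
proof -
  obtain f where f: "\<And>z. z \<in> S \<Longrightarrow> f z \<in> T \<and> (f z, z) \<in> P" using assms(2) by metis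
  show ?thesis
  proof (rule card_inj_on_le[of f])
    show "inj_on f S" by (rule inj_onI) (metis f greedy_inj)
  qed (use f assms(1) in auto)
qed

text \<open>To the left of an unpaired \<open>z\<close> every letter of \<open>u\<close> is paired
  before \<open>z\<close>, so between \<open>k\<close> and \<open>z\<close> the letters of
  \<open>v\<close> are in the majority. If \<open>z\<close> is paired with \<open>b\<close>, the
  letters of \<open>v\<close> under the arc are matched inside it, and the path at \<open>z\<close>
  is not below its value at \<open>b\<close>.\<close>

lemma unpaired_right_iff:
  "z \<in> v - snd ` P \<longleftrightarrow> (\<forall>k<z. height u v z < height u v k)"
proof
  assume z: "z \<in> v - snd ` P"
  show "\<forall>k<z. height u v z < height u v k"
  proof (intro allI impI)
    fix k assume k: "k < z"
    have "card {b \<in> u. k \<le> b \<and> b < z} \<le> card {c \<in> v. k < c \<and> c < z}"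
    proof (rule card_pairs_left)
      fix b assume b: "b \<in> {b \<in> u. k \<le> b \<and> b < z}"
      then have "b \<in> fst ` P" using greedy_unpaired[of b z] z by auto
      then obtain c where c: "(b, c) \<in> P" by auto
      have "c \<noteq> z" using c z by force
      moreover have "\<not> z < c" using greedy_under(2)[OF c, of z] b z by auto
      ultimately have "c \<in> {c \<in> v. k < c \<and> c < z}" using greedy_pair[OF c] b by auto
      then show "\<exists>c\<in>{c \<in> v. k < c \<and> c < z}. (b, c) \<in> P" using c by blast
    qed (use fin in simp)
    moreover have "{c \<in> v. k < c \<and> c \<le> z} = insert z {c \<in> v. k < c \<and> c < z}" using z k by auto
    then have "card {c \<in> v. k < c \<and> c \<le> z} = Suc (card {c \<in> v. k < c \<and> c < z})" using fin by simp
    ultimately show "height u v z < height u v k" using height_diff[OF fin k] by linarith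
  qed
next
  assume h: "\<forall>k<z. height u v z < height u v k"
  then have "height u v z < height u v (z - 1)" by simp
  then have zv: "z \<in> v" using height_step[OF fin, of "z - 1"] by (auto split: if_splits)
  show "z \<in> v - snd ` P"
  proof (rule ccontr)
    assume "z \<notin> v - snd ` P"
    then obtain b where b: "(b, z) \<in> P" using zv by auto
    then have bz: "b \<in> u" "b < z" using greedy_pair by auto
    have "card {c \<in> v. b < c \<and> c \<le> z} \<le> card {y \<in> u. b \<le> y \<and> y < z}"
    proof (rule card_pairs_right)
      fix c assume c: "c \<in> {c \<in> v. b < c \<and> c \<le> z}"
      show "\<exists>y\<in>{y \<in> u. b \<le> y \<and> y < z}. (y, c) \<in> P"
      proof (cases "c = z")
        case True
        then show ?thesis using b bz by auto
      next
        case False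
        then have "c \<in> snd ` P" using greedy_under(2)[OF b, of c] c by auto
        then obtain y where y: "(y, c) \<in> P" by auto
        then have "b < y" "y \<in> u" "y < c" using greedy_noncrossing[OF b y] greedy_pair[OF y] c False by auto
        then show ?thesis using y c by auto
      qed
    qed (use fin in simp)
    then have "height u v z \<ge> height u v b" using height_diff[OF fin bz(2)] by linarith
    then show False using h bz(2) by auto
  qed
qed

lemma unpaired_left_iff:
  "z \<in> u - fst ` P \<longleftrightarrow> (\<forall>k>z. height u v z < height u v k)"
proof
  assume z: "z \<in> u - fst ` P"
  show "\<forall>k>z. height u v z < height u v k"
  proof (intro allI impI)
    fix k assume k: "z < k"
    have "card {c \<in> v. z < c \<and> c \<le> k} \<le> card {b \<in> u. z < b \<and> b < k}"
    proof (rule card_pairs_right)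
      fix c assume c: "c \<in> {c \<in> v. z < c \<and> c \<le> k}"
      then have "c \<in> snd ` P" using greedy_unpaired[of z c] z by auto
      then obtain b where b: "(b, c) \<in> P" by auto
      have "b \<noteq> z" using b z by force
      moreover have "\<not> b < z" using greedy_under(1)[OF b, of z] c z by auto
      ultimately have "b \<in> {b \<in> u. z < b \<and> b < k}" using greedy_pair[OF b] c by auto
      then show "\<exists>b\<in>{b \<in> u. z < b \<and> b < k}. (b, c) \<in> P" using b by blast
    qed (use fin in simp)
    moreover have "{b \<in> u. z \<le> b \<and> b < k} = insert z {b \<in> u. z < b \<and> b < k}" using z k by auto
    then have "card {b \<in> u. z \<le> b \<and> b < k} = Suc (card {b \<in> u. z < b \<and> b < k})" using fin by simp
    ultimately show "height u v z < height u v k" using height_diff[OF fin k] by linarith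
  qed
next
  assume h: "\<forall>k>z. height u v z < height u v k"
  then have "height u v z < height u v (z + 1)" by simp
  then have zu: "z \<in> u" using height_step[OF fin, of z] by (auto split: if_splits)
  show "z \<in> u - fst ` P"
  proof (rule ccontr)
    assume "z \<notin> u - fst ` P"
    then obtain c where c: "(z, c) \<in> P" using zu by auto
    then have cz: "c \<in> v" "z < c" using greedy_pair by auto
    have "card {b \<in> u. z \<le> b \<and> b < c} \<le> card {y \<in> v. z < y \<and> y \<le> c}"
    proof (rule card_pairs_left)
      fix b assume b: "b \<in> {b \<in> u. z \<le> b \<and> b < c}"
      show "\<exists>y\<in>{y \<in> v. z < y \<and> y \<le> c}. (b, y) \<in> P"
      proof (cases "b = z")
        case True
        then show ?thesis using c cz by auto
      next
        case False
        then have "b \<in> fst ` P" using greedy_under(1)[OF c, of b] b by auto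
        then obtain y where y: "(b, y) \<in> P" by auto
        have "y \<noteq> c" using greedy_inj[OF y c] False by auto
        moreover have "\<not> c < y" using greedy_noncrossing[OF y c] b False by auto
        ultimately show ?thesis using y greedy_pair[OF y] b by auto
      qed
    qed (use fin in simp)
    then have "height u v c \<le> height u v z" using height_diff[OF fin cz(2)] by linarith
    then show False using h cz(2) by auto
  qed
qed

text \<open>Nothing lies between \<open>b\<close> and \<open>b + 1\<close>, so any other partner of
  either letter would leave the other letter unpaired under an arc or make arcs cross. Inside the
  run on which an operator acts, the pairs are therefore known explicitly.\<close>

lemma greedy_adjacent:
  assumes "b \<in> u" "b + 1 \<in> v" shows "(b, b + 1) \<in> P"
proof (cases "b + 1 \<in> snd ` P")
  case True
  then obtain b' where b': "(b', b + 1) \<in> P" by auto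
  show ?thesis
  proof (cases "b' = b")
    case False
    then have lt: "b' < b" using greedy_pair[OF b'] by simp
    then have "b \<in> fst ` P" using greedy_under(1)[OF b' assms(1)] by simp
    then obtain c where c: "(b, c) \<in> P" by auto
    have "c \<noteq> b + 1" using greedy_inj[OF c b'] False by auto
    then have "b + 1 < c" using greedy_pair[OF c] by simp
    then have "b < b'" using greedy_noncrossing[OF c b'] by simp
    then show ?thesis using lt by simp
  qed (use b' in simp)
next
  case False
  then have "b \<in> fst ` P" using greedy_unpaired[of b "b + 1"] assms by auto
  then obtain c where c: "(b, c) \<in> P" by auto
  have "c \<noteq> b + 1" using c False by force
  then have "b + 1 < c" using greedy_pair[OF c] by simp
  then show ?thesis using greedy_under(2)[OF c assms(2)] False by simp
qed

end

subsection \<open>The crystal operators on primed words\<close>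

lemma dec_insert: "finite S \<Longrightarrow> k \<notin> S \<Longrightarrow> dec (insert k S) = dec {z \<in> S. k < z} @ k # dec {z \<in> S. z < k}"
  by (intro dec_eqI) (auto simp: sorted_wrt_append sorted_wrt_rev dest: less_trans)

lemma dec_split_at: "finite S \<Longrightarrow> k \<notin> S \<Longrightarrow> dec S = dec {z \<in> S. k < z} @ dec {z \<in> S. z < k}"
  by (intro dec_eqI) (auto simp: sorted_wrt_append sorted_wrt_rev neq_iff dest: less_trans, metis linorder_cases)

lemma insert_decreasing_primed:
  assumes "finite S" "k \<notin> S"
  shows "insert_decreasing (letter k (p k)) (primed S p) = primed (insert k S) p"
proof -
  define A where "A = map (\<lambda>z. letter z (p z)) (dec {z \<in> S. k < z})"
  define B where "B = map (\<lambda>z. letter z (p z)) (dec {z \<in> S. z < k})"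
  have A: "\<forall>z\<in>set A. letter k (p k) < z" using assms(1) letter_less by (auto simp: A_def)
  have B: "\<forall>z\<in>set B. \<not> letter k (p k) < z" using assms(1) letter_less by (auto simp: B_def not_less less_imp_le)
  have S: "primed S p = A @ B" using dec_split_at[OF assms] by (simp add: primed_def A_def B_def)
  have "takeWhile ((<) (letter k (p k))) B = []" "dropWhile ((<) (letter k (p k))) B = B"
    using B by (cases B; simp)+
  then have "insert_decreasing (letter k (p k)) (primed S p) = A @ letter k (p k) # B"
    unfolding S insert_decreasing_def using A by (simp add: takeWhile_append dropWhile_append)
  also have "\<dots> = primed (insert k S) p" using dec_insert[OF assms] by (simp add: primed_def A_def B_def)
  finally show ?thesis .
qed

lemma remove1_primed:
  assumes "finite S" "k \<in> S"
  shows "remove1 (letter k (p k)) (primed S p) = primed (S - {k}) p"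
proof -
  have e: "{z \<in> S - {k}. k < z} = {z \<in> S. k < z}" "{z \<in> S - {k}. z < k} = {z \<in> S. z < k}" by auto
  have "dec (S - {k}) = dec {z \<in> S. k < z} @ dec {z \<in> S. z < k}"
    using dec_split_at[of "S - {k}" k] assms(1) unfolding e by simp
  then show ?thesis using dec_split[OF assms] assms(1) by (auto simp: primed_def remove1_append)
qed

lemma pairing_primed:
  assumes "finite u" "finite v"
  shows "pairing (primed u p) (primed v r) = (\<lambda>(b, c). (letter b (p b), letter c (r c))) ` int_pairing u (row v)"
proof -
  have "rev (primed v r) = map (\<lambda>k. letter k (r k)) (row v)" by (simp add: primed_def rev_map)
  then show ?thesis unfolding pairing_def using pairing_from_letters[OF assms(1)] set_primed[OF assms(1)] by simp
qed

lemma unpaired_images: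
  fixes p r :: "int \<Rightarrow> bool"
  assumes "finite u" "finite v"
  defines "P \<equiv> pairing (primed u p) (primed v r)"
  shows "{c \<in> set (primed v r). c \<notin> snd ` P} = (\<lambda>k. letter k (r k)) ` (v - snd ` int_pairing u (row v))"
    and "{b \<in> set (primed u p). b \<notin> fst ` P} = (\<lambda>k. letter k (p k)) ` (u - fst ` int_pairing u (row v))"
proof -
  have "snd ` P = (\<lambda>k. letter k (r k)) ` snd ` int_pairing u (row v)"
    "fst ` P = (\<lambda>k. letter k (p k)) ` fst ` int_pairing u (row v)"
    unfolding P_def pairing_primed[OF assms(1,2)] by (simp_all add: image_image split_def)
  then show "{c \<in> set (primed v r). c \<notin> snd ` P} = (\<lambda>k. letter k (r k)) ` (v - snd ` int_pairing u (row v))"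
    and "{b \<in> set (primed u p). b \<notin> fst ` P} = (\<lambda>k. letter k (p k)) ` (u - fst ` int_pairing u (row v))"
    unfolding image_set_diff[OF inj_letter] set_primed[OF assms(1)] set_primed[OF assms(2)] by auto
qed

lemma greedy_row: "finite u \<Longrightarrow> finite v \<Longrightarrow> greedy u v (int_pairing u (row v))"
  using greedy_int_pairing[of u "row v"] by simp

text \<open>The condition \<open>T\<close> is left open because \<open>e_pair\<close> selects pairs
  by their right letter and \<open>f_pair\<close> by their left one. In both cases the selected
  pairs join neighbours in the run, and a swap of primes exchanges their flags.\<close>

lemma swap_primed:
  fixes p r :: "int \<Rightarrow> bool"
  assumes fin: "finite u" "finite v"
    and Q: "\<And>b c. (b, c) \<in> int_pairing u (row v) \<and> T c b \<longleftrightarrow> c = b + 1 \<and> x \<le> b \<and> b < x + q"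
  defines "QQ \<equiv> {(b, c) \<in> pairing (primed u p) (primed v r). T \<lceil>c\<rceil> \<lceil>b\<rceil>}"
  shows "S \<subseteq> u \<Longrightarrow> swap_left QQ (primed S p) = primed S (\<lambda>k. if x \<le> k \<and> k < x + q then r (k + 1) else p k)"
    and "S \<subseteq> v \<Longrightarrow> swap_right QQ (primed S r) = primed S (\<lambda>k. if x < k \<and> k \<le> x + q then p (k - 1) else r k)"
proof -
  have QQ: "(y, z) \<in> QQ \<longleftrightarrow> (\<exists>b. x \<le> b \<and> b < x + q \<and> y = letter b (p b) \<and> z = letter (b + 1) (r (b + 1)))" for y z
  proof -
    have "(y, z) \<in> QQ \<longleftrightarrow> (\<exists>b c. (b, c) \<in> int_pairing u (row v) \<and> T c b \<and> y = letter b (p b) \<and> z = letter c (r c))"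
      unfolding QQ_def pairing_primed[OF fin] by force
    then show ?thesis using Q by metis
  qed
  have L: "(\<exists>c. (letter k (p k), c) \<in> QQ \<and> (letter k (p k) \<in> primed_ints) \<noteq> (c \<in> primed_ints)) \<longleftrightarrow>
    x \<le> k \<and> k < x + q \<and> p k \<noteq> r (k + 1)" for k
    unfolding QQ by auto
  have R: "(\<exists>b. (b, letter k (r k)) \<in> QQ \<and> (b \<in> primed_ints) \<noteq> (letter k (r k) \<in> primed_ints)) \<longleftrightarrow>
    x < k \<and> k \<le> x + q \<and> p (k - 1) \<noteq> r k" for k
    unfolding QQ by (auto intro!: exI[of _ "k - 1"])
  show "swap_left QQ (primed S p) = primed S (\<lambda>k. if x \<le> k \<and> k < x + q then r (k + 1) else p k)"
    unfolding swap_left_def primed_def map_map comp_def L by (rule map_cong) auto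
  show "swap_right QQ (primed S r) = primed S (\<lambda>k. if x < k \<and> k \<le> x + q then p (k - 1) else r k)"
    unfolding swap_right_def primed_def map_map comp_def R by (rule map_cong) auto
qed

lemma e_pair_None:
  assumes fin: "finite u" "finite v" and r: "raise u v = None"
  shows "e_pair (primed u p) (primed v s) = None"
proof -
  have "v - snd ` int_pairing u (row v) = {}"
  proof (rule equals0I)
    fix z assume "z \<in> v - snd ` int_pairing u (row v)"
    then have h: "\<forall>k<z. height u v z < height u v k"
      using unpaired_right_iff[OF fin greedy_row[OF fin]] by blast
    obtain k where "height u v k = 0" "k < z" using ex_height_0[OF fin] by blast
    then have "height u v z < 0" using h by force
    then show False using raise_NoneD[OF fin r, of z] by simp
  qed
  then have "{c \<in> set (primed v s). c \<notin> snd ` pairing (primed u p) (primed v s)} = {}"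
    unfolding unpaired_images(1)[OF fin] by (simp only: image_empty)
  then show ?thesis unfolding e_pair_def Let_def by (simp only: simp_thms if_True)
qed

lemma f_pair_None:
  assumes fin: "finite u" "finite v" and r: "lower u v = None"
  shows "f_pair (primed u p) (primed v s) = None"
proof -
  have fin': "finite (uminus ` v)" "finite (uminus ` u)" using fin by auto
  have r': "raise (uminus ` v) (uminus ` u) = None" using r by (simp add: raise_uminus)
  have "u - fst ` int_pairing u (row v) = {}"
  proof (rule equals0I)
    fix z assume "z \<in> u - fst ` int_pairing u (row v)"
    then have h: "\<forall>k>z. height u v z < height u v k"
      using unpaired_left_iff[OF fin greedy_row[OF fin]] by blast
    obtain k where k: "height (uminus ` v) (uminus ` u) k = 0" "k < - z" using ex_height_0[OF fin'] by blast
    then have "height u v z < height u v (- k)" using h by simp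
    then have "height (uminus ` v) (uminus ` u) (- z) < 0"
      using height_uminus[OF fin, of z] height_uminus[OF fin, of "- k"] k(1) by simp
    then show False using raise_NoneD[OF fin' r', of "- z"] by simp
  qed
  then have "{b \<in> set (primed u p). b \<notin> fst ` pairing (primed u p) (primed v s)} = {}"
    unfolding unpaired_images(2)[OF fin] by (simp only: image_empty)
  then show ?thesis unfolding f_pair_def Let_def by (simp only: simp_thms if_True)
qed

text \<open>The first minimum \<open>x\<close> is unpaired by \<open>unpaired_right_iff\<close>, and
  it is the largest unpaired letter, since a later one would be lower than the minimum of the
  path.\<close>

lemma e_pair_Some:
  assumes fin: "finite u" "finite v" and red: "reduced (dec u @ dec v)" and x: "first_min u v x"
  defines "q \<equiv> gap x u"
  shows "e_pair (primed u p) (primed v r) =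
    Some (primed (insert (x + int q) u) (shift_left x q p r), primed (v - {x}) (shift_right x q p r))"
proof -
  note s = raise_structure[OF fin red x, folded q_def]
  define P where "P = int_pairing u (row v)"
  note G = greedy_row[OF fin, folded P_def]
  have iff: "z \<in> v - snd ` P \<longleftrightarrow> (\<forall>k<z. height u v z < height u v k)" for z
    by (rule unpaired_right_iff[OF fin G])
  have xN: "x \<in> v - snd ` P" unfolding iff using x by (simp add: first_min_def)
  have le: "z \<le> x" if "z \<in> v - snd ` P" for z
  proof (rule ccontr)
    assume "\<not> z \<le> x"
    then have "height u v z < height u v x" using that unfolding iff by simp
    then show False using x by (simp add: first_min_def not_less[symmetric])
  qed
  have finN: "finite (v - snd ` P)" using fin by simp
  have Mx: "Max (v - snd ` P) = x" using finN xN le by (intro Max_eqI) auto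
  have M: "Max ((\<lambda>k. letter k (r k)) ` (v - snd ` P)) = letter x (r x)"
  proof -
    have "v - snd ` P \<noteq> {}" using xN by blast
    from mono_Max_commute[OF strict_mono_mono[OF strict_mono_letter[of r]] finN this]
    show ?thesis unfolding Mx by (rule sym)
  qed
  have N: "{c \<in> set (primed v r). c \<notin> snd ` pairing (primed u p) (primed v r)} = (\<lambda>k. letter k (r k)) ` (v - snd ` P)"
    using unpaired_images(1)[OF fin] by (simp add: P_def)
  have ne: "(\<lambda>k. letter k (r k)) ` (v - snd ` P) \<noteq> {}" using xN by blast
  have q: "(LEAST q. \<lceil>letter x (r x)\<rceil> + int q \<notin> ceiling ` set (primed u p)) = q"
    using ceiling_set_primed[OF fin(1), of p] by (simp add: q_def gap_def)
  define Q where "Q = {(b, c) \<in> pairing (primed u p) (primed v r). \<lceil>letter x (r x)\<rceil> + int q \<ge> \<lceil>c\<rceil> \<and> \<lceil>c\<rceil> > \<lceil>letter x (r x)\<rceil>}"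
  \<comment> \<open>By \<open>raise_structure\<close> both \<open>c - 1\<close> in \<open>u\<close>
    and \<open>c\<close> in \<open>v\<close> belong to the run for every selected \<open>c\<close>,
    so the partner of \<open>c\<close> is its neighbour.\<close>
  have Qi: "(b, c) \<in> P \<and> (x + int q \<ge> c \<and> c > x) \<longleftrightarrow> c = b + 1 \<and> x \<le> b \<and> b < x + int q" for b c
  proof
    assume a: "(b, c) \<in> P \<and> (x + int q \<ge> c \<and> c > x)"
    then have "c - 1 \<in> u" "c \<in> v" using s(2,4) by auto
    then have "(c - 1, c) \<in> P" using greedy_adjacent[OF fin G, of "c - 1"] by simp
    then have "b = c - 1" using greedy_inj[OF fin G, of b c "c - 1" c] a by simp
    then show "c = b + 1 \<and> x \<le> b \<and> b < x + int q" using a by auto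
  next
    assume a: "c = b + 1 \<and> x \<le> b \<and> b < x + int q"
    then have "b \<in> u" "b + 1 \<in> v" using s(2,4) by auto
    then show "(b, c) \<in> P \<and> (x + int q \<ge> c \<and> c > x)" using greedy_adjacent[OF fin G, of b] a by auto
  qed
  note SW = swap_primed[where T = "\<lambda>c b. x + int q \<ge> c \<and> c > x" and x = x and q = "int q" and p = p and r = r,
      OF fin, folded P_def, OF Qi]
  have Q': "Q = {(b, c) \<in> pairing (primed u p) (primed v r). x + int q \<ge> \<lceil>c\<rceil> \<and> \<lceil>c\<rceil> > x}"
    by (simp add: Q_def)
  have xv: "x \<in> v" using xN by simp
  have "e_pair (primed u p) (primed v r) =
    Some (insert_decreasing (letter x (r x) + of_nat q) (swap_left Q (primed u p)), swap_right Q (remove1 (letter x (r x)) (primed v r)))"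
    unfolding e_pair_def Let_def N M q Q_def using ne by simp
  also have "swap_left Q (primed u p) = primed u (shift_left x q p r)"
    unfolding Q' SW(1)[OF subset_refl] using fin s(3) by (intro primed_cong) (auto simp: shift_left_def)
  also have "letter x (r x) + of_nat q = letter (x + int q) (shift_left x q p r (x + int q))"
    by (simp add: letter_add shift_left_def)
  also have "insert_decreasing (letter (x + int q) (shift_left x q p r (x + int q))) (primed u (shift_left x q p r)) =
      primed (insert (x + int q) u) (shift_left x q p r)"
    using fin(1) s(3) by (rule insert_decreasing_primed)
  also have "swap_right Q (remove1 (letter x (r x)) (primed v r)) = primed (v - {x}) (shift_right x q p r)"
    unfolding remove1_primed[OF fin(2) xv] Q' SW(2)[OF Diff_subset] using fin
    by (intro primed_cong) (auto simp: shift_right_def)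
  finally show ?thesis .
qed

text \<open>The flags after lowering, written from the side of the result: \<open>x\<close> is the
  first minimum of the lowered pair, so \<open>x + q\<close> is the letter that leaves the first
  factor, and its flag reappears at \<open>x\<close>.\<close>

definition unshift_left :: "int \<Rightarrow> nat \<Rightarrow> (int \<Rightarrow> bool) \<Rightarrow> (int \<Rightarrow> bool) \<Rightarrow> int \<Rightarrow> bool" where
  "unshift_left x q p r k = (if x \<le> k \<and> k < x + int q then r (k + 1) else p k)"

definition unshift_right :: "int \<Rightarrow> nat \<Rightarrow> (int \<Rightarrow> bool) \<Rightarrow> (int \<Rightarrow> bool) \<Rightarrow> int \<Rightarrow> bool" where
  "unshift_right x q p r k = (if x < k \<and> k \<le> x + int q then p (k - 1) else if k = x then p (x + int q) else r k)"

lemma shift_unshift: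
  "shift_left x q (unshift_left x q p r) (unshift_right x q p r) k = p k"
  "k \<noteq> x \<Longrightarrow> shift_right x q (unshift_left x q p r) (unshift_right x q p r) k = r k"
  by (auto simp: shift_left_def shift_right_def unshift_left_def unshift_right_def)

text \<open>The parameter \<open>x\<close> belongs to the lowered pair \<open>(U, V)\<close>. This
  makes the known shape of that pair under raising available and gives \<open>e_pair\<close> and
  \<open>f_pair\<close> the same parameters.\<close>

lemma f_pair_Some:
  assumes fin: "finite u" "finite v" and red: "reduced (dec u @ dec v)" and l: "lower u v = Some (U, V)"
    and x: "first_min U V x"
  defines "q \<equiv> gap x U"
  shows "f_pair (primed u p) (primed v r) = Some (primed U (unshift_left x q p r), primed V (unshift_right x q p r))"
proof -
  note lf = lower_facts[OF fin red l]
  note s = raise_structure[OF lf(1-3) x, folded q_def]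
  have uv: "u = insert (x + int q) U" "v = V - {x}"
    using raise_eqI[OF x] lf(4) by (auto simp: q_def)
  have xV: "x \<in> V" using s(4) by auto
  \<comment> \<open>The letter that leaves \<open>u\<close>. In the mirrored pair it is the negative
    of the first minimum, so it is the last minimum of the path and hence the smallest unpaired
    letter of \<open>u\<close>.\<close>
  define y where "y = x + int q"
  have yu: "y \<in> u" "y \<notin> U" using uv(1) s(3) by (auto simp: y_def)
  obtain z where z: "first_min (uminus ` v) (uminus ` u) z"
    "uminus ` U = uminus ` u - {z}"
    using l by (auto simp: lower_def image_image elim!: raise_SomeE)
  have "z = - y"
  proof -
    have "- y \<in> uminus ` u" "- y \<notin> uminus ` U" using yu by auto
    then show ?thesis using z(2) by blast
  qed
  with z(1) have ly: "first_min (uminus ` v) (uminus ` u) (- y)" by simp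
  have min: "height u v y \<le> height u v k" "y < k \<Longrightarrow> height u v y < height u v k" for k
  proof -
    show "height u v y \<le> height u v k"
    proof -
      have "height (uminus ` v) (uminus ` u) (- y) \<le> height (uminus ` v) (uminus ` u) (- k)"
        using ly unfolding first_min_def by blast
      then show ?thesis using height_uminus[OF fin, of y] height_uminus[OF fin, of k] by simp
    qed
    assume "y < k"
    then have "height (uminus ` v) (uminus ` u) (- y) < height (uminus ` v) (uminus ` u) (- k)"
      using ly by (simp add: first_min_def)
    then show "height u v y < height u v k"
      using height_uminus[OF fin, of y] height_uminus[OF fin, of k] by simp
  qed
  define P where "P = int_pairing u (row v)"
  note G = greedy_row[OF fin, folded P_def]
  have iff: "z \<in> u - fst ` P \<longleftrightarrow> (\<forall>k>z. height u v z < height u v k)" for z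
    by (rule unpaired_left_iff[OF fin G])
  have yN: "y \<in> u - fst ` P" unfolding iff using min by simp
  have le: "y \<le> z" if "z \<in> u - fst ` P" for z
  proof (rule ccontr)
    assume "\<not> y \<le> z"
    then have "height u v z < height u v y" using that unfolding iff by simp
    then show False using min(1)[of z] by simp
  qed
  have finN: "finite (u - fst ` P)" using fin by simp
  have Mx: "Min (u - fst ` P) = y" using finN yN le by (intro Min_eqI) auto
  have M: "Min ((\<lambda>k. letter k (p k)) ` (u - fst ` P)) = letter y (p y)"
  proof -
    have "u - fst ` P \<noteq> {}" using yN by blast
    from mono_Min_commute[OF strict_mono_mono[OF strict_mono_letter[of p]] finN this]
    show ?thesis unfolding Mx by (rule sym)
  qed
  have N: "{b \<in> set (primed u p). b \<notin> fst ` pairing (primed u p) (primed v r)} = (\<lambda>k. letter k (p k)) ` (u - fst ` P)"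
    using unpaired_images(2)[OF fin] by (simp add: P_def)
  have ne: "(\<lambda>k. letter k (p k)) ` (u - fst ` P) \<noteq> {}" using yN by blast
  have q: "(LEAST q. \<lceil>letter y (p y)\<rceil> - int q \<notin> ceiling ` set (primed v r)) = q"
    unfolding ceiling_set_primed[OF fin(2)] ceiling_letter
  proof (rule Least_equality)
    show "y - int q \<notin> v" by (simp add: y_def uv(2))
    fix j assume j: "y - int j \<notin> v"
    show "q \<le> j"
    proof (rule ccontr)
      assume "\<not> q \<le> j"
      then have "y - int j \<in> {x..x + int q}" "y - int j \<noteq> x" by (auto simp: y_def)
      then show False using j s(4) uv(2) by blast
    qed
  qed
  define Q where "Q = {(b, c) \<in> pairing (primed u p) (primed v r). \<lceil>letter y (p y)\<rceil> > \<lceil>b\<rceil> \<and> \<lceil>b\<rceil> \<ge> \<lceil>letter y (p y)\<rceil> - int q}"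
  have Qi: "(b, c) \<in> P \<and> (y > b \<and> b \<ge> y - int q) \<longleftrightarrow> c = b + 1 \<and> x \<le> b \<and> b < x + int q" for b c
  proof -
    have adj: "(b, b + 1) \<in> P" if "x \<le> b" "b < x + int q"
    proof (rule greedy_adjacent[OF fin G])
      show "b \<in> u" using that s(2) uv(1) by auto
      have "b + 1 \<in> {x..x + int q}" using that by auto
      then have "b + 1 \<in> V" using s(4) by blast
      then show "b + 1 \<in> v" using that uv(2) by auto
    qed
    show ?thesis
    proof
      assume a: "(b, c) \<in> P \<and> (y > b \<and> b \<ge> y - int q)"
      then have b: "x \<le> b" "b < x + int q" by (auto simp: y_def)
      then have "c = b + 1" using greedy_inj[OF fin G, of b c b "b + 1"] a adj by simp
      then show "c = b + 1 \<and> x \<le> b \<and> b < x + int q" using b by simp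
    next
      assume "c = b + 1 \<and> x \<le> b \<and> b < x + int q"
      then show "(b, c) \<in> P \<and> (y > b \<and> b \<ge> y - int q)" using adj by (auto simp: y_def)
    qed
  qed
  note SW = swap_primed[where T = "\<lambda>c b. y > b \<and> b \<ge> y - int q" and x = x and q = "int q" and p = p and r = r,
      OF fin, folded P_def, OF Qi]
  have Q': "Q = {(b, c) \<in> pairing (primed u p) (primed v r). y > \<lceil>b\<rceil> \<and> \<lceil>b\<rceil> \<ge> y - int q}"
    by (simp add: Q_def)
  have "f_pair (primed u p) (primed v r) =
    Some (swap_left Q (remove1 (letter y (p y)) (primed u p)), insert_decreasing (letter y (p y) - of_nat q) (swap_right Q (primed v r)))"
    unfolding f_pair_def Let_def N M q Q_def using ne by simp
  also have "swap_left Q (remove1 (letter y (p y)) (primed u p)) = primed U (unshift_left x q p r)"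
  proof -
    have "u - {y} = U" using uv(1) yu(2) by (auto simp: y_def)
    moreover have "U \<subseteq> u" using uv(1) by auto
    ultimately show ?thesis unfolding remove1_primed[OF fin(1) yu(1)] Q' using SW(1)[of U]
      by (simp add: unshift_left_def[abs_def])
  qed
  also have "swap_right Q (primed v r) = primed v (unshift_right x q p r)"
    unfolding Q' SW(2)[OF subset_refl] using fin uv(2) by (intro primed_cong) (auto simp: unshift_right_def)
  also have "letter y (p y) - of_nat q = letter x (unshift_right x q p r x)"
    by (simp add: letter_diff unshift_right_def y_def)
  also have "insert_decreasing (letter x (unshift_right x q p r x)) (primed v (unshift_right x q p r)) =
      primed (insert x v) (unshift_right x q p r)"
    using fin(2) uv(2) by (intro insert_decreasing_primed) auto
  also have "insert x v = V" using uv(2) xV by auto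
  finally show ?thesis .
qed

section \<open>The operators fix the marked inversions\<close>

definition flagged :: "rat list \<Rightarrow> (int \<times> bool) list" where
  "flagged is = map (\<lambda>x. (\<lceil>x\<rceil>, x \<in> primed_ints)) is"

lemma flagged_append: "flagged (a @ b) = flagged a @ flagged b"
  by (simp add: flagged_def)

lemma map_fst_flagged: "map fst (flagged is) = map ceiling is"
  by (simp add: flagged_def comp_def)

lemma flagged_primed: "flagged (primed S p) = flag p (dec S)"
  by (simp add: flagged_def primed_def flag_def comp_def)

lemma marked_labels:
  "marked is = {inv_labels (map ceiling is) ! j | j. j < length is \<and> is ! j \<in> primed_ints}"
proof -
  have "l \<in> marked is \<longleftrightarrow> (\<exists>j<length is. l = inv_labels (map ceiling is) ! j \<and> is ! j \<in> primed_ints)" for l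
    unfolding marked_def by (auto simp: inv_labels_nth)
  then show ?thesis by blast
qed

lemma marked_flagged: "marked is = {l. (l, True) \<in> flagged_labels (flagged is)}"
proof -
  have "(l, True) \<in> flagged_labels (flagged is) \<longleftrightarrow>
      (\<exists>j<length is. l = inv_labels (map ceiling is) ! j \<and> is ! j \<in> primed_ints)" for l
    unfolding flagged_labels_def map_fst_flagged by (auto simp: in_set_zip flagged_def)
  then show ?thesis unfolding marked_labels by blast
qed

lemma pair_ops:
  assumes fin: "finite u" "finite v" and red: "reduced (dec u @ dec v)"
  shows "e_pair (primed u p) (primed v r) = None \<longleftrightarrow> raise u v = None"
    and "f_pair (primed u p) (primed v r) = None \<longleftrightarrow> lower u v = None"
    and "raise u v = Some (U, V) \<Longrightarrow> \<exists>p' r'. e_pair (primed u p) (primed v r) = Some (primed U p', primed V r') \<and>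
      marked (a @ primed U p' @ primed V r' @ b) = marked (a @ primed u p @ primed v r @ b)"
    and "lower u v = Some (U, V) \<Longrightarrow> \<exists>p' r'. f_pair (primed u p) (primed v r) = Some (primed U p', primed V r') \<and>
      marked (a @ primed U p' @ primed V r' @ b) = marked (a @ primed u p @ primed v r @ b)"
proof -
  have mm: "marked (a @ primed u1 p1 @ primed v1 r1 @ b) = marked (a @ primed u2 p2 @ primed v2 r2 @ b)"
    if "mark_moves (flag p1 (dec u1) @ flag r1 (dec v1)) (flag p2 (dec u2) @ flag r2 (dec v2))"
    for u1 p1 v1 r1 u2 p2 v2 r2
    using mark_moves_invariant(3)[OF mark_moves_infix[OF that, of "flagged a" "flagged b"]]
    by (simp add: marked_flagged flagged_append flagged_primed)
  {
    assume r: "raise u v = Some (U, V)"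
    then obtain x where x: "first_min u v x" "U = insert (x + int (gap x u)) u" "V = v - {x}"
      by (rule raise_SomeE)
    define q where "q = gap x u"
    define p' where "p' = shift_left x q p r"
    define r' where "r' = shift_right x q p r"
    have "e_pair (primed u p) (primed v r) = Some (primed U p', primed V r')"
      unfolding e_pair_Some[OF fin red x(1)] x(2,3) p'_def r'_def q_def ..
    moreover have "marked (a @ primed U p' @ primed V r' @ b) = marked (a @ primed u p @ primed v r @ b)"
      using mm[OF raise_moves[OF fin red x(1), of p r]] unfolding x(2,3) p'_def r'_def q_def by (rule sym)
    ultimately show "\<exists>p' r'. e_pair (primed u p) (primed v r) = Some (primed U p', primed V r') \<and>
      marked (a @ primed U p' @ primed V r' @ b) = marked (a @ primed u p @ primed v r @ b)"
      by blast
  }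
  {
    assume l: "lower u v = Some (U, V)"
    note lf = lower_facts[OF fin red l]
    obtain x where x: "first_min U V x" "u = insert (x + int (gap x U)) U" "v = V - {x}"
      using lf(4) by (rule raise_SomeE)
    define q where "q = gap x U"
    define p' where "p' = unshift_left x q p r"
    define r' where "r' = unshift_right x q p r"
    \<comment> \<open>For lowering, the moves are read from the lowered pair back to the given one.
      Shifting the unshifted flags must reproduce \<open>p\<close> on \<open>u\<close> and
      \<open>r\<close> on \<open>v\<close>; it may differ at \<open>x\<close>, which is not in
      \<open>v\<close>.\<close>
    have "primed u (shift_left x q p' r') = primed u p" "primed v (shift_right x q p' r') = primed v r"
      using fin x(3) by (auto intro!: primed_cong simp: p'_def r'_def shift_unshift)
    then have fl: "flag (shift_left x q p' r') (dec u) = flag p (dec u)" "flag (shift_right x q p' r') (dec v) = flag r (dec v)"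
      by (metis flagged_primed)+
    have "mark_moves (flag p' (dec U) @ flag r' (dec V)) (flag p (dec u) @ flag r (dec v))"
      using raise_moves[OF lf(1-3) x(1), of p' r'] unfolding x(2,3)[symmetric] unfolding q_def[symmetric] fl .
    from mm[OF this]
    have "marked (a @ primed U p' @ primed V r' @ b) = marked (a @ primed u p @ primed v r @ b)" .
    moreover have "f_pair (primed u p) (primed v r) = Some (primed U p', primed V r')"
      unfolding f_pair_Some[OF fin red l x(1)] p'_def r'_def q_def ..
    ultimately show "\<exists>p' r'. f_pair (primed u p) (primed v r) = Some (primed U p', primed V r') \<and>
      marked (a @ primed U p' @ primed V r' @ b) = marked (a @ primed u p @ primed v r @ b)"
      by blast
  }
  show "e_pair (primed u p) (primed v r) = None \<longleftrightarrow> raise u v = None"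
  proof (cases "raise u v")
    case (Some z)
    then obtain U V where "raise u v = Some (U, V)" by (cases z) auto
    then obtain x where "first_min u v x" by (rule raise_SomeE)
    from e_pair_Some[OF fin red this] show ?thesis using Some by simp
  qed (simp add: e_pair_None[OF fin])
  show "f_pair (primed u p) (primed v r) = None \<longleftrightarrow> lower u v = None"
  proof (cases "lower u v")
    case (Some z)
    then obtain U V where l: "lower u v = Some (U, V)" by (cases z) auto
    obtain x where "first_min U V x" using lower_facts(4)[OF fin red l] by (rule raise_SomeE)
    from f_pair_Some[OF fin red l this] show ?thesis using Some by simp
  qed (simp add: f_pair_None[OF fin])
qed

subsection \<open>A criterion for normality\<close>

text \<open>
  A morphism to a tensor power that becomes injective together with an invariant of the connected
  components identifies every component with a component of the tensor power.
\<close>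

lemma normal_crystalI:
  fixes X :: "'a crystal" and \<Phi> :: "'a \<Rightarrow> nat list" and I :: "'a \<Rightarrow> 'b"
  assumes fin: "finite (elems X)" and closed: "ops_closed n X"
    and \<Phi>: "\<And>x. x \<in> elems X \<Longrightarrow> \<Phi> x \<in> elems (tensor_power n N)"
    and w: "\<And>x j. x \<in> elems X \<Longrightarrow> j \<in> {1..n} \<Longrightarrow> wt (tensor_power n N) (\<Phi> x) j = wt X x j"
    and e: "\<And>x i. x \<in> elems X \<Longrightarrow> i \<in> {1..<n} \<Longrightarrow> tensor_e i (\<Phi> x) = map_option \<Phi> (e_op X i x)"
    and f: "\<And>x i. x \<in> elems X \<Longrightarrow> i \<in> {1..<n} \<Longrightarrow> tensor_f i (\<Phi> x) = map_option \<Phi> (f_op X i x)"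
    and I: "\<And>x y i. x \<in> elems X \<Longrightarrow> i \<in> {1..<n} \<Longrightarrow> e_op X i x = Some y \<or> f_op X i x = Some y \<Longrightarrow> I y = I x"
    and inj: "\<And>x y. x \<in> elems X \<Longrightarrow> y \<in> elems X \<Longrightarrow> \<Phi> x = \<Phi> y \<Longrightarrow> I x = I y \<Longrightarrow> x = y"
  shows "normal_crystal n X"
proof -
  define Y where "Y = tensor_power n N"
  have Yop: "e_op Y = tensor_e" "f_op Y = tensor_f" by (simp_all add: Y_def tensor_power_def)
  define E where "E = crystal_edges n X \<union> (crystal_edges n X)\<inverse>"
  define F where "F = crystal_edges n Y \<union> (crystal_edges n Y)\<inverse>"
  define comp where "comp x = {y. (x, y) \<in> E\<^sup>*}" for x
  define compY where "compY b = {c. (b, c) \<in> F\<^sup>*}" for b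
  have symE: "(x, y) \<in> E\<^sup>* \<Longrightarrow> (y, x) \<in> E\<^sup>*" for x y
    by (rule symD[OF sym_rtrancl]) (auto simp: E_def sym_Un_converse)
  have cl: "y \<in> elems X" if "x \<in> elems X" "i \<in> {1..<n}" "e_op X i x = Some y \<or> f_op X i x = Some y" for x y i
    using closed that unfolding ops_closed_def by fastforce
  have edge: "(x, y) \<in> E \<Longrightarrow> x \<in> elems X \<and> y \<in> elems X \<and> I y = I x \<and> (\<Phi> x, \<Phi> y) \<in> F" for x y
  proof -
    have d: "x \<in> elems X \<and> y \<in> elems X \<and> I y = I x \<and> (\<Phi> x, \<Phi> y) \<in> crystal_edges n Y" if xy: "(x, y) \<in> crystal_edges n X" for x y
    proof -
      obtain i where i: "x \<in> elems X" "y \<in> elems X" "i \<in> {1..<n}" "e_op X i x = Some y \<or> f_op X i x = Some y"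
        using xy by (auto simp: crystal_edges_def)
      then have "tensor_e i (\<Phi> x) = Some (\<Phi> y) \<or> tensor_f i (\<Phi> x) = Some (\<Phi> y)" using e f by auto
      moreover have "\<Phi> x \<in> elems Y" "\<Phi> y \<in> elems Y" using \<Phi> i(1,2) by (simp_all add: Y_def)
      ultimately have "(\<Phi> x, \<Phi> y) \<in> crystal_edges n Y" using i(3) unfolding crystal_edges_def Yop by blast
      then show ?thesis using i I by blast
    qed
    assume "(x, y) \<in> E"
    then consider "(x, y) \<in> crystal_edges n X" | "(y, x) \<in> crystal_edges n X" by (auto simp: E_def)
    then show ?thesis
    proof cases
      case 1
      from d[OF this] show ?thesis by (simp add: F_def)
    next
      case 2
      from d[OF this] show ?thesis by (simp add: F_def)
    qed
  qed
  have reach: "y \<in> elems X \<and> I y = I x \<and> (\<Phi> x, \<Phi> y) \<in> F\<^sup>*" if "(x, y) \<in> E\<^sup>*" "x \<in> elems X" for x y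
    using that
  proof (induction rule: rtrancl_induct)
    case (step y z)
    then show ?case using edge[of y z] by (auto intro: rtrancl.rtrancl_into_rtrancl)
  qed simp
  have tef: "tensor_e i c = Some d \<Longrightarrow> tensor_f i d = Some c" "tensor_f i c = Some d \<Longrightarrow> tensor_e i d = Some c" for i c d
    using tensor_e_f by blast+
  \<comment> \<open>An edge of the tensor power may be traversed in either direction. Since
    \<open>tensor_e\<close> and \<open>tensor_f\<close> are inverse to each other, every traversal
    is an operator applied to the current vertex, and it is defined on the preimage because
    \<open>\<Phi>\<close> also reflects undefinedness.\<close>
  have lift: "\<exists>y. (x, y) \<in> E\<^sup>* \<and> c = \<Phi> y" if "(\<Phi> x, c) \<in> F\<^sup>*" "x \<in> elems X" for x c
    using that
  proof (induction rule: rtrancl_induct)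
    case base
    show ?case by (intro exI[of _ x]) simp
  next
    case (step c d)
    then obtain y where y: "(x, y) \<in> E\<^sup>*" "c = \<Phi> y" by blast
    have yX: "y \<in> elems X" using reach[OF y(1)] step.prems by blast
    obtain i where i: "i \<in> {1..<n}" "tensor_e i c = Some d \<or> tensor_f i c = Some d"
    proof -
      from step.hyps(2) consider "(c, d) \<in> crystal_edges n Y" | "(d, c) \<in> crystal_edges n Y" by (auto simp: F_def)
      then show thesis
      proof cases
        case 1
        then show ?thesis using that unfolding crystal_edges_def Yop by blast
      next
        case 2
        then obtain i where "i \<in> {1..<n}" "tensor_e i d = Some c \<or> tensor_f i d = Some c"
          unfolding crystal_edges_def Yop by blast
        then show ?thesis using that tef by blast
      qed
    qed
    then obtain z where z: "e_op X i y = Some z \<or> f_op X i y = Some z" "d = \<Phi> z"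
      using e[OF yX i(1)] f[OF yX i(1)] y(2) by auto
    have "(y, z) \<in> E" using cl[OF yX i(1) z(1)] yX i(1) z(1) by (auto simp: E_def crystal_edges_def)
    then show ?case using y(1) z(2) by (auto intro: rtrancl.rtrancl_into_rtrancl)
  qed
  have comp_eq: "comp x = comp y" if "(x, y) \<in> E\<^sup>*" for x y
    unfolding comp_def using that symE[OF that] by (blast intro: rtrancl_trans)
  have comp_refl: "x \<in> comp x" for x by (simp add: comp_def)
  have imgc: "compY (\<Phi> x) = \<Phi> ` comp x" if "x \<in> elems X" for x
  proof
    show "compY (\<Phi> x) \<subseteq> \<Phi> ` comp x" unfolding compY_def comp_def using lift[OF _ that] by blast
    show "\<Phi> ` comp x \<subseteq> compY (\<Phi> x)" unfolding compY_def comp_def using reach[OF _ that] by blast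
  qed
  obtain Ks where Ks: "set Ks = comp ` elems X" "distinct Ks"
    using finite_distinct_list[OF finite_imageI[OF fin, of comp]] by blast
  define rep where "rep K = (SOME x. x \<in> elems X \<and> comp x = K)" for K
  have rep: "rep K \<in> elems X \<and> comp (rep K) = K" if "K \<in> set Ks" for K
  proof -
    have "\<exists>x. x \<in> elems X \<and> comp x = K" using that Ks by auto
    then show ?thesis unfolding rep_def by (rule someI_ex)
  qed
  define Cs where "Cs = map (\<lambda>K. Y\<lparr>elems := compY (\<Phi> (rep K))\<rparr>) Ks"
  define pos where "pos x = (SOME k. k < length Ks \<and> Ks ! k = comp x)" for x
  have pos: "pos x < length Ks \<and> Ks ! pos x = comp x" if "x \<in> elems X" for x
  proof -
    have "comp x \<in> set Ks" using that Ks by auto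
    then have "\<exists>k. k < length Ks \<and> Ks ! k = comp x" by (auto simp: in_set_conv_nth)
    then show ?thesis unfolding pos_def by (rule someI_ex)
  qed
  \<comment> \<open>Different components of \<open>X\<close> may have the same image under
    \<open>\<Phi>\<close>; the position in the list of components keeps their copies apart.\<close>
  define h where "h x = (pos x, \<Phi> x)" for x
  have Csk: "elems (Cs ! k) = \<Phi> ` (Ks ! k)" "e_op (Cs ! k) = tensor_e" "f_op (Cs ! k) = tensor_f" "wt (Cs ! k) = wt Y"
    if "k < length Ks" for k
    using that rep[of "Ks ! k"] imgc[of "rep (Ks ! k)"] by (simp_all add: Cs_def Yop)
  define D where "D = disjoint_union Cs"
  have elD: "elems D = {(k, c). k < length Ks \<and> c \<in> \<Phi> ` (Ks ! k)}"
    using Csk(1) by (auto simp: D_def disjoint_union_def Cs_def)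
  have memK: "\<exists>y \<in> elems X. c = \<Phi> y \<and> k = pos y" if kc: "k < length Ks" "c \<in> \<Phi> ` (Ks ! k)" for k c
  proof -
    have K: "Ks ! k \<in> set Ks" using kc by simp
    obtain y where y: "y \<in> Ks ! k" "c = \<Phi> y" using kc by auto
    have r: "(rep (Ks ! k), y) \<in> E\<^sup>*" using rep[OF K] y(1) by (auto simp: comp_def)
    then have yX: "y \<in> elems X" using reach rep[OF K] by blast
    have "comp y = Ks ! k" using comp_eq[OF r] rep[OF K] by simp
    then have "pos y = k" using \<open>comp y = Ks ! k\<close> pos[OF yX] kc(1) nth_eq_iff_index_eq[OF Ks(2), of "pos y" k] by simp
    then show ?thesis using yX y(2) by blast
  qed
  have step_pos: "pos y = pos x" if "x \<in> elems X" "i \<in> {1..<n}" "e_op X i x = Some y \<or> f_op X i x = Some y" for x y i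
  proof -
    have "(x, y) \<in> E" using cl[OF that] that by (auto simp: E_def crystal_edges_def)
    then have "comp x = comp y" by (intro comp_eq) auto
    then show ?thesis by (simp add: pos_def)
  qed
  have eD: "e_op D i (h x) = map_option h (e_op X i x)" "f_op D i (h x) = map_option h (f_op X i x)"
    if "x \<in> elems X" "i \<in> {1..<n}" for x i
  proof -
    have D: "e_op D i (h x) = map_option (Pair (pos x)) (tensor_e i (\<Phi> x))"
      "f_op D i (h x) = map_option (Pair (pos x)) (tensor_f i (\<Phi> x))"
      using Csk(2,3) pos[OF that(1)] by (simp_all add: D_def disjoint_union_def h_def)
    have "map_option (Pair (pos x) \<circ> \<Phi>) (e_op X i x) = map_option h (e_op X i x)"
      "map_option (Pair (pos x) \<circ> \<Phi>) (f_op X i x) = map_option h (f_op X i x)"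
      using step_pos[OF that] by (auto simp: h_def intro!: option.map_cong)
    then show "e_op D i (h x) = map_option h (e_op X i x)" "f_op D i (h x) = map_option h (f_op X i x)"
      unfolding D e[OF that] f[OF that] option.map_comp .
  qed
  have hD: "h x \<in> elems D" if "x \<in> elems X" for x
    using pos[OF that] comp_refl by (auto simp: elD h_def)
  have onto: "\<exists>x\<in>elems X. z = h x" if "z \<in> elems D" for z
    using that memK unfolding elD h_def by blast
  have "crystal_iso n X D h"
    unfolding crystal_iso_def
  proof (intro conjI ballI closed)
    show "ops_closed n D"
      unfolding ops_closed_def
    proof (intro ballI)
      fix i z assume i: "i \<in> {1..<n}" and z: "z \<in> elems D"
      obtain x where x: "x \<in> elems X" "z = h x" using onto[OF z] by blast
      show "set_option (e_op D i z) \<subseteq> elems D \<and> set_option (f_op D i z) \<subseteq> elems D"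
        unfolding x(2) eD[OF x(1) i] option.set_map using closed x(1) i hD unfolding ops_closed_def by blast
    qed
    show "bij_betw h (elems X) (elems D)"
      unfolding bij_betw_def
    proof (intro conjI inj_onI)
      fix x y assume xy: "x \<in> elems X" "y \<in> elems X" "h x = h y"
      then have "comp x = comp y" using pos[OF xy(1)] pos[OF xy(2)] by (simp add: h_def)
      then have "(x, y) \<in> E\<^sup>*" using comp_refl[of y] by (auto simp: comp_def)
      then have "I y = I x" using reach xy(1) by blast
      then show "x = y" using inj[OF xy(1,2)] xy(3) by (simp add: h_def)
    next
      show "h ` elems X = elems D" using hD onto by blast
    qed
    show "wt D (h x) j = wt X x j" if "x \<in> elems X" "j \<in> {1..n}" for x j
      using w[OF that] Csk(4) pos[OF that(1)] by (simp add: D_def disjoint_union_def h_def Y_def)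
    show "e_op D i (h x) = map_option h (e_op X i x)" "f_op D i (h x) = map_option h (f_op X i x)"
      if "x \<in> elems X" "i \<in> {1..<n}" for x i using eD[OF that] by auto
  qed
  moreover have "\<forall>C \<in> set Cs. \<exists>m. crystal_component n (tensor_power n m) C"
  proof
    fix C assume "C \<in> set Cs"
    then obtain K where K: "K \<in> set Ks" "C = Y\<lparr>elems := compY (\<Phi> (rep K))\<rparr>" by (auto simp: Cs_def)
    have "\<Phi> (rep K) \<in> elems Y" using rep[OF K(1)] \<Phi> by (simp add: Y_def)
    then have "crystal_component n Y C"
      unfolding crystal_component_def K(2) compY_def F_def by blast
    then show "\<exists>m. crystal_component n (tensor_power n m) C" unfolding Y_def by blast
  qed
  ultimately show ?thesis unfolding normal_crystal_def D_def by blast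
qed

subsection \<open>Reduced factorizations\<close>

definition supports :: "rat list list \<Rightarrow> int set list" where
  "supports a = map (\<lambda>u. ceiling ` set u) a"

lemma length_supports [simp]: "length (supports a) = length a"
  by (simp add: supports_def)

lemma finite_supports: "\<forall>S\<in>set (supports a). finite S"
  by (simp add: supports_def)

text \<open>A strictly decreasing primed word might contain both \<open>k\<close> and
  \<open>k'\<close>. Their ceilings would be equal neighbours, which a reduced word does not
  have.\<close>

lemma sorted_ceiling:
  assumes "sorted_wrt (>) (u :: rat list)" "reduced (map ceiling u)"
  shows "sorted_wrt (>) (map ceiling u)"
  using assms
proof (induction u)
  case (Cons x u)
  have "reduced ([\<lceil>x\<rceil>] @ map ceiling u)" using Cons.prems(2) by simp
  then have "reduced (map ceiling u)" by (rule reduced_appendD)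
  then have IH: "sorted_wrt (>) (map ceiling u)" using Cons by simp
  show ?case
  proof (cases u)
    case (Cons y t)
    have "\<not> reduced ([\<lceil>x\<rceil>, \<lceil>x\<rceil>])" using not_reduced_repeat[of "[]" "\<lceil>x\<rceil>"] by simp
    moreover have "reduced ([\<lceil>x\<rceil>, \<lceil>y\<rceil>] @ map ceiling t)" using Cons.prems(2) Cons by simp
    then have "reduced [\<lceil>x\<rceil>, \<lceil>y\<rceil>]" by (rule reduced_appendD)
    ultimately have "\<lceil>x\<rceil> \<noteq> \<lceil>y\<rceil>" by metis
    moreover have "\<lceil>y\<rceil> \<le> \<lceil>x\<rceil>" using Cons.prems(1) Cons by (intro ceiling_mono) simp
    ultimately have "\<lceil>y\<rceil> < \<lceil>x\<rceil>" by simp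
    then show ?thesis using IH Cons by auto
  qed simp
qed simp

lemma sorted_of_ceiling: "sorted_wrt (>) (map ceiling u) \<Longrightarrow> sorted_wrt (>) (u :: rat list)"
proof (induction u)
  case (Cons x u)
  have "y < x" if "y \<in> set u" for y
    using Cons.prems that ceiling_mono[of x y] by fastforce
  then show ?case using Cons by simp
qed simp

lemma word_supports: "(\<And>u. u \<in> set a \<Longrightarrow> sorted_wrt (>) (map ceiling u)) \<Longrightarrow> word (supports a) = map ceiling (concat a)"
proof (induction a)
  case (Cons u a)
  have "dec (ceiling ` set u) = map ceiling u" using Cons.prems[of u] by (intro dec_eqI) auto
  then show ?case using Cons by (simp add: supports_def)
qed (simp add: supports_def)

lemma RF_plusD:
  assumes "a \<in> RF_plus n w"
  shows "length a = n" "word (supports a) = map ceiling (concat a)" "reduced (word (supports a))"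
    "word_perm (word (supports a)) = w"
    "u \<in> set a \<Longrightarrow> u = primed (ceiling ` set u) (\<lambda>k. letter k True \<in> set u)"
    "u \<in> set a \<Longrightarrow> map ceiling u = dec (ceiling ` set u)"
proof -
  have c: "reduced (map ceiling (concat a))" "word_perm (map ceiling (concat a)) = w"
    using assms by (auto simp: RF_plus_def reduced_words_iff)
  have s: "sorted_wrt (>) (map ceiling u)" if u: "u \<in> set a" for u
  proof -
    obtain p s where "a = p @ u # s" using split_list[OF u] by blast
    then have "reduced (map ceiling (concat p) @ map ceiling u @ map ceiling (concat s))" using c(1) by simp
    then have "reduced (map ceiling u)" by (rule reduced_middleD)
    moreover have "sorted_wrt (>) u" using assms u by (auto simp: RF_plus_def strictly_decreasing_def)
    ultimately show ?thesis by (intro sorted_ceiling)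
  qed
  show w: "word (supports a) = map ceiling (concat a)" using s by (rule word_supports)
  show "length a = n" using assms by (simp add: RF_plus_def)
  show "reduced (word (supports a))" "word_perm (word (supports a)) = w" unfolding w by (fact c)+
  show "u \<in> set a \<Longrightarrow> u = primed (ceiling ` set u) (\<lambda>k. letter k True \<in> set u)"
    using s assms by (intro primed_repr) (auto simp: RF_plus_def)
  show "u \<in> set a \<Longrightarrow> map ceiling u = dec (ceiling ` set u)" using s by (intro dec_eqI[symmetric]) auto
qed

lemma RF_plusI:
  assumes "length a = n" "\<And>u. u \<in> set a \<Longrightarrow> primed_word u \<and> sorted_wrt (>) (map ceiling u)"
    "reduced (word (supports a))" "word_perm (word (supports a)) = w"
  shows "a \<in> RF_plus n w"
  using assms word_supports[of a]
  by (auto simp: RF_plus_def reduced_words_iff strictly_decreasing_def intro!: sorted_of_ceiling)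

lemma primed_word_primed: "primed_word (primed S p)"
  unfolding primed_word_def primed_def set_map using letter_in by blast

lemma on_factors_split:
  "on_factors opr (Suc (length p)) (p @ u # v # s) = map_option (\<lambda>(U, V). p @ U # V # s) (opr u v)"
  by (simp add: on_factors_def nth_append list_update_append split_def)

lemma on_factors_op:
  assumes a: "a \<in> RF_plus n w" and i: "i \<in> {1..<n}"
    and opr: "(opp = e_pair \<and> opr = raise) \<or> (opp = f_pair \<and> opr = lower)"
  shows "op_at opr i (supports a) = map_option supports (on_factors opp i a)"
    and "on_factors opp i a = Some b \<Longrightarrow> b \<in> RF_plus n w \<and> marked (concat b) = marked (concat a)"
proof -
  note A = RF_plusD[OF a]
  have ia: "1 \<le> i" "i < length a" using i A(1) by auto
  obtain p u v s where sp: "a = p @ u # v # s" "i = Suc (length p)" using factor_split[OF ia] .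
  define S where "S = ceiling ` set u"
  define T where "T = ceiling ` set v"
  define pu where "pu = (\<lambda>k. letter k True \<in> set u)"
  define pv where "pv = (\<lambda>k. letter k True \<in> set v)"
  have u: "u = primed S pu" and v: "v = primed T pv" using A(5) by (auto simp: sp S_def T_def pu_def pv_def)
  have fin: "finite S" "finite T" by (simp_all add: S_def T_def)
  have sup: "supports a = supports p @ S # T # supports s" by (simp add: supports_def sp S_def T_def)
  have "reduced (word (supports p) @ (dec S @ dec T) @ word (supports s))" using A(3) by (simp add: sup)
  then have red: "reduced (dec S @ dec T)" by (rule reduced_middleD)
  note PO = pair_ops[OF fin red]
  have None_case: "opp u v = None \<longleftrightarrow> opr S T = None" using opr PO(1,2) u v by auto
  have Some_case: "\<exists>p' r'. opp u v = Some (primed U p', primed V r') \<and>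
     marked (concat p @ primed U p' @ primed V r' @ concat s) = marked (concat a)"
    if "opr S T = Some (U, V)" for U V
    using opr
  proof
    assume o: "opp = e_pair \<and> opr = raise"
    then have "raise S T = Some (U, V)" using that by simp
    from PO(3)[OF this, of pu pv "concat p" "concat s"] show ?thesis using o u v by (auto simp: sp)
  next
    assume o: "opp = f_pair \<and> opr = lower"
    then have "lower S T = Some (U, V)" using that by simp
    from PO(4)[OF this, of pu pv "concat p" "concat s"] show ?thesis using o u v by (auto simp: sp)
  qed
  have o: "on_factors opp i a = map_option (\<lambda>(U, V). p @ U # V # s) (opp u v)"
    unfolding sp by (rule on_factors_split)
  have oa: "op_at opr i (supports a) = map_option (\<lambda>(U, V). supports p @ U # V # supports s) (opr S T)"
    unfolding sup using op_at_split[of opr "supports p"] by (simp add: sp(2))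
  have main: "op_at opr i (supports a) = map_option supports (on_factors opp i a) \<and>
    (\<forall>b. on_factors opp i a = Some b \<longrightarrow> b \<in> RF_plus n w \<and> marked (concat b) = marked (concat a))"
  proof (cases "opr S T")
    case n: None
    then have "opp u v = None" using None_case by simp
    then show ?thesis using n o oa by simp
  next
    case (Some z)
    then obtain U V where UV: "opr S T = Some (U, V)" by (cases z) auto
    obtain p' r' where pr: "opp u v = Some (primed U p', primed V r')"
      "marked (concat p @ primed U p' @ primed V r' @ concat s) = marked (concat a)"
      using Some_case[OF UV] by blast
    define b where "b = p @ primed U p' # primed V r' # s"
    have opr': "opr = raise \<or> opr = lower" using opr by blast
    note OF' = op_facts[OF opr' fin red UV]
    have ob: "on_factors opp i a = Some b" using o pr(1) by (simp add: b_def)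
    have sb: "supports b = supports p @ U # V # supports s"
      using OF'(1,2) by (simp add: supports_def b_def ceiling_set_primed)
    have oab: "op_at opr i (supports a) = Some (supports b)" using oa UV sb by simp
    have i': "1 \<le> i" "i < length (supports a)" using i A(1) by auto
    note OP = op_at_facts[OF opr' finite_supports A(3) i' oab]
    have "b \<in> RF_plus n w"
    proof (rule RF_plusI)
      show "length b = n" using A(1) by (simp add: b_def sp)
      show "reduced (word (supports b))" using ck_reduced[OF OP(2)] A(3) by blast
      show "word_perm (word (supports b)) = w" using ck_word_perm[OF OP(2)] A(4) by simp
      fix y assume "y \<in> set b"
      then consider "y = primed U p'" | "y = primed V r'" | "y \<in> set a" by (auto simp: b_def sp)
      then show "primed_word y \<and> sorted_wrt (>) (map ceiling y)"
      proof cases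
        case 3
        then show ?thesis using a A(6)[OF 3] sorted_dec by (auto simp: RF_plus_def)
      qed (simp_all only: primed_word_primed map_ceiling_primed sorted_dec simp_thms)
    qed
    moreover have "marked (concat b) = marked (concat a)" using pr(2) by (simp add: b_def)
    ultimately show ?thesis using oab ob by simp
  qed
  then show "op_at opr i (supports a) = map_option supports (on_factors opp i a)"
    and "on_factors opp i a = Some b \<Longrightarrow> b \<in> RF_plus n w \<and> marked (concat b) = marked (concat a)" by blast+
qed

lemma RF_plus_inject:
  assumes a: "a \<in> RF_plus n w" and b: "b \<in> RF_plus n w"
    and s: "supports a = supports b" and m: "marked (concat a) = marked (concat b)"
  shows "a = b"
proof -
  note A = RF_plusD[OF a] and B = RF_plusD[OF b]
  define c where "c = word (supports a)"
  have ca: "map ceiling (concat a) = c" and cb: "map ceiling (concat b) = c" using A(2) B(2) s by (simp_all add: c_def)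
  have d: "distinct (inv_labels c)" using inv_labels_reduced(1) A(3) by (simp add: c_def)
  have len: "length (concat a) = length c" "length (concat b) = length c" using arg_cong[OF ca, of length] arg_cong[OF cb, of length] by simp_all
  \<comment> \<open>The labels of a reduced word are distinct, so a marked label points to a single
    position.\<close>
  have iff: "is ! j \<in> primed_ints \<longleftrightarrow> inv_labels c ! j \<in> marked is" if "map ceiling is = c" "j < length c" for "is" j
    using that d nth_eq_iff_index_eq[OF d] unfolding marked_labels by (auto simp: that(1)[symmetric])
  have "concat a = concat b"
  proof (rule nth_equalityI)
    fix j assume "j < length (concat a)"
    then have j: "j < length c" by (simp add: len)
    have in': "x ! j \<in> \<int> \<union> primed_ints" if "x = concat y" "y \<in> RF_plus n w" "j < length x" for x y
    proof -
      have "x ! j \<in> set x" using that(3) by (rule nth_mem)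
      then obtain u where u: "u \<in> set y" "x ! j \<in> set u" unfolding \<open>x = concat y\<close> by auto
      then have "set u \<subseteq> \<int> \<union> primed_ints" using \<open>y \<in> RF_plus n w\<close> unfolding RF_plus_def primed_word_def by blast
      then show ?thesis using u(2) by blast
    qed
    have "concat a ! j = letter \<lceil>concat a ! j\<rceil> (concat a ! j \<in> primed_ints)"
      by (rule letter_ceiling[symmetric]) (rule in'[OF refl a], simp add: len j)
    also have "\<dots> = letter \<lceil>concat b ! j\<rceil> (concat b ! j \<in> primed_ints)"
    proof -
      have "\<lceil>concat a ! j\<rceil> = c ! j" "\<lceil>concat b ! j\<rceil> = c ! j" using ca cb j len by (metis nth_map)+
      then show ?thesis using iff[OF ca j] iff[OF cb j] m by simp
    qed
    also have "\<dots> = concat b ! j"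
      by (rule letter_ceiling) (rule in'[OF refl b], simp add: len j)
    finally show "concat a ! j = concat b ! j" .
  qed (simp add: len)
  moreover have "\<forall>(x, y)\<in>set (zip a b). length x = length y"
  proof clarify
    fix x y assume xy: "(x, y) \<in> set (zip a b)"
    then obtain j where j: "j < length a" "j < length b" "x = a ! j" "y = b ! j" by (auto simp: in_set_zip)
    have "ceiling ` set x = ceiling ` set y" using arg_cong[OF s, of "\<lambda>l. l ! j"] j by (simp add: supports_def)
    moreover have "x \<in> set a" "y \<in> set b" using j by auto
    ultimately have "map ceiling x = map ceiling y" using A(6)[of x] B(6)[of y] by simp
    then show "length x = length y" by (metis length_map)
  qed
  ultimately show "a = b" using A(1) B(1) by (intro concat_injective) auto
qed

section \<open>Prescribing and forgetting marks\<close>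

fun chop :: "'a list \<Rightarrow> nat list \<Rightarrow> 'a list list" where
  "chop xs [] = []"
| "chop xs (k # ks) = take k xs # chop (drop k xs) ks"

lemma concat_chop: "length xs = sum_list ks \<Longrightarrow> concat (chop xs ks) = xs"
  by (induction ks arbitrary: xs) auto

lemma map_chop: "map (map f) (chop xs ks) = chop (map f xs) ks"
  by (induction ks arbitrary: xs) (simp_all add: take_map drop_map)

lemma chop_concat: "chop (concat ls) (map length ls) = ls"
  by (induction ls) simp_all

lemma ex_marked:
  assumes a: "a \<in> RF_plus n w" and A: "A \<subseteq> Inv w"
  shows "\<exists>b. b \<in> RF_plus n w \<and> supports b = supports a \<and> marked (concat b) = A"
proof -
  note D = RF_plusD[OF a]
  define s where "s = supports a"
  define c where "c = word s"
  \<comment> \<open>Exactly the letters whose label belongs to \<open>A\<close> are primed. Since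
    every inversion of \<open>w\<close> is a label, all of \<open>A\<close> is marked.\<close>
  define new where "new = map2 letter c (map (\<lambda>l. l \<in> A) (inv_labels c))"
  define ks where "ks = map length (map dec s)"
  define b where "b = chop new ks"
  have mc: "map ceiling new = c" unfolding new_def by (rule nth_equalityI) simp_all
  have c: "c = concat (map dec s)" by (simp add: c_def word_def)
  have len: "length new = length c" by (simp add: new_def)
  have conc: "concat b = new"
    unfolding b_def by (rule concat_chop) (simp add: len c length_concat ks_def)
  have fac: "map (map ceiling) b = map dec s"
    unfolding b_def map_chop mc unfolding c ks_def by (rule chop_concat)
  have sup: "supports b = s"
  proof -
    have "supports b = map set (map (map ceiling) b)" by (simp add: supports_def)
    also have "\<dots> = s" unfolding fac using finite_supports[of a] by (simp add: s_def map_idI)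
    finally show ?thesis .
  qed
  have "b \<in> RF_plus n w"
  proof (rule RF_plusI)
    show "length b = n" using arg_cong[OF fac, of length] D(1) by (simp add: s_def)
    show "reduced (word (supports b))" "word_perm (word (supports b)) = w" using D(3,4) sup by (simp_all add: s_def)
    fix u assume u: "u \<in> set b"
    have "map ceiling u \<in> set (map dec s)" using u unfolding fac[symmetric] by simp
    then have sorted: "sorted_wrt (>) (map ceiling u)" using sorted_dec by auto
    have "set u \<subseteq> set new" using u conc by auto
    moreover have "x \<in> \<int> \<union> primed_ints" if x: "x \<in> set new" for x
    proof -
      obtain k b where "x = letter k b" using x unfolding new_def by auto
      then show ?thesis by (simp only: letter_in)
    qed
    ultimately have "primed_word u" unfolding primed_word_def by blast
    with sorted show "primed_word u \<and> sorted_wrt (>) (map ceiling u)" by simp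
  qed
  moreover have "marked (concat b) = A"
  proof -
    have "new ! j \<in> primed_ints \<longleftrightarrow> inv_labels c ! j \<in> A" if "j < length c" for j
      using that by (simp add: new_def)
    then have "marked new = {inv_labels c ! j | j. j < length c \<and> inv_labels c ! j \<in> A}"
      unfolding marked_labels mc len by auto
    also have "\<dots> = set (inv_labels c) \<inter> A" unfolding set_conv_nth length_inv_labels by blast
    also have "\<dots> = A" using inv_labels_reduced(2)[of c] D(3,4) A by (auto simp: c_def s_def)
    finally show ?thesis by (simp add: conc)
  qed
  ultimately show ?thesis using sup by (auto simp: s_def)
qed

lemma marked_empty: "marked is = {} \<longleftrightarrow> set is \<inter> primed_ints = {}"
proof -
  have "marked is = {} \<longleftrightarrow> (\<forall>j<length is. is ! j \<notin> primed_ints)" unfolding marked_labels by blast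
  also have "\<dots> \<longleftrightarrow> set is \<inter> primed_ints = {}" using all_set_conv_all_nth[of "is" "\<lambda>x. x \<notin> primed_ints"] by blast
  finally show ?thesis .
qed

lemma unprime_supports:
  assumes "a \<in> RF_plus n w" shows "unprime a = map (\<lambda>S. primed S (\<lambda>_. False)) (supports a)"
proof -
  have "map (\<lambda>x. of_int \<lceil>x\<rceil>) u = primed (ceiling ` set u) (\<lambda>_. False)" if "u \<in> set a" for u
  proof -
    have "map (\<lambda>x. of_int \<lceil>x\<rceil>) u = map (\<lambda>k. letter k False) (map ceiling u)" by (simp add: letter_def comp_def)
    then show ?thesis unfolding RF_plusD(6)[OF assms that] by (simp add: primed_def)
  qed
  then show ?thesis by (simp add: unprime_def supports_def)
qed

lemma unprime_RF:
  assumes a: "a \<in> RF_plus n w"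
  shows "unprime a \<in> RF n w" "supports (unprime a) = supports a"
proof -
  note D = RF_plusD[OF a] and U = unprime_supports[OF a]
  show s: "supports (unprime a) = supports a"
    unfolding U using finite_supports[of a] by (simp add: supports_def[of "map _ _"] ceiling_set_primed map_idI)
  have "unprime a \<in> RF_plus n w"
  proof (rule RF_plusI)
    show "length (unprime a) = n" using D(1) by (simp add: unprime_def)
    show "reduced (word (supports (unprime a)))" "word_perm (word (supports (unprime a))) = w" unfolding s by (fact D)+
    show "primed_word u \<and> sorted_wrt (>) (map ceiling u)" if "u \<in> set (unprime a)" for u
      using that primed_word_primed sorted_dec unfolding U by auto
  qed
  moreover have "marked (concat (unprime a)) = {}"
    unfolding marked_empty U by (auto simp: primed_def)
  ultimately show "unprime a \<in> RF n w" by (simp add: RF_def RF_plus_marked_def)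
qed

text \<open>No flags are followed here: both sides have the same supports and no marks, and these
  data determine a factorization.\<close>

lemma on_factors_unprime:
  assumes a: "a \<in> RF_plus n w" and i: "i \<in> {1..<n}"
    and opr: "(opp = e_pair \<and> opr = raise) \<or> (opp = f_pair \<and> opr = lower)"
  shows "on_factors opp i (unprime a) = map_option unprime (on_factors opp i a)"
proof -
  have ua: "unprime a \<in> RF_plus n w" "marked (concat (unprime a)) = {}"
    using unprime_RF(1)[OF a] by (auto simp: RF_def RF_plus_marked_def)
  note 1 = on_factors_op[OF a i opr] and 2 = on_factors_op[OF ua(1) i opr]
  have e: "map_option supports (on_factors opp i (unprime a)) = map_option supports (on_factors opp i a)"
    using 1(1) 2(1) unprime_RF(2)[OF a] by simp
  show ?thesis
  proof (cases "on_factors opp i a")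
    case None
    then show ?thesis using e by simp
  next
    case (Some b)
    then obtain b' where b': "on_factors opp i (unprime a) = Some b'" "supports b' = supports b" using e by auto
    have b: "b \<in> RF_plus n w" using 1(2)[OF Some] by blast
    have b'F: "b' \<in> RF_plus n w" "marked (concat b') = {}" using 2(2)[OF b'(1)] ua(2) by auto
    have ub: "unprime b \<in> RF_plus n w" "marked (concat (unprime b)) = {}"
      using unprime_RF(1)[OF b] by (auto simp: RF_def RF_plus_marked_def)
    have "b' = unprime b"
      using b'(2) unprime_RF(2)[OF b] ub(2) b'F(2) by (intro RF_plus_inject[OF b'F(1) ub(1)]) simp_all
    then show ?thesis using b'(1) Some by simp
  qed
qed

text \<open>All letters come from the finitely many reduced words of \<open>w\<close>. Finiteness
  supplies the common bound for the letters in \<open>tensor_embedding\<close>.\<close>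

lemma finite_supports_RF: "finite (supports ` RF_plus n w)"
proof -
  define L where "L = \<Union> (set ` {c. word_perm c = w \<and> reduced c})"
  have "finite L" unfolding L_def using finite_reduced_words[of w] by auto
  then have fin: "finite {s. set s \<subseteq> Pow L \<and> length s = n}" by (intro finite_lists_length_eq) simp
  have "supports a \<in> {s. set s \<subseteq> Pow L \<and> length s = n}" if "a \<in> RF_plus n w" for a
  proof -
    note D = RF_plusD[OF that]
    have "\<Union> (set (supports a)) \<subseteq> L"
      using set_word[OF finite_supports[of a]] D(3,4) by (auto simp: L_def)
    then show ?thesis using D(1) by auto
  qed
  then have "supports ` RF_plus n w \<subseteq> {s. set s \<subseteq> Pow L \<and> length s = n}" by blast
  then show ?thesis using fin by (rule finite_subset)
qed

lemma finite_RF_plus: "finite (RF_plus n w)"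
proof (cases "RF_plus n w = {}")
  case False
  then obtain a where a: "a \<in> RF_plus n w" by blast
  have Iw: "finite (Inv w)" using RF_plusD(4)[OF a] finite_Inv_word_perm by blast
  have "(\<lambda>a. (supports a, marked (concat a))) ` RF_plus n w \<subseteq> supports ` RF_plus n w \<times> Pow (Inv w)"
  proof clarify
    fix b assume b: "b \<in> RF_plus n w"
    note D = RF_plusD[OF b]
    have "marked (concat b) \<subseteq> set (inv_labels (word (supports b)))"
      unfolding marked_labels D(2) by auto
    also have "\<dots> = Inv w" using inv_labels_reduced(2)[OF D(3)] D(4) by simp
    finally show "supports b \<in> supports ` RF_plus n w \<and> marked (concat b) \<in> Pow (Inv w)" using b by auto
  qed
  moreover have "inj_on (\<lambda>a. (supports a, marked (concat a))) (RF_plus n w)"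
    by (rule inj_onI) (auto intro: RF_plus_inject)
  ultimately show ?thesis using finite_supports_RF Iw by (meson finite_SigmaI finite_Pow_iff inj_on_finite)
qed simp

text \<open>\<open>M\<close> is the family of permitted mark sets: a singleton gives the
  factorizations with fixed marks and \<open>UNIV\<close> gives all of them, so both crystals are
  treated at once.\<close>

lemma ops_closed_RF:
  "ops_closed n (factorization_crystal {a \<in> RF_plus n w. marked (concat a) \<in> M})"
  unfolding ops_closed_def factorization_crystal_def crystal.simps
proof (intro ballI conjI subsetI)
  fix i a b assume i: "i \<in> {1..<n}" and a: "a \<in> {a \<in> RF_plus n w. marked (concat a) \<in> M}"
  have aR: "a \<in> RF_plus n w" using a by blast
  show "b \<in> {a \<in> RF_plus n w. marked (concat a) \<in> M}" if "b \<in> set_option (on_factors e_pair i a)"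
    using on_factors_op(2)[OF aR i, of e_pair raise b] a that by simp
  show "b \<in> {a \<in> RF_plus n w. marked (concat a) \<in> M}" if "b \<in> set_option (on_factors f_pair i a)"
    using on_factors_op(2)[OF aR i, of f_pair lower b] a that by simp
qed

text \<open>The tensor embedding sees supports only. The marks are constant under the operators, so
  they join the invariant and separate factorizations with equal supports.\<close>

lemma normal_RF:
  "normal_crystal n (factorization_crystal {a \<in> RF_plus n w. marked (concat a) \<in> M})"
proof -
  define X where "X = {a \<in> RF_plus n w. marked (concat a) \<in> M}"
  define N where "N = card (Inv w)"
  have XR: "a \<in> RF_plus n w" if "a \<in> X" for a using that by (simp add: X_def)
  have sX: "length s = n \<and> (\<forall>u\<in>set s. finite u) \<and> reduced (word s) \<and> length (word s) = N"
    if "s \<in> supports ` RF_plus n w" for s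
    using that RF_plusD(1,3,4) finite_supports reduced_iff_card_Inv by (auto simp: N_def)
  obtain \<Phi> and I :: "int set list \<Rightarrow> int set list" where
    P1: "\<And>a. a \<in> supports ` RF_plus n w \<Longrightarrow> \<Phi> a \<in> elems (tensor_power n N)"
    and P2: "\<And>a j. a \<in> supports ` RF_plus n w \<Longrightarrow> j \<in> {1..n} \<Longrightarrow> wt (tensor_power n N) (\<Phi> a) j = int (card (a ! (j - 1)))"
    and P3: "\<And>a i. a \<in> supports ` RF_plus n w \<Longrightarrow> i \<in> {1..<n} \<Longrightarrow> tensor_e i (\<Phi> a) = map_option \<Phi> (op_at raise i a)"
    and P4: "\<And>a i. a \<in> supports ` RF_plus n w \<Longrightarrow> i \<in> {1..<n} \<Longrightarrow> tensor_f i (\<Phi> a) = map_option \<Phi> (op_at lower i a)"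
    and P5: "\<And>a b i. a \<in> supports ` RF_plus n w \<Longrightarrow> i \<in> {1..<n} \<Longrightarrow> op_at raise i a = Some b \<or> op_at lower i a = Some b \<Longrightarrow> I b = I a"
    and P6: "\<And>a b. a \<in> supports ` RF_plus n w \<Longrightarrow> b \<in> supports ` RF_plus n w \<Longrightarrow> \<Phi> a = \<Phi> b \<Longrightarrow> I a = I b \<Longrightarrow> a = b"
    using tensor_embedding[OF finite_supports_RF[of n w] sX] by blast
  have E: "op_at raise i (supports a) = map_option supports (on_factors e_pair i a)"
    "op_at lower i (supports a) = map_option supports (on_factors f_pair i a)" if "a \<in> X" "i \<in> {1..<n}" for a i
    using on_factors_op(1)[OF XR[OF that(1)] that(2)] by blast+
  have "normal_crystal n (factorization_crystal X)"
  proof (rule normal_crystalI[where \<Phi> = "\<Phi> \<circ> supports" and N = N and I = "\<lambda>a. (I (supports a), marked (concat a))"])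
    show "finite (elems (factorization_crystal X))"
      using finite_RF_plus[of n w] by (simp add: factorization_crystal_def X_def)
    show "ops_closed n (factorization_crystal X)" unfolding X_def by (rule ops_closed_RF)
  next
    fix a assume "a \<in> elems (factorization_crystal X)"
    then have a: "a \<in> X" by (simp add: factorization_crystal_def)
    have sa: "supports a \<in> supports ` RF_plus n w" using XR[OF a] by blast
    show "(\<Phi> \<circ> supports) a \<in> elems (tensor_power n N)" using P1[OF sa] by simp
    show "wt (tensor_power n N) ((\<Phi> \<circ> supports) a) j = wt (factorization_crystal X) a j" if j: "j \<in> {1..n}" for j
    proof -
      note D = RF_plusD[OF XR[OF a]]
      have jl: "j - 1 < length a" "1 \<le> j" "j \<le> length a" using j D(1) by auto
      then have "map ceiling (a ! (j - 1)) = dec (ceiling ` set (a ! (j - 1)))" by (intro D(6)) simp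
      then have "length (a ! (j - 1)) = card (ceiling ` set (a ! (j - 1)))" by (metis length_map length_dec)
      then show ?thesis using P2[OF sa j] jl by (simp add: factorization_crystal_def factor_wt_def supports_def)
    qed
    fix i assume i: "i \<in> {1..<n}"
    show "tensor_e i ((\<Phi> \<circ> supports) a) = map_option (\<Phi> \<circ> supports) (e_op (factorization_crystal X) i a)"
      "tensor_f i ((\<Phi> \<circ> supports) a) = map_option (\<Phi> \<circ> supports) (f_op (factorization_crystal X) i a)"
      using P3[OF sa i] P4[OF sa i] E[OF a i] by (simp_all add: factorization_crystal_def option.map_comp)
    fix b assume "e_op (factorization_crystal X) i a = Some b \<or> f_op (factorization_crystal X) i a = Some b"
    then have b: "on_factors e_pair i a = Some b \<or> on_factors f_pair i a = Some b" by (simp add: factorization_crystal_def)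
    then have "op_at raise i (supports a) = Some (supports b) \<or> op_at lower i (supports a) = Some (supports b)"
      using E[OF a i] by auto
    then have "I (supports b) = I (supports a)" by (rule P5[OF sa i])
    moreover have "marked (concat b) = marked (concat a)"
      using b on_factors_op(2)[OF XR[OF a] i] by blast
    ultimately show "(I (supports b), marked (concat b)) = (I (supports a), marked (concat a))" by simp
  next
    fix a b assume "a \<in> elems (factorization_crystal X)" "b \<in> elems (factorization_crystal X)"
      and eq: "(\<Phi> \<circ> supports) a = (\<Phi> \<circ> supports) b" "(I (supports a), marked (concat a)) = (I (supports b), marked (concat b))"
    then have ab: "a \<in> RF_plus n w" "b \<in> RF_plus n w" using XR by (simp_all add: factorization_crystal_def)
    have "supports a = supports b" using eq by (intro P6[OF imageI[OF ab(1)] imageI[OF ab(2)]]) simp_all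
    then show "a = b" using eq(2) by (intro RF_plus_inject[OF ab]) simp_all
  qed
  then show ?thesis by (simp add: X_def)
qed

theorem theorem3p13:
  fixes w :: "int \<Rightarrow> int" and n :: nat and A :: "(int \<times> int) set"
  assumes "permutation w" and "n \<ge> 1" and "A \<subseteq> Inv w"
  shows "(RF_plus_marked n w A \<noteq> {} \<longrightarrow>
            normal_crystal n (factorization_crystal (RF_plus_marked n w A))) \<and>
         (RF_plus n w \<noteq> {} \<longrightarrow>
            normal_crystal n (factorization_crystal (RF_plus n w))) \<and>
         crystal_iso n (factorization_crystal (RF_plus_marked n w A))
           (factorization_crystal (RF n w)) unprime"
proof (intro conjI impI)
  have marked_eq: "RF_plus_marked n w B = {a \<in> RF_plus n w. marked (concat a) \<in> {B}}" for B
    by (auto simp: RF_plus_marked_def)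
  show "normal_crystal n (factorization_crystal (RF_plus_marked n w A))"
    unfolding marked_eq by (rule normal_RF)
  show "normal_crystal n (factorization_crystal (RF_plus n w))"
    using normal_RF[of n w UNIV] by simp
  have closed: "ops_closed n (factorization_crystal (RF_plus_marked n w B))" for B
    unfolding marked_eq by (rule ops_closed_RF)
  show "crystal_iso n (factorization_crystal (RF_plus_marked n w A)) (factorization_crystal (RF n w)) unprime"
    unfolding crystal_iso_def
  proof (intro conjI ballI)
    show "ops_closed n (factorization_crystal (RF_plus_marked n w A))" "ops_closed n (factorization_crystal (RF n w))"
      unfolding RF_def by (rule closed)+
    show "bij_betw unprime (elems (factorization_crystal (RF_plus_marked n w A))) (elems (factorization_crystal (RF n w)))"
      unfolding bij_betw_def factorization_crystal_def crystal.simps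
    proof (intro conjI inj_onI)
      fix a b assume ab: "a \<in> RF_plus_marked n w A" "b \<in> RF_plus_marked n w A" "unprime a = unprime b"
      then have R: "a \<in> RF_plus n w" "b \<in> RF_plus n w" and m: "marked (concat a) = marked (concat b)"
        by (auto simp: RF_plus_marked_def)
      have "supports a = supports b" using unprime_RF(2)[OF R(1)] unprime_RF(2)[OF R(2)] ab(3) by simp
      then show "a = b" using m by (rule RF_plus_inject[OF R])
    next
      show "unprime ` RF_plus_marked n w A = RF n w"
      proof
        show "unprime ` RF_plus_marked n w A \<subseteq> RF n w"
          using unprime_RF(1) by (auto simp: RF_plus_marked_def)
        show "RF n w \<subseteq> unprime ` RF_plus_marked n w A"
        proof
          fix a assume "a \<in> RF n w"
          then have a: "a \<in> RF_plus n w" "marked (concat a) = {}" by (auto simp: RF_def RF_plus_marked_def)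
          obtain b where b: "b \<in> RF_plus n w" "supports b = supports a" "marked (concat b) = A"
            using ex_marked[OF a(1) assms(3)] by blast
          have u: "unprime b \<in> RF_plus n w" "marked (concat (unprime b)) = {}"
            using unprime_RF(1)[OF b(1)] by (auto simp: RF_def RF_plus_marked_def)
          \<comment> \<open>Equal supports and no marks on either side.\<close>
          have "unprime b = a"
            using unprime_RF(2)[OF b(1)] b(2) u(2) a(2) by (intro RF_plus_inject[OF u(1) a(1)]) simp_all
          then show "a \<in> unprime ` RF_plus_marked n w A" using b by (auto simp: RF_plus_marked_def)
        qed
      qed
    qed
  next
    fix a j
    show "wt (factorization_crystal (RF n w)) (unprime a) j = wt (factorization_crystal (RF_plus_marked n w A)) a j"
      by (cases "1 \<le> j \<and> j \<le> length a") (auto simp: factorization_crystal_def factor_wt_def unprime_def)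
  next
    fix a i assume "a \<in> elems (factorization_crystal (RF_plus_marked n w A))" and i: "i \<in> {1..<n}"
    then have a: "a \<in> RF_plus n w" by (simp add: factorization_crystal_def RF_plus_marked_def)
    show "e_op (factorization_crystal (RF n w)) i (unprime a) =
        map_option unprime (e_op (factorization_crystal (RF_plus_marked n w A)) i a)"
      using on_factors_unprime[OF a i, of e_pair raise] by (simp add: factorization_crystal_def)
    show "f_op (factorization_crystal (RF n w)) i (unprime a) =
        map_option unprime (f_op (factorization_crystal (RF_plus_marked n w A)) i a)"
      using on_factors_unprime[OF a i, of f_pair lower] by (simp add: factorization_crystal_def)
  qed
qed

end
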